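(* Let $M$ be a nonsingular complex algebraic variety and $f:M\to\mathbb C$ a regular function such that $D=f^{-1}(0)=\bigcup_{i\in I}D_i$ is a divisor with simple normal crossings; fix the line bundles $L_i$ and sections $s_i$ associated with the $D_i$ as in the context. Then the motivic Milnor fibre $\mathcal S_f\in K_0(\mathrm{Var}_{D\times\mathbb C^*}^{\mathbb C^*})$ is determined by the stratified topological Milnor fibration $\mathrm{sign} f:(M,D)^{\mathrm{top}}_{|D}\to S^1$. That is, if $g:M\to\mathbb C$ is another regular function with $g^{-1}(0)=D$ and $\mathrm{sign} f=\mathrm{sign} g$ on $(M,D)^{\mathrm{top}}_{|D}$, then $\mathcal S_f=\mathcal S_g$.
   Context: **Set-up.** $D=\bigcup_{i\in I}D_i$ with $I$ finite and $D_i$ nonsingular hypersurfaces meeting transversally. For $i\in I$, $L_i\to M$ is the algebraic line bundle associated with $D_i$ and $s_i$ is a regular section of $L_i$, transverse to the zero section, with zero locus $D_i$. Then $f=u\prod_{i\in I}s_i^{N_i}$ with integers $N_i\ge1$ and $u$ a nowhere vanishing regular section of $\bigotimes_iL_i^{-N_i}$. For $J\subset I$: $D_J=\bigcap_{j\in J}D_j$, $D_J^\circ=D_J\setminus\bigcup_{i\notin J}D_i$. For a line bundle $L$, $L^*$ is $L$ minus its zero section and $\mathbb S(L)=L^*/\mathbb R_{>0}$. **The maps.** For $\varnothing\ne J\subset I$, $L_J^\star$ is the fibre product over $D_J^\circ$ of the $L^*_{j|D_J^\circ}$, $j\in J$, with projection $\pi_J:L_J^\star\to D_J^\circ\subset D$,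 and $f_J:L_J^\star\to\mathbb C^*$ is $f_J(x,(v_j)_{j\in J})=u_J(x)\prod_{j\in J}v_j^{N_j}$ with $u_J=u\prod_{i\notin J}s_i^{N_i}$ over $D_J^\circ$. $(M,D)^{\mathrm{top}}$ is the fibre product over $M$ of the real oriented blowings-up $\widehat M_i=\{(x,\theta):\theta\in\mathbb S(L_i)_x,\ \theta=s_i(x)\bmod\mathbb R_{>0}\text{ if }x\notin D_i\}$. Over $D_J^\circ$ it is identified with the fibre product over $D_J^\circ$ of the $\mathbb S(L_{j|D_J^\circ})$, $j\in J$, i.e. with $L_J^\star/(\mathbb R_{>0})^J$. The map $\mathrm{sign} f:(M,D)^{\mathrm{top}}_{|D}\to S^1$ is given over $D_J^\circ$, $J\ne\varnothing$, by $\mathrm{sign} f_J(x,(\theta_j)_{j\in J})=f_J(x,(v_j))/|f_J(x,(v_j))|$ for any $v_j\in L^*_{j,x}$ with $v_j\bmod\mathbb R_{>0}=\theta_j$. **Grothendieck ring.** For $n\ge1$, objects of $\mathrm{Var}_{D\times\mathbb C^*}^{\mathbb C^*,n}$ are morphisms $\phi:Y\to D\times\mathbb C^*$, $Y$ a complex algebraic variety with a good $\mathbb C^*$-action (every orbit is contained in an affine open subset), such that the fibres of $\mathrm{pr}_D\circ\phi$ are $\mathbb C^*$-invariant and $\mathrm{pr}_{\mathbb C^*}\phi(\lambda\cdot y)=\lambda^n\,\mathrm{pr}_{\mathbb C^*}\phi(y)$; morphisms are equivariant morphisms over $D\times\mathbb C^*$. $K_0(\mathrm{Var}_{D\times\mathbb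 C^*}^{\mathbb C^*,n})$ is the free abelian group on isomorphism classes modulo: (i) $[\phi]=[\phi_{|Y\setminus W}]+[\phi_{|W}]$ for $W\subset Y$ closed invariant; (ii) for $\phi:\mathbb C^*\curvearrowright_\tau Y\to D\times\mathbb C^*$ and two good actions $\sigma,\sigma'$ on $Y\times\mathbb C^m$ lifting $\tau$, $[\phi\circ\mathrm{pr}_Y,\sigma]=[\phi\circ\mathrm{pr}_Y,\sigma']$. The product is the fibre product over $D\times\mathbb C^*$ with diagonal action. $K_0(\mathrm{Var}_{D\times\mathbb C^*}^{\mathbb C^*})=\varinjlim_n K_0(\mathrm{Var}_{D\times\mathbb C^*}^{\mathbb C^*,n})$, where the transition map from level $n$ to level $kn$ replaces the action $\lambda\cdot y$ by $\lambda^k\cdot y$. **Motivic Milnor fibre.** $\mathcal S_f=-\sum_{\varnothing\neq J\subset I}(-1)^{|J|}[(\pi_J,f_J):\mathbb C^*\curvearrowright L_J^\star\to D\times\mathbb C^*]$, where $\mathbb C^*$ acts on $L_J^\star$ by $\lambda\cdot(x,(v_j))=(x,(\lambda^{k_j}v_j))$ for some $k\in\mathbb N_{>0}^J$ (the class does not depend on $k$). *)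

theory Defs
  imports "HOL-Analysis.Analysis" "HOL-Algebra.Free_Abelian_Groups"
begin

text \<open>
  Complex algebraic varieties are treated classically (Serre, Kempf): a variety is a topological
  space (the closed points with the Zariski topology) together with the algebra of regular functions
  on each of its open sets.  Varieties are reduced and separated, of finite type over the complex
  numbers, and not necessarily irreducible.
\<close>

section \<open>Spaces with functions\<close>

record 'a fspace =
  zar :: "'a topology"
  reg :: "'a set \<Rightarrow> ('a \<Rightarrow> complex) set"

abbreviation pts :: "'a fspace \<Rightarrow> 'a set"
  where "pts X \<equiv> topspace (zar X)"

definition space_with_functions :: "'a fspace \<Rightarrow> bool" where
  "space_with_functions X \<longleftrightarrow>
     (\<forall>U V f. openin (zar X) U \<and> openin (zar X) V \<and> V \<subseteq> U \<and> f \<in> reg X U \<longrightarrow> f \<in> reg X V) \<and>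
     (\<forall>U f. openin (zar X) U \<and>
        (\<forall>x\<in>U. \<exists>V g. openin (zar X) V \<and> x \<in> V \<and> V \<subseteq> U \<and> g \<in> reg X V \<and> (\<forall>y\<in>V. f y = g y))
        \<longrightarrow> f \<in> reg X U) \<and>
     (\<forall>U c. openin (zar X) U \<longrightarrow> (\<lambda>_. c) \<in> reg X U) \<and>
     (\<forall>U f g. openin (zar X) U \<and> f \<in> reg X U \<and> g \<in> reg X U \<longrightarrow>
        (\<lambda>x. f x + g x) \<in> reg X U \<and> (\<lambda>x. f x * g x) \<in> reg X U) \<and>
     (\<forall>U f. openin (zar X) U \<and> f \<in> reg X U \<longrightarrow>
        openin (zar X) {x\<in>U. f x \<noteq> 0} \<and> (\<lambda>x. inverse (f x)) \<in> reg X {x\<in>U. f x \<noteq> 0})"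

definition morphism :: "'a fspace \<Rightarrow> 'b fspace \<Rightarrow> ('a \<Rightarrow> 'b) \<Rightarrow> bool" where
  "morphism X Y \<phi> \<longleftrightarrow> continuous_map (zar X) (zar Y) \<phi> \<and>
     (\<forall>V f. openin (zar Y) V \<and> f \<in> reg Y V \<longrightarrow> f \<circ> \<phi> \<in> reg X {x \<in> pts X. \<phi> x \<in> V})"

definition isomorphism :: "'a fspace \<Rightarrow> 'b fspace \<Rightarrow> ('a \<Rightarrow> 'b) \<Rightarrow> bool" where
  "isomorphism X Y \<phi> \<longleftrightarrow> morphism X Y \<phi> \<and>
     (\<exists>\<psi>. morphism Y X \<psi> \<and> (\<forall>x\<in>pts X. \<psi> (\<phi> x) = x) \<and> (\<forall>y\<in>pts Y. \<phi> (\<psi> y) = y))"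

text \<open>
  The coarsest structure on the set \<open>P\<close> for which the given partial functions
  \<open>(U, f) \<in> A\<close> have open domain and are regular: its open sets are generated by the domains of
  the algebraic expressions (with division) in the members of \<open>A\<close>, and its regular functions are
  locally given by such expressions.  Affine spaces, subvarieties with their reduced structure,
  products and fibre products are all of this form.
\<close>

inductive_set expressions ::
    "'a set \<Rightarrow> ('a set \<times> ('a \<Rightarrow> complex)) set \<Rightarrow> ('a set \<times> ('a \<Rightarrow> complex)) set"
  for P A where
  base: "(U, f) \<in> A \<Longrightarrow> (U \<inter> P, f) \<in> expressions P A"
| const: "(P, \<lambda>_. c) \<in> expressions P A"
| add: "(U, f) \<in> expressions P A \<Longrightarrow> (V, g) \<in> expressions P A \<Longrightarrow>
    (U \<inter> V, \<lambda>x. f x + g x) \<in> expressions P A"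
| mult: "(U, f) \<in> expressions P A \<Longrightarrow> (V, g) \<in> expressions P A \<Longrightarrow>
    (U \<inter> V, \<lambda>x. f x * g x) \<in> expressions P A"
| inv: "(U, f) \<in> expressions P A \<Longrightarrow>
    ({x\<in>U. f x \<noteq> 0}, \<lambda>x. inverse (f x)) \<in> expressions P A"

definition generated :: "'a set \<Rightarrow> ('a set \<times> ('a \<Rightarrow> complex)) set \<Rightarrow> 'a fspace" where
  "generated P A =
     \<lparr>zar = topology_generated_by (fst ` expressions P A),
      reg = (\<lambda>W. {f. \<forall>x\<in>W. \<exists>U g. (U, g) \<in> expressions P A \<and> x \<in> U \<and> (\<forall>y\<in>U \<inter> W. f y = g y)})\<rparr>"

definition sections :: "'a fspace \<Rightarrow> ('a set \<times> ('a \<Rightarrow> complex)) set" where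
  "sections X = {(U, f). openin (zar X) U \<and> f \<in> reg X U}"

definition pullback :: "('a \<Rightarrow> 'b) \<Rightarrow> ('b set \<times> ('b \<Rightarrow> complex)) set \<Rightarrow> ('a set \<times> ('a \<Rightarrow> complex)) set"
  where "pullback p A = (\<lambda>(U, f). (p -` U, f \<circ> p)) ` A"

definition subspace :: "'a fspace \<Rightarrow> 'a set \<Rightarrow> 'a fspace" where
  "subspace X S = generated (S \<inter> pts X) (sections X)"

definition product :: "'a fspace \<Rightarrow> 'b fspace \<Rightarrow> ('a \<times> 'b) fspace" where
  "product X Y =
     generated (pts X \<times> pts Y) (pullback fst (sections X) \<union> pullback snd (sections Y))"

section \<open>Varieties\<close>

definition affine_space :: "nat \<Rightarrow> (nat \<Rightarrow> complex) fspace" where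
  "affine_space n = generated {x. \<forall>i\<ge>n. x i = 0} {(UNIV, \<lambda>x. x i) | i. i < n}"

definition affine_line :: "complex fspace" where
  "affine_line = generated UNIV {(UNIV, \<lambda>z. z)}"

definition Gm :: "complex fspace" where
  "Gm = subspace affine_line {z. z \<noteq> 0}"

definition affine_variety :: "'a fspace \<Rightarrow> bool" where
  "affine_variety X \<longleftrightarrow> space_with_functions X \<and>
     (\<exists>n Z \<phi>. closedin (zar (affine_space n)) Z \<and> isomorphism X (subspace (affine_space n) Z) \<phi>)"

definition variety :: "'a fspace \<Rightarrow> bool" where
  "variety X \<longleftrightarrow> space_with_functions X \<and>
     (\<exists>\<U>. finite \<U> \<and> \<Union>\<U> = pts X \<and> (\<forall>U\<in>\<U>. openin (zar X) U \<and> affine_variety (subspace X U))) \<and>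
     closedin (zar (product X X)) {(x, x) | x. x \<in> pts X}"

section \<open>Local rings and nonsingularity\<close>

definition germ :: "'a fspace \<Rightarrow> 'a \<Rightarrow> ('a \<Rightarrow> complex) set" where
  "germ X x = {h. \<exists>U. openin (zar X) U \<and> x \<in> U \<and> h \<in> reg X U}"

definition locally_equal :: "'a fspace \<Rightarrow> 'a \<Rightarrow> ('a \<Rightarrow> complex) \<Rightarrow> ('a \<Rightarrow> complex) \<Rightarrow> bool" where
  "locally_equal X x g h \<longleftrightarrow> (\<exists>U. openin (zar X) U \<and> x \<in> U \<and> (\<forall>y\<in>U. g y = h y))"

definition max_ideal :: "'a fspace \<Rightarrow> 'a \<Rightarrow> ('a \<Rightarrow> complex) set" where
  "max_ideal X x = {h \<in> germ X x. h x = 0}"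

definition max_ideal_sq :: "'a fspace \<Rightarrow> 'a \<Rightarrow> ('a \<Rightarrow> complex) set" where
  "max_ideal_sq X x = {h \<in> germ X x. \<exists>(n::nat) a b.
     (\<forall>i<n. a i \<in> max_ideal X x \<and> b i \<in> max_ideal X x) \<and>
     locally_equal X x h (\<lambda>y. \<Sum>i<n. a i y * b i y)}"

definition irreducible_closed :: "'a topology \<Rightarrow> 'a set \<Rightarrow> bool" where
  "irreducible_closed T Z \<longleftrightarrow> closedin T Z \<and> Z \<noteq> {} \<and>
     (\<forall>A B. closedin T A \<and> closedin T B \<and> Z = A \<union> B \<longrightarrow> Z = A \<or> Z = B)"

text \<open>The Krull dimension of the local ring at \<open>x\<close>: its prime ideals correspond to the
  irreducible closed subsets through \<open>x\<close>.\<close>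

definition local_dim :: "'a fspace \<Rightarrow> 'a \<Rightarrow> enat" where
  "local_dim X x = Sup {enat r | r. \<exists>Z :: nat \<Rightarrow> 'a set.
     (\<forall>i\<le>r. irreducible_closed (zar X) (Z i) \<and> x \<in> Z i) \<and> (\<forall>i<r. Z i \<subset> Z (Suc i))}"

text \<open>Every local ring is regular: its maximal ideal is generated by as many elements as its
  dimension.\<close>

definition nonsingular :: "'a fspace \<Rightarrow> bool" where
  "nonsingular X \<longleftrightarrow> (\<forall>x\<in>pts X. \<exists>d t. local_dim X x = enat d \<and>
     (\<forall>i<d. t i \<in> max_ideal X x) \<and>
     (\<forall>h\<in>max_ideal X x. \<exists>a. (\<forall>i<d. a i \<in> germ X x) \<and>
        locally_equal X x h (\<lambda>y. \<Sum>i<d. a i y * t i y)))"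

text \<open>A hypersurface, having codimension one, is in particular nonempty; it need not be
  connected.\<close>

definition nonsingular_hypersurface :: "'a fspace \<Rightarrow> 'a set \<Rightarrow> bool" where
  "nonsingular_hypersurface M E \<longleftrightarrow> closedin (zar M) E \<and> E \<noteq> {} \<and>
     nonsingular (subspace M E) \<and>
     (\<forall>x\<in>E. local_dim M x = local_dim (subspace M E) x + 1)"

text \<open>Transversality at a point \<open>x\<close> of hypersurfaces through \<open>x\<close>: their conormal lines (classes modulo
  the square of the maximal ideal of the germs vanishing on the hypersurface) are linearly
  independent in the cotangent space.\<close>

definition meet_transversally :: "'a fspace \<Rightarrow> 'i set \<Rightarrow> ('i \<Rightarrow> 'a set) \<Rightarrow> bool" where
  "meet_transversally M I Di \<longleftrightarrow> (\<forall>x\<in>pts M. \<forall>h.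
     (\<forall>j\<in>{i\<in>I. x \<in> Di i}. h j \<in> germ M x \<and>
        (\<exists>U. openin (zar M) U \<and> x \<in> U \<and> (\<forall>y\<in>U \<inter> Di j. h j y = 0))) \<and>
     (\<lambda>y. \<Sum>j\<in>{i\<in>I. x \<in> Di i}. h j y) \<in> max_ideal_sq M x \<longrightarrow>
     (\<forall>j\<in>{i\<in>I. x \<in> Di i}. h j \<in> max_ideal_sq M x))"

section \<open>Line bundles\<close>

text \<open>Fibrewise addition is not recorded: on a line, commuting with scalars is the same as being
  linear.\<close>

record ('a, 'l) lbundle =
  tot :: "'l fspace"
  proj :: "'l \<Rightarrow> 'a"
  smul :: "complex \<Rightarrow> 'l \<Rightarrow> 'l"

definition trivialization ::
    "'a fspace \<Rightarrow> ('a, 'l) lbundle \<Rightarrow> 'a set \<Rightarrow> ('l \<Rightarrow> 'a \<times> complex) \<Rightarrow> bool" where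
  "trivialization M L U \<Phi> \<longleftrightarrow> openin (zar M) U \<and>
     isomorphism (subspace (tot L) {v. proj L v \<in> U}) (product (subspace M U) affine_line) \<Phi> \<and>
     (\<forall>v\<in>pts (tot L). proj L v \<in> U \<longrightarrow>
        fst (\<Phi> v) = proj L v \<and> (\<forall>c. snd (\<Phi> (smul L c v)) = c * snd (\<Phi> v)))"

definition line_bundle :: "'a fspace \<Rightarrow> ('a, 'l) lbundle \<Rightarrow> bool" where
  "line_bundle M L \<longleftrightarrow> variety (tot L) \<and> morphism (tot L) M (proj L) \<and>
     (\<forall>c. \<forall>v\<in>pts (tot L). smul L c v \<in> pts (tot L) \<and> proj L (smul L c v) = proj L v) \<and>
     (\<forall>x\<in>pts M. \<exists>U \<Phi>. x \<in> U \<and> trivialization M L U \<Phi>)"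

definition fibre :: "('a, 'l) lbundle \<Rightarrow> 'a \<Rightarrow> 'l set" where
  "fibre L x = {v \<in> pts (tot L). proj L v = x}"

definition is_zero :: "('a, 'l) lbundle \<Rightarrow> 'l \<Rightarrow> bool" where
  "is_zero L v \<longleftrightarrow> smul L 0 v = v"

definition fibre_star :: "('a, 'l) lbundle \<Rightarrow> 'a \<Rightarrow> 'l set" where
  "fibre_star L x = {v \<in> fibre L x. \<not> is_zero L v}"

definition regular_section :: "'a fspace \<Rightarrow> ('a, 'l) lbundle \<Rightarrow> ('a \<Rightarrow> 'l) \<Rightarrow> bool" where
  "regular_section M L s \<longleftrightarrow> morphism M (tot L) s \<and> (\<forall>x\<in>pts M. proj L (s x) = x)"

definition zero_locus :: "'a fspace \<Rightarrow> ('a, 'l) lbundle \<Rightarrow> ('a \<Rightarrow> 'l) \<Rightarrow> 'a set" where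
  "zero_locus M L s = {x \<in> pts M. is_zero L (s x)}"

text \<open>In a local trivialization, the differential of the section (its class modulo the square of the
  maximal ideal) does not vanish at the zeros of the section.\<close>

definition transverse_to_zero :: "'a fspace \<Rightarrow> ('a, 'l) lbundle \<Rightarrow> ('a \<Rightarrow> 'l) \<Rightarrow> bool" where
  "transverse_to_zero M L s \<longleftrightarrow> (\<forall>x\<in>zero_locus M L s. \<forall>U \<Phi>.
     x \<in> U \<and> trivialization M L U \<Phi> \<longrightarrow> (\<lambda>y. snd (\<Phi> (s y))) \<notin> max_ideal_sq M x)"

text \<open>The fibre product over \<open>M\<close> of the \<open>L j\<close>, \<open>j \<in> J\<close>.\<close>

definition fibre_product ::
    "'a fspace \<Rightarrow> ('i \<Rightarrow> ('a, 'l) lbundle) \<Rightarrow> 'i set \<Rightarrow> ('a \<times> ('i \<Rightarrow> 'l)) fspace" where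
  "fibre_product M L J =
     generated {(x, v). x \<in> pts M \<and> v \<in> (\<Pi>\<^sub>E j\<in>J. fibre (L j) x)}
       (pullback fst (sections M) \<union>
        (\<Union>j\<in>J. pullback (\<lambda>(x, v). v j) (sections (tot (L j)))))"

section \<open>Simple normal crossings\<close>

definition snc_data ::
    "'a fspace \<Rightarrow> ('i \<Rightarrow> ('a, 'l) lbundle) \<Rightarrow> ('i \<Rightarrow> 'a \<Rightarrow> 'l) \<Rightarrow> 'i set \<Rightarrow> ('i \<Rightarrow> 'a set) \<Rightarrow> bool" where
  "snc_data M L s I Di \<longleftrightarrow> finite I \<and>
     (\<forall>i\<in>I. nonsingular_hypersurface M (Di i)) \<and> meet_transversally M I Di \<and>
     (\<forall>i\<in>I. line_bundle M (L i) \<and> regular_section M (L i) (s i) \<and>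
        transverse_to_zero M (L i) (s i) \<and> zero_locus M (L i) (s i) = Di i)"

text \<open>
  The fibre at \<open>x\<close> of the tensor product of the bundles \<open>L\<^sub>i\<close> to the power \<open>-N\<^sub>i\<close> (with \<open>N\<^sub>i \<ge> 1\<close>) is the
  line of functions of \<open>v \<in> \<Prod>\<^sub>i L\<^sub>i\<^sub>,\<^sub>x\<close> that are homogeneous of degree \<open>N\<^sub>i\<close> in each \<open>v\<^sub>i\<close>, so a regular
  section \<open>u\<close> is a regular function on the fibre product of the \<open>L\<^sub>i\<close> with this homogeneity.  The value
  \<open>u (x, v)\<close> is the number usually written \<open>u(x) \<Prod>\<^sub>i v\<^sub>i\<^bsup>N\<^sub>i\<^esup>\<close>.
\<close>

definition nowhere_vanishing_section_neg_tensor ::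
    "'a fspace \<Rightarrow> ('i \<Rightarrow> ('a, 'l) lbundle) \<Rightarrow> 'i set \<Rightarrow> ('i \<Rightarrow> nat) \<Rightarrow> ('a \<times> ('i \<Rightarrow> 'l) \<Rightarrow> complex) \<Rightarrow> bool"
  where
  "nowhere_vanishing_section_neg_tensor M L I N u \<longleftrightarrow>
     u \<in> reg (fibre_product M L I) (pts (fibre_product M L I)) \<and>
     (\<forall>x\<in>pts M. \<forall>v \<in> (\<Pi>\<^sub>E i\<in>I. fibre (L i) x). \<forall>c :: 'i \<Rightarrow> complex.
        u (x, \<lambda>i\<in>I. smul (L i) (c i) (v i)) = (\<Prod>i\<in>I. c i ^ N i) * u (x, v)) \<and>
     (\<forall>x\<in>pts M. \<forall>v \<in> (\<Pi>\<^sub>E i\<in>I. fibre_star (L i) x). u (x, v) \<noteq> 0)"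

text \<open>The factorization \<open>f = u \<Prod>\<^sub>i s\<^sub>i\<^bsup>N\<^sub>i\<^esup>\<close>.\<close>

definition factorization ::
    "'a fspace \<Rightarrow> ('i \<Rightarrow> ('a, 'l) lbundle) \<Rightarrow> ('i \<Rightarrow> 'a \<Rightarrow> 'l) \<Rightarrow> 'i set \<Rightarrow>
     ('a \<Rightarrow> complex) \<Rightarrow> ('i \<Rightarrow> nat) \<Rightarrow> ('a \<times> ('i \<Rightarrow> 'l) \<Rightarrow> complex) \<Rightarrow> bool" where
  "factorization M L s I f N u \<longleftrightarrow> (\<forall>i\<in>I. N i \<ge> 1) \<and>
     nowhere_vanishing_section_neg_tensor M L I N u \<and>
     (\<forall>x\<in>pts M. f x = u (x, \<lambda>i\<in>I. s i x))"

definition stratum :: "'a fspace \<Rightarrow> 'i set \<Rightarrow> ('i \<Rightarrow> 'a set) \<Rightarrow> 'i set \<Rightarrow> 'a set" where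
  "stratum M I Di J = {x \<in> pts M. (\<forall>j\<in>J. x \<in> Di j) \<and> (\<forall>i\<in>I - J. x \<notin> Di i)}"

definition L_star ::
    "'a fspace \<Rightarrow> ('i \<Rightarrow> ('a, 'l) lbundle) \<Rightarrow> 'i set \<Rightarrow> ('i \<Rightarrow> 'a set) \<Rightarrow> 'i set \<Rightarrow>
     ('a \<times> ('i \<Rightarrow> 'l)) fspace" where
  "L_star M L I Di J = subspace (fibre_product M L J)
     {(x, v). x \<in> stratum M I Di J \<and> (\<forall>j\<in>J. v j \<in> fibre_star (L j) x)}"

text \<open>\<open>f\<^sub>J(x, v) = u\<^sub>J(x) \<Prod>\<^sub>j\<^sub>\<in>\<^sub>J v\<^sub>j\<^bsup>N\<^sub>j\<^esup>\<close>, where \<open>u\<^sub>J\<close> is \<open>u\<close> times the product of the \<open>s\<^sub>i\<^bsup>N\<^sub>i\<^esup>\<close> with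
  \<open>i \<notin> J\<close>.\<close>

definition f_strat ::
    "('i \<Rightarrow> 'a \<Rightarrow> 'l) \<Rightarrow> 'i set \<Rightarrow> ('a \<times> ('i \<Rightarrow> 'l) \<Rightarrow> complex) \<Rightarrow> 'i set \<Rightarrow>
     'a \<times> ('i \<Rightarrow> 'l) \<Rightarrow> complex" where
  "f_strat s I u J = (\<lambda>(x, v). u (x, \<lambda>i\<in>I. if i \<in> J then v i else s i x))"

section \<open>The stratified topological Milnor fibration\<close>

definition ray :: "('a, 'l) lbundle \<Rightarrow> 'l \<Rightarrow> 'l set" where
  "ray L v = {smul L (complex_of_real r) v | r. r > 0}"

definition circle_bundle :: "('a, 'l) lbundle \<Rightarrow> 'a \<Rightarrow> 'l set set" where
  "circle_bundle L x = ray L ` fibre_star L x"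

text \<open>\<open>(M,D)\<^sup>t\<^sup>o\<^sup>p\<close> as a set of pairs \<open>(x, \<theta>)\<close>.\<close>

definition MD_top ::
    "'a fspace \<Rightarrow> ('i \<Rightarrow> ('a, 'l) lbundle) \<Rightarrow> ('i \<Rightarrow> 'a \<Rightarrow> 'l) \<Rightarrow> 'i set \<Rightarrow> ('i \<Rightarrow> 'a set) \<Rightarrow>
     ('a \<times> ('i \<Rightarrow> 'l set)) set" where
  "MD_top M L s I Di = {(x, \<theta>). x \<in> pts M \<and> \<theta> \<in> (\<Pi>\<^sub>E i\<in>I. circle_bundle (L i) x) \<and>
     (\<forall>i\<in>I. x \<notin> Di i \<longrightarrow> \<theta> i = ray (L i) (s i x))}"

text \<open>The value does not depend on the chosen representatives \<open>v\<^sub>j\<close> of \<open>\<theta>\<^sub>j\<close>; note that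
  \<open>sgn z = z / \<bar>z\<bar>\<close> for complex \<open>z\<close>.\<close>

definition sign_map ::
    "('i \<Rightarrow> 'a \<Rightarrow> 'l) \<Rightarrow> 'i set \<Rightarrow> ('i \<Rightarrow> 'a set) \<Rightarrow> ('a \<times> ('i \<Rightarrow> 'l) \<Rightarrow> complex) \<Rightarrow>
     'a \<times> ('i \<Rightarrow> 'l set) \<Rightarrow> complex" where
  "sign_map s I Di u = (\<lambda>(x, \<theta>). let J = {j\<in>I. x \<in> Di j} in
     sgn (f_strat s I u J (x, \<lambda>j\<in>J. SOME v. v \<in> \<theta> j)))"

section \<open>The Grothendieck group of varieties with action\<close>

text \<open>Varieties over \<open>B \<times> \<complex>\<^sup>*\<close> with an action of \<open>\<complex>\<^sup>*\<close>.\<close>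

record ('b, 'y) gvar =
  var :: "'y fspace"
  act :: "complex \<Rightarrow> 'y \<Rightarrow> 'y"
  str :: "'y \<Rightarrow> 'b \<times> complex"

definition good_action :: "'y fspace \<Rightarrow> (complex \<Rightarrow> 'y \<Rightarrow> 'y) \<Rightarrow> bool" where
  "good_action Y \<sigma> \<longleftrightarrow> morphism (product Gm Y) Y (\<lambda>(z, y). \<sigma> z y) \<and>
     (\<forall>y\<in>pts Y. \<sigma> 1 y = y) \<and>
     (\<forall>z w. \<forall>y\<in>pts Y. z \<noteq> 0 \<and> w \<noteq> 0 \<longrightarrow> \<sigma> (z * w) y = \<sigma> z (\<sigma> w y)) \<and>
     (\<forall>y\<in>pts Y. \<exists>U. openin (zar Y) U \<and> affine_variety (subspace Y U) \<and> (\<forall>z. z \<noteq> 0 \<longrightarrow> \<sigma> z y \<in> U))"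

definition gvar_obj :: "'b fspace \<Rightarrow> nat \<Rightarrow> ('b, 'y) gvar \<Rightarrow> bool" where
  "gvar_obj B n X \<longleftrightarrow> variety (var X) \<and> good_action (var X) (act X) \<and>
     morphism (var X) (product B Gm) (str X) \<and>
     (\<forall>z. \<forall>y\<in>pts (var X). z \<noteq> 0 \<longrightarrow>
        fst (str X (act X z y)) = fst (str X y) \<and> snd (str X (act X z y)) = z ^ n * snd (str X y))"

definition gvar_iso :: "('b, 'y) gvar \<Rightarrow> ('b, 'z) gvar \<Rightarrow> bool" where
  "gvar_iso X Y \<longleftrightarrow> (\<exists>\<phi>. isomorphism (var X) (var Y) \<phi> \<and>
     (\<forall>z. \<forall>x\<in>pts (var X). z \<noteq> 0 \<longrightarrow> \<phi> (act X z x) = act Y z (\<phi> x)) \<and>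
     (\<forall>x\<in>pts (var X). str Y (\<phi> x) = str X x))"

text \<open>A variety has at most continuum many points, so every isomorphism class has members whose
  points are of the fixed type \<open>nat \<Rightarrow> complex\<close>; isomorphism classes are sets of such objects.\<close>

type_synonym 'b ugvar = "('b, nat \<Rightarrow> complex) gvar"

definition iso_class :: "'b fspace \<Rightarrow> nat \<Rightarrow> ('b, 'y) gvar \<Rightarrow> 'b ugvar set" where
  "iso_class B n X = {Y. gvar_obj B n Y \<and> gvar_iso X Y}"

definition iso_classes :: "'b fspace \<Rightarrow> nat \<Rightarrow> 'b ugvar set set" where
  "iso_classes B n = {iso_class B n X | X :: 'b ugvar. gvar_obj B n X}"

definition gvar_restrict :: "('b, 'y) gvar \<Rightarrow> 'y set \<Rightarrow> ('b, 'y) gvar" where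
  "gvar_restrict X S = X\<lparr>var := subspace (var X) S\<rparr>"

definition gvar_times ::
    "('b, 'y) gvar \<Rightarrow> nat \<Rightarrow> (complex \<Rightarrow> 'y \<times> (nat \<Rightarrow> complex) \<Rightarrow> 'y \<times> (nat \<Rightarrow> complex)) \<Rightarrow>
     ('b, 'y \<times> (nat \<Rightarrow> complex)) gvar" where
  "gvar_times X m \<sigma> = \<lparr>var = product (var X) (affine_space m), act = \<sigma>, str = str X \<circ> fst\<rparr>"

definition lifts_action ::
    "('b, 'y) gvar \<Rightarrow> nat \<Rightarrow> (complex \<Rightarrow> 'y \<times> (nat \<Rightarrow> complex) \<Rightarrow> 'y \<times> (nat \<Rightarrow> complex)) \<Rightarrow> bool" where
  "lifts_action X m \<sigma> \<longleftrightarrow> good_action (product (var X) (affine_space m)) \<sigma> \<and>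
     (\<forall>z. \<forall>p\<in>pts (product (var X) (affine_space m)). z \<noteq> 0 \<longrightarrow>
        fst (\<sigma> z p) = act X z (fst p))"

abbreviation gen_group :: "'b fspace \<Rightarrow> nat \<Rightarrow> ('b ugvar set \<Rightarrow>\<^sub>0 int) monoid"
  where "gen_group B n \<equiv> free_Abelian_group (iso_classes B n)"

definition relators :: "'b fspace \<Rightarrow> nat \<Rightarrow> ('b ugvar set \<Rightarrow>\<^sub>0 int) set" where
  "relators B n =
     {frag_of (iso_class B n X) - frag_of (iso_class B n (gvar_restrict X (pts (var X) - W)))
        - frag_of (iso_class B n (gvar_restrict X W)) | (X :: 'b ugvar) W.
        gvar_obj B n X \<and> closedin (zar (var X)) W \<and> (\<forall>z. \<forall>y\<in>W. z \<noteq> 0 \<longrightarrow> act X z y \<in> W)} \<union>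
     {frag_of (iso_class B n (gvar_times X m \<sigma>)) - frag_of (iso_class B n (gvar_times X m \<sigma>'))
        | (X :: 'b ugvar) m \<sigma> \<sigma>'.
        gvar_obj B n X \<and> lifts_action X m \<sigma> \<and> lifts_action X m \<sigma>'}"

definition rel_subgroup :: "'b fspace \<Rightarrow> nat \<Rightarrow> ('b ugvar set \<Rightarrow>\<^sub>0 int) set" where
  "rel_subgroup B n = generate (gen_group B n) (relators B n)"

text \<open>The additive groups of the Grothendieck rings, in the multiplicative notation of HOL-Algebra.\<close>

definition K0_level :: "'b fspace \<Rightarrow> nat \<Rightarrow> ('b ugvar set \<Rightarrow>\<^sub>0 int) set monoid" where
  "K0_level B n = gen_group B n Mod rel_subgroup B n"

definition class_level :: "'b fspace \<Rightarrow> nat \<Rightarrow> ('b, 'y) gvar \<Rightarrow> ('b ugvar set \<Rightarrow>\<^sub>0 int) set" where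
  "class_level B n X = rel_subgroup B n #>\<^bsub>gen_group B n\<^esub> frag_of (iso_class B n X)"

definition power_act :: "nat \<Rightarrow> ('b, 'y) gvar \<Rightarrow> ('b, 'y) gvar" where
  "power_act q X = X\<lparr>act := \<lambda>z. act X (z ^ q)\<rparr>"

text \<open>The map from level \<open>n\<close> to level \<open>m\<close>, for \<open>n\<close> dividing \<open>m\<close>, induced by \<open>power_act (m div n)\<close>.\<close>

definition transition ::
    "'b fspace \<Rightarrow> nat \<Rightarrow> nat \<Rightarrow> ('b ugvar set \<Rightarrow>\<^sub>0 int) set \<Rightarrow> ('b ugvar set \<Rightarrow>\<^sub>0 int) set" where
  "transition B n m A = the_elem ((\<lambda>a. rel_subgroup B m #>\<^bsub>gen_group B m\<^esub>
     frag_extend (\<lambda>C. frag_of (iso_class B m (power_act (m div n) (SOME X. X \<in> C)))) a) ` A)"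

text \<open>Direct limit of a system of abelian groups indexed by the positive integers ordered by
  divisibility.\<close>

definition limit_rel ::
    "(nat \<Rightarrow> 'g monoid) \<Rightarrow> (nat \<Rightarrow> nat \<Rightarrow> 'g \<Rightarrow> 'g) \<Rightarrow> ((nat \<times> 'g) \<times> (nat \<times> 'g)) set" where
  "limit_rel G \<tau> = {((n, a), (m, b)). n \<ge> 1 \<and> m \<ge> 1 \<and> a \<in> carrier (G n) \<and> b \<in> carrier (G m) \<and>
     (\<exists>l\<ge>1. n dvd l \<and> m dvd l \<and> \<tau> n l a = \<tau> m l b)}"

definition direct_limit ::
    "(nat \<Rightarrow> 'g monoid) \<Rightarrow> (nat \<Rightarrow> nat \<Rightarrow> 'g \<Rightarrow> 'g) \<Rightarrow> (nat \<times> 'g) set monoid" where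
  "direct_limit G \<tau> =
     \<lparr>carrier = (SIGMA n:{1..}. carrier (G n)) // limit_rel G \<tau>,
      mult = (\<lambda>P Q. \<Union>(n, a)\<in>P. \<Union>(m, b)\<in>Q.
        limit_rel G \<tau> `` {(n * m, \<tau> n (n * m) a \<otimes>\<^bsub>G (n * m)\<^esub> \<tau> m (n * m) b)}),
      one = limit_rel G \<tau> `` {(1, \<one>\<^bsub>G 1\<^esub>)}\<rparr>"

type_synonym 'b K0_elem = "(nat \<times> ('b ugvar set \<Rightarrow>\<^sub>0 int) set) set"

definition K0 :: "'b fspace \<Rightarrow> 'b K0_elem monoid" where
  "K0 B = direct_limit (K0_level B) (transition B)"

definition K0_class :: "'b fspace \<Rightarrow> nat \<Rightarrow> ('b, 'y) gvar \<Rightarrow> 'b K0_elem" where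
  "K0_class B n X = limit_rel (K0_level B) (transition B) `` {(n, class_level B n X)}"

section \<open>The motivic Milnor fibre\<close>

text \<open>\<open>(\<pi>\<^sub>J, f\<^sub>J)\<close> on \<open>L\<^sub>J\<^sup>\<star>\<close> with the action of weights \<open>k\<close>; it is an object of level
  \<open>\<Sum>\<^sub>j\<^sub>\<in>\<^sub>J k\<^sub>j N\<^sub>j\<close>.\<close>

definition milnor_gvar ::
    "'a fspace \<Rightarrow> ('i \<Rightarrow> ('a, 'l) lbundle) \<Rightarrow> ('i \<Rightarrow> 'a \<Rightarrow> 'l) \<Rightarrow> 'i set \<Rightarrow> ('i \<Rightarrow> 'a set) \<Rightarrow>
     ('a \<times> ('i \<Rightarrow> 'l) \<Rightarrow> complex) \<Rightarrow> 'i set \<Rightarrow> ('i \<Rightarrow> nat) \<Rightarrow> ('a, 'a \<times> ('i \<Rightarrow> 'l)) gvar" where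
  "milnor_gvar M L s I Di u J k =
     \<lparr>var = L_star M L I Di J,
      act = (\<lambda>z (x, v). (x, \<lambda>j\<in>J. smul (L j) (z ^ k j) (v j))),
      str = (\<lambda>(x, v). (x, f_strat s I u J (x, v)))\<rparr>"

text \<open>The positive weights \<open>k J\<close> used on each \<open>L\<^sub>J\<^sup>\<star>\<close>, on which the class does not depend, are an
  explicit parameter.\<close>

definition motivic_milnor_fibre ::
    "'a fspace \<Rightarrow> ('i \<Rightarrow> ('a, 'l) lbundle) \<Rightarrow> ('i \<Rightarrow> 'a \<Rightarrow> 'l) \<Rightarrow> 'i set \<Rightarrow> ('i \<Rightarrow> 'a set) \<Rightarrow>
     ('i set \<Rightarrow> 'i \<Rightarrow> nat) \<Rightarrow> ('i \<Rightarrow> nat) \<Rightarrow> ('a \<times> ('i \<Rightarrow> 'l) \<Rightarrow> complex) \<Rightarrow> 'a K0_elem" where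
  "motivic_milnor_fibre M L s I Di k N u =
     (let B = subspace M (\<Union>i\<in>I. Di i); K = K0 B in
      inv\<^bsub>K\<^esub> (\<Otimes>\<^bsub>K\<^esub>J\<in>{J. J \<subseteq> I \<and> J \<noteq> {}}.
        K0_class B (\<Sum>j\<in>J. k J j * N j) (milnor_gvar M L s I Di u J (k J))
          [^]\<^bsub>K\<^esub> ((-1) ^ card J :: int)))"

end

theory Submission
  imports Defs "HOL-Library.Function_Algebras"
    "HOL-Computational_Algebra.Fundamental_Theorem_Algebra"
begin

text \<open>
  Rotating one of the \<open>v\<^sub>j\<close> shows that equal signs force equal multiplicities.  Hence on the stratum of
  \<open>J\<close> the quotient \<open>f\<^sub>J / g\<^sub>J\<close> descends to a regular function with positive real values.  The regular
  functions on an affine variety form an algebra of countable dimension over the uncountable field \<open>\<complex>\<close>,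
  so a function that omits uncountably many values is algebraic over \<open>\<complex>\<close> and takes finitely many values:
  the quotient is locally constant in the Zariski topology.  Multiplying one coordinate \<open>v\<^sub>j\<close> by its
  positive \<open>N\<^sub>j\<close>-th root is then an equivariant isomorphism from \<open>(\<pi>\<^sub>J, f\<^sub>J)\<close> to \<open>(\<pi>\<^sub>J, g\<^sub>J)\<close>.
\<close>

section \<open>Algebras of functions\<close>

text \<open>A root of a nonconstant regular function need not be regular, so the rescaling is
  algebraic only because the quotient is Zariski locally constant. Positivity supplies both an
  uncountable set of omitted values and a canonical choice of root. Counting dimensions replaces any
  appeal to irreducible components, so reducible and disconnected strata need no separate treatment.
  The uncountability of \<complex> acts twice: it identifies the residue fields at maximal ideals
  with \<complex>, which turns a noninvertible difference into a point where the value is attained,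
  and it turns uncountably many invertible differences into one polynomial relation. A stratum is
  only locally closed, which is why the denominator of a local fraction is inverted inside the
  algebra. Quotient rings are never formed: all algebras consist of total functions, and congruence
  modulo an ideal replaces equality on a subset. The two motivic fibres then agree summand by
  summand, already at the level of isomorphism classes.\<close>

inductive_set function_algebra :: "('x \<Rightarrow> complex) set \<Rightarrow> ('x \<Rightarrow> complex) set"
  for G where
  gen: "g \<in> G \<Longrightarrow> g \<in> function_algebra G"
| const: "(\<lambda>_. c) \<in> function_algebra G"
| add: "a \<in> function_algebra G \<Longrightarrow> b \<in> function_algebra G \<Longrightarrow> (\<lambda>x. a x + b x) \<in> function_algebra G"
| mult: "a \<in> function_algebra G \<Longrightarrow> b \<in> function_algebra G \<Longrightarrow> (\<lambda>x. a x * b x) \<in> function_algebra G"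

lemma function_algebra_diff:
  assumes "a \<in> function_algebra G" "b \<in> function_algebra G"
  shows "(\<lambda>x. a x - b x) \<in> function_algebra G"
  using function_algebra.add[OF assms(1) function_algebra.mult[OF function_algebra.const[of "-1"] assms(2)]]
  by simp

lemma function_algebra_prod:
  assumes "\<And>i. i \<in> F \<Longrightarrow> a i \<in> function_algebra G"
  shows "(\<lambda>x. \<Prod>i\<in>F. a i x) \<in> function_algebra G"
  using assms
  by (induction F rule: infinite_finite_induct)
     (auto intro: function_algebra.mult function_algebra.const[of 1])

lemma function_algebra_poly:
  assumes "a \<in> function_algebra G"
  shows "(\<lambda>x. poly P (a x)) \<in> function_algebra G"
proof (induction P)
  case 0
  then show ?case using function_algebra.const[of 0] by simp
next
  case (pCons c P)
  from function_algebra.add[OF function_algebra.const[of c] function_algebra.mult[OF assms pCons(2)]]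
  show ?case by simp
qed

lemma function_algebra_mono: "G \<subseteq> H \<Longrightarrow> function_algebra G \<subseteq> function_algebra H"
proof
  fix a assume "G \<subseteq> H" "a \<in> function_algebra G"
  from this(2,1) show "a \<in> function_algebra H"
    by (induction rule: function_algebra.induct) (auto intro: function_algebra.intros)
qed

interpretation fun_space: vector_space "\<lambda>(c::complex) f (x::'x). c * f x"
  by unfold_locales (auto simp: fun_eq_iff algebra_simps)

text \<open>Monomials are indexed by words over \<open>G\<close>: concatenation is multiplication
  and the empty word is \<open>1\<close>. A countable \<open>G\<close> has countably many words,
  which is the source of the countable dimension.\<close>

lemma function_algebra_subset_span:
  "function_algebra G \<subseteq> fun_space.span ((\<lambda>l x. \<Prod>g\<leftarrow>l. g x) ` lists G)"
proof
  fix a assume "a \<in> function_algebra G"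
  let ?B = "(\<lambda>l x. \<Prod>g\<leftarrow>l. g x) ` lists G"
  have pr: "(\<lambda>x. a x * b x) \<in> fun_space.span ?B"
    if "a \<in> fun_space.span ?B" "b \<in> fun_space.span ?B" for a b
  proof -
    \<comment> \<open>Bilinearity in two stages: a monomial times an element of the span, then
      induction on the other factor.\<close>
    have 1: "(\<lambda>x. a x * b x) \<in> fun_space.span ?B" if a: "a \<in> ?B" and b: "b \<in> fun_space.span ?B" for a b
      using b
    proof (induction rule: fun_space.span_induct_alt)
      case base
      then show ?case using fun_space.span_zero by (simp add: zero_fun_def)
    next
      case (step c b y)
      obtain l l' where "l \<in> lists G" "l' \<in> lists G" "a = (\<lambda>x. \<Prod>g\<leftarrow>l. g x)" "b = (\<lambda>x. \<Prod>g\<leftarrow>l'. g x)"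
        using a step by auto
      then have "(\<lambda>x. a x * b x) \<in> ?B"
        by (intro image_eqI[of _ _ "l @ l'"]) auto
      then have "(\<lambda>x. c * (a x * b x)) + (\<lambda>x. a x * y x) \<in> fun_space.span ?B"
        by (intro fun_space.span_add fun_space.span_scale step(2)) (rule fun_space.span_base)
      then show ?case by (simp add: plus_fun_def algebra_simps)
    qed
    show ?thesis
      using that(1)
    proof (induction rule: fun_space.span_induct_alt)
      case base
      then show ?case using fun_space.span_zero by (simp add: zero_fun_def)
    next
      case (step c a y)
      have "(\<lambda>x. c * (a x * b x)) + (\<lambda>x. y x * b x) \<in> fun_space.span ?B"
        using step 1[OF step(1) that(2)] by (intro fun_space.span_add fun_space.span_scale)
      then show ?case by (simp add: plus_fun_def algebra_simps)
    qed
  qed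
  show "a \<in> fun_space.span ?B"
    using \<open>a \<in> function_algebra G\<close>
  proof (induction rule: function_algebra.induct)
    case (gen g)
    then have "g \<in> ?B" by (intro image_eqI[of _ _ "[g]"]) auto
    then show ?case by (rule fun_space.span_base)
  next
    case (const c)
    have "(\<lambda>_. 1) \<in> ?B" by (intro image_eqI[of _ _ "[]"]) auto
    from fun_space.span_scale[OF fun_space.span_base[OF this], of c]
    show ?case by simp
  next
    case (add a b)
    from fun_space.span_add[OF add(3,4)] show ?case by (simp add: plus_fun_def)
  next
    case (mult a b)
    then show ?case by (intro pr)
  qed
qed

text \<open>Linear dependence is a property of sets, while these vectors carry indices. If
  \<open>b\<close> is injective on \<open>\<Lambda>\<close>, an infinite set in a finite-dimensional
  span is dependent; otherwise two indices share a vector and the coefficients \<open>1\<close> and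
  \<open>-1\<close> give a relation.\<close>

lemma family_dependent:
  fixes b :: "'k \<Rightarrow> 'x \<Rightarrow> complex"
  assumes "infinite \<Lambda>" "finite t" "\<And>l. l \<in> \<Lambda> \<Longrightarrow> b l \<in> fun_space.span t"
  shows "\<exists>F c. finite F \<and> F \<subseteq> \<Lambda> \<and> (\<exists>l\<in>F. c l \<noteq> 0) \<and> (\<forall>x. (\<Sum>l\<in>F. c l * b l x) = 0)"
proof (cases "inj_on b \<Lambda>")
  case True
  then have "infinite (b ` \<Lambda>)" using assms(1) finite_imageD by blast
  then have "fun_space.dependent (b ` \<Lambda>)"
    using fun_space.independent_span_bound[OF assms(2)] assms(3) by blast
  then obtain S u where S: "finite S" "S \<subseteq> b ` \<Lambda>" "\<exists>v\<in>S. u v \<noteq> 0" "(\<Sum>v\<in>S. (\<lambda>x. u v * v x)) = 0"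
    unfolding fun_space.dependent_explicit by auto
  then obtain F where F: "F \<subseteq> \<Lambda>" "inj_on b F" "S = b ` F"
    using S(2) unfolding subset_image_inj by blast
  have "finite F" using F S(1) finite_imageD by blast
  moreover have "(\<Sum>l\<in>F. u (b l) * b l x) = 0" for x
  proof -
    have "(\<Sum>l\<in>F. u (b l) * b l x) = (\<Sum>v\<in>S. u v * v x)"
      unfolding F(3) using F(2) by (simp add: sum.reindex)
    also have "\<dots> = (\<Sum>v\<in>S. (\<lambda>x. u v * v x)) x"
      by (induction S rule: infinite_finite_induct) auto
    finally show ?thesis using S(4) by simp
  qed
  ultimately show ?thesis using F S(3) by (intro exI[of _ F] exI[of _ "\<lambda>l. u (b l)"]) auto
next
  case False
  then obtain l k where "l \<in> \<Lambda>" "k \<in> \<Lambda>" "l \<noteq> k" "b l = b k" by (auto simp: inj_on_def)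
  then show ?thesis
    by (intro exI[of _ "{l, k}"] exI[of _ "\<lambda>i. if i = l then 1 else -1"]) auto
qed

section \<open>Ideals in algebras of functions and a countable-dimension argument\<close>

definition function_ideal :: "('x \<Rightarrow> complex) set \<Rightarrow> ('x \<Rightarrow> complex) set \<Rightarrow> bool" where
  "function_ideal A m \<longleftrightarrow> m \<subseteq> A \<and> (\<lambda>_. 0) \<in> m \<and> (\<forall>a\<in>m. \<forall>b\<in>m. (\<lambda>x. a x + b x) \<in> m) \<and>
     (\<forall>a\<in>A. \<forall>b\<in>m. (\<lambda>x. a x * b x) \<in> m)"

lemma
  assumes "function_ideal A m"
  shows function_ideal_zero: "(\<lambda>_. 0) \<in> m"
    and function_ideal_add: "a \<in> m \<Longrightarrow> b \<in> m \<Longrightarrow> (\<lambda>x. a x + b x) \<in> m"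
    and function_ideal_mult: "c \<in> A \<Longrightarrow> a \<in> m \<Longrightarrow> (\<lambda>x. c x * a x) \<in> m"
  using assms by (simp_all add: function_ideal_def)

lemma function_ideal_sum:
  assumes "function_ideal A m" "\<And>i. i \<in> F \<Longrightarrow> a i \<in> m"
  shows "(\<lambda>x. \<Sum>i\<in>F. a i x) \<in> m"
  using assms(2)
  by (induction F rule: infinite_finite_induct) (use assms(1) in \<open>auto simp: function_ideal_def\<close>)

lemma function_ideal_diff:
  assumes "function_ideal (function_algebra G) m" "a \<in> m" "b \<in> m"
  shows "(\<lambda>x. a x - b x) \<in> m"
proof -
  have "(\<lambda>x. (-1) * b x) \<in> m"
    by (rule function_ideal_mult[OF assms(1) function_algebra.const assms(3)])
  from function_ideal_add[OF assms(1,2) this] have "(\<lambda>x. a x + (-1) * b x) \<in> m" .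
  then show ?thesis by simp
qed

text \<open>Each inverse \<open>b l\<close> needs only finitely many of countably many monomials, so
  infinitely many of them share one finite-dimensional span and satisfy a linear relation. Clearing
  the denominators of \<open>\<Sum> c l / (a - l)\<close> turns it into a polynomial relation for
  \<open>a\<close> modulo \<open>m\<close>.\<close>

lemma uncountable_inverses_imp_algebraic:
  assumes "countable G" and m: "function_ideal (function_algebra G) m"
    and a: "a \<in> function_algebra G" and "uncountable \<Lambda>"
    and "\<And>l. l \<in> \<Lambda> \<Longrightarrow> \<exists>b\<in>function_algebra G. (\<lambda>x. (a x - l) * b x - 1) \<in> m"
  shows "\<exists>P. P \<noteq> 0 \<and> (\<lambda>x. poly P (a x)) \<in> m"
proof -
  let ?B = "(\<lambda>l x. \<Prod>g\<leftarrow>l. g x) ` lists G"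
  obtain b where b: "\<And>l. l \<in> \<Lambda> \<Longrightarrow> b l \<in> function_algebra G"
      "\<And>l. l \<in> \<Lambda> \<Longrightarrow> (\<lambda>x. (a x - l) * b l x - 1) \<in> m"
    using assms(5) by metis
  have "\<exists>t. finite t \<and> t \<subseteq> ?B \<and> b l \<in> fun_space.span t" if "l \<in> \<Lambda>" for l
  proof -
    have "b l \<in> fun_space.span ?B" using b(1)[OF that] function_algebra_subset_span by blast
    then obtain t r where "finite t" "t \<subseteq> ?B" "b l = (\<Sum>v\<in>t. (\<lambda>x. r v * v x))"
      unfolding fun_space.span_explicit by blast
    moreover from this have "b l \<in> fun_space.span t"
      by (auto intro!: fun_space.span_sum fun_space.span_scale intro: fun_space.span_base)
    ultimately show ?thesis by blast
  qed
  then obtain t where t: "\<And>l. l \<in> \<Lambda> \<Longrightarrow> finite (t l) \<and> t l \<subseteq> ?B \<and> b l \<in> fun_space.span (t l)"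
    by metis
  have "countable ?B" using \<open>countable G\<close> by auto
  then have "countable {s. finite s \<and> s \<subseteq> ?B}" by (rule countable_Collect_finite_subset)
  then have "countable (t ` \<Lambda>)"
    by (rule countable_subset[rotated]) (use t in auto)
  \<comment> \<open>Pigeonhole: an uncountable set is not a countable union of countable fibres of
    \<open>t\<close>.\<close>
  have "\<exists>s. uncountable {l\<in>\<Lambda>. t l = s}"
  proof (rule ccontr)
    assume "\<not> ?thesis"
    then have "countable (\<Union>s\<in>t ` \<Lambda>. {l\<in>\<Lambda>. t l = s})"
      using \<open>countable (t ` \<Lambda>)\<close> by (intro countable_UN) auto
    moreover have "(\<Union>s\<in>t ` \<Lambda>. {l\<in>\<Lambda>. t l = s}) = \<Lambda>" by auto
    ultimately show False using \<open>uncountable \<Lambda>\<close> by simp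
  qed
  then obtain s where "uncountable {l\<in>\<Lambda>. t l = s}" ..
  then have inf: "infinite {l\<in>\<Lambda>. t l = s}" using countable_finite by blast
  then obtain l0 where "l0 \<in> \<Lambda>" "t l0 = s" using not_finite_existsD by auto
  then have "finite s" using t by auto
  have bs: "b l \<in> fun_space.span s" if "l \<in> {l\<in>\<Lambda>. t l = s}" for l using t that by auto
  have "\<exists>F c. finite F \<and> F \<subseteq> {l\<in>\<Lambda>. t l = s} \<and> (\<exists>l\<in>F. c l \<noteq> 0) \<and> (\<forall>x. (\<Sum>l\<in>F. c l * b l x) = 0)"
    by (rule family_dependent[OF inf \<open>finite s\<close>]) (rule bs)
  then obtain F c where "finite F" "F \<subseteq> {l\<in>\<Lambda>. t l = s}" and F: "\<exists>l\<in>F. c l \<noteq> 0"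
      "\<forall>x. (\<Sum>l\<in>F. c l * b l x) = 0"
    by (elim exE conjE)
  then have F: "finite F" "F \<subseteq> \<Lambda>" "\<exists>l\<in>F. c l \<noteq> 0" "\<And>x. (\<Sum>l\<in>F. c l * b l x) = 0" by auto
  \<comment> \<open>The numerator of \<open>\<Sum> c l / (y - l)\<close> over the common
    denominator. At a node \<open>l\<close> with \<open>c l \<noteq> 0\<close> only the summand of
    \<open>l\<close> survives, so \<open>P\<close> is not zero.\<close>
  define P where "P = (\<Sum>l\<in>F. Polynomial.smult (c l) (\<Prod>k\<in>F - {l}. [:- k, 1:]))"
  have P: "poly P y = (\<Sum>l\<in>F. c l * (\<Prod>k\<in>F - {l}. y - k))" for y
    by (simp add: P_def poly_sum poly_prod)
  obtain l where l: "l \<in> F" "c l \<noteq> 0" using F by auto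
  have "poly P l = c l * (\<Prod>k\<in>F - {l}. l - k)"
    unfolding P by (subst sum.remove[OF F(1) l(1)]) (use F(1) l in \<open>auto intro!: sum.neutral\<close>)
  then have "poly P l \<noteq> 0" using l F(1) by auto
  then have "P \<noteq> 0" by auto
  moreover have "(\<lambda>x. poly P (a x)) \<in> m"
  proof -
    have "(\<lambda>x. (c l * (\<Prod>k\<in>F - {l}. a x - k)) * ((a x - l) * b l x - 1)) \<in> m" if "l \<in> F" for l
    proof -
      have "(\<lambda>x. c l * (\<Prod>k\<in>F - {l}. a x - k)) \<in> function_algebra G"
        by (intro function_algebra.mult function_algebra.const function_algebra_prod
              function_algebra_diff a)
      from function_ideal_mult[OF m this b(2)[of l]] show ?thesis using F(2) that by blast
    qed
    then have "(\<lambda>x. \<Sum>l\<in>F. (c l * (\<Prod>k\<in>F - {l}. a x - k)) * ((a x - l) * b l x - 1)) \<in> m"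
      by (rule function_ideal_sum[OF m])
    \<comment> \<open>Expanding each summand leaves the full product times
      \<open>c l * b l x\<close>, minus the summand of \<open>P\<close>. The first parts add up to
      zero by the linear relation, which holds exactly and not only modulo \<open>m\<close>.\<close>
    moreover have "(\<Sum>l\<in>F. (c l * (\<Prod>k\<in>F - {l}. a x - k)) * ((a x - l) * b l x - 1)) = - poly P (a x)" for x
    proof -
      have "(\<Sum>l\<in>F. (c l * (\<Prod>k\<in>F - {l}. a x - k)) * ((a x - l) * b l x - 1)) =
         (\<Sum>l\<in>F. (\<Prod>k\<in>F. a x - k) * (c l * b l x) - c l * (\<Prod>k\<in>F - {l}. a x - k))"
      proof (rule sum.cong[OF refl])
        fix l assume "l \<in> F"
        note pr = prod.remove[OF F(1) this, of "\<lambda>k. a x - k"]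
        show "(c l * (\<Prod>k\<in>F - {l}. a x - k)) * ((a x - l) * b l x - 1) =
           (\<Prod>k\<in>F. a x - k) * (c l * b l x) - c l * (\<Prod>k\<in>F - {l}. a x - k)"
          unfolding pr by algebra
      qed
      also have "\<dots> = (\<Prod>k\<in>F. a x - k) * (\<Sum>l\<in>F. c l * b l x) - poly P (a x)"
        by (simp add: sum_subtractf sum_distrib_left P)
      finally show ?thesis using F(4) by simp
    qed
    ultimately have "(\<lambda>x. - poly P (a x)) \<in> m" by simp
    from function_ideal_diff[OF m _ this, of "\<lambda>_. 0"] show ?thesis
      using m by (simp add: function_ideal_def)
  qed
  ultimately show ?thesis by blast
qed

section \<open>Maximal ideals and their residue fields\<close>

definition maximal_function_ideal :: "('x \<Rightarrow> complex) set \<Rightarrow> ('x \<Rightarrow> complex) set \<Rightarrow> bool" where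
  "maximal_function_ideal A m \<longleftrightarrow> function_ideal A m \<and> (\<lambda>_. 1) \<notin> m \<and>
     (\<forall>n. function_ideal A n \<and> (\<lambda>_. 1) \<notin> n \<and> m \<subseteq> n \<longrightarrow> n = m)"

lemma maximal_function_ideal_exists:
  assumes "function_ideal A k" "(\<lambda>_. 1) \<notin> k"
  shows "\<exists>m. maximal_function_ideal A m \<and> k \<subseteq> m"
proof -
  let ?S = "{m. function_ideal A m \<and> (\<lambda>_. 1) \<notin> m \<and> k \<subseteq> m}"
  have "\<exists>M\<in>?S. \<forall>X\<in>?S. M \<subseteq> X \<longrightarrow> X = M"
  proof (rule subset_Zorn_nonempty)
    show "?S \<noteq> {}" using assms by auto
  next
    fix C assume "C \<noteq> {}" "subset.chain ?S C"
    then have C: "\<And>m. m \<in> C \<Longrightarrow> m \<in> ?S" "\<And>m n. m \<in> C \<Longrightarrow> n \<in> C \<Longrightarrow> m \<subseteq> n \<or> n \<subseteq> m"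
      by (auto simp: subset_chain_def)
    have "(\<lambda>x. a x + b x) \<in> \<Union>C" if "m \<in> C" "a \<in> m" "n \<in> C" "b \<in> n" for a b m n
    proof -
      \<comment> \<open>In a chain one of the two ideals contains the other, so the sum can be
        formed inside the larger one.\<close>
      have "a \<in> n \<or> b \<in> m" using C(2)[OF that(1,3)] that by blast
      then show ?thesis
        using C(1)[OF that(1)] C(1)[OF that(3)] that
          function_ideal_add[of A n a b] function_ideal_add[of A m a b] by blast
    qed
    moreover have "\<Union>C \<subseteq> A" "(\<lambda>_. 0) \<in> \<Union>C"
      using C(1) \<open>C \<noteq> {}\<close> unfolding function_ideal_def by blast+
    moreover have "(\<lambda>x. a x * b x) \<in> \<Union>C" if "m \<in> C" "b \<in> m" "a \<in> A" for a b m
      using C(1)[OF that(1)] function_ideal_mult[OF _ that(3,2)] that(1) by blast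
    ultimately have "function_ideal A (\<Union>C)"
      unfolding function_ideal_def by (intro conjI ballI) (assumption | blast)+
    then show "\<Union>C \<in> ?S" using C(1) \<open>C \<noteq> {}\<close> by blast
  qed
  then obtain m where "m \<in> ?S" "\<forall>X\<in>?S. m \<subseteq> X \<longrightarrow> X = m" by blast
  then show ?thesis unfolding maximal_function_ideal_def by (intro exI[of _ m]) blast
qed

lemma function_ideal_adjoin:
  assumes m: "function_ideal (function_algebra G) m" and a: "a \<in> function_algebra G"
  shows "function_ideal (function_algebra G) {c. \<exists>i\<in>m. \<exists>b\<in>function_algebra G. c = (\<lambda>x. i x + a x * b x)}"
    (is "function_ideal ?A ?n")
proof -
  have n: "c \<in> ?n" if "i \<in> m" "b \<in> ?A" "\<And>x. c x = i x + a x * b x" for c i b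
    using that by (intro CollectI bexI[of _ i] bexI[of _ b] ext) auto
  show ?thesis
    unfolding function_ideal_def
  proof (intro conjI ballI subsetI)
    fix c assume "c \<in> ?n"
    then obtain i b where "i \<in> m" "b \<in> ?A" "c = (\<lambda>x. i x + a x * b x)" by blast
    moreover from this have "i \<in> ?A" using m by (auto simp: function_ideal_def)
    ultimately show "c \<in> ?A" using a by (auto intro: function_algebra.intros)
  next
    show "(\<lambda>_. 0) \<in> ?n"
      using m function_algebra.const[of 0 G] by (intro n) (auto simp: function_ideal_def)
  next
    fix c d assume "c \<in> ?n" "d \<in> ?n"
    then obtain i b i' b' where *: "i \<in> m" "b \<in> ?A" "c = (\<lambda>x. i x + a x * b x)"
      "i' \<in> m" "b' \<in> ?A" "d = (\<lambda>x. i' x + a x * b' x)" by blast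
    then have "(\<lambda>x. i x + i' x) \<in> m" by (intro function_ideal_add[OF m])
    from n[OF this function_algebra.add[OF *(2,5)]] show "(\<lambda>x. c x + d x) \<in> ?n"
      by (simp add: * algebra_simps)
  next
    fix d c assume d: "d \<in> ?A" and "c \<in> ?n"
    then obtain i b where *: "i \<in> m" "b \<in> ?A" "c = (\<lambda>x. i x + a x * b x)" by blast
    then have "(\<lambda>x. d x * i x) \<in> m" by (intro function_ideal_mult[OF m] d)
    from n[OF this function_algebra.mult[OF d *(2)]] show "(\<lambda>x. d x * c x) \<in> ?n"
      by (simp add: * algebra_simps)
  qed
qed

text \<open>The question is whether \<open>1\<close> lies in \<open>m + (a)\<close>: an equation
  \<open>1 = i + a b\<close> makes \<open>b\<close> an inverse modulo \<open>m\<close>, and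
  otherwise \<open>m + (a)\<close> is the proper ideal sought. Maximality is not assumed, since the
  dichotomy is also applied to the ideal of functions vanishing on a set.\<close>

lemma inverse_mod_or_proper_adjoin:
  assumes m: "function_ideal (function_algebra G) m" and a: "a \<in> function_algebra G"
  shows "(\<exists>b\<in>function_algebra G. (\<lambda>x. a x * b x - 1) \<in> m) \<or>
    (\<exists>n. function_ideal (function_algebra G) n \<and> (\<lambda>_. 1) \<notin> n \<and> m \<subseteq> n \<and> a \<in> n)"
proof -
  let ?A = "function_algebra G"
  let ?n = "{c. \<exists>i\<in>m. \<exists>b\<in>?A. c = (\<lambda>x. i x + a x * b x)}"
  show ?thesis
  proof (cases "(\<lambda>_. 1) \<in> ?n")
    case True
    then obtain i b where *: "i \<in> m" "b \<in> ?A" "\<And>x. i x + a x * b x = 1"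
      by (auto simp: fun_eq_iff)
    have "(\<lambda>x. 0 - i x) \<in> m"
      using function_ideal_diff[OF m _ *(1), of "\<lambda>_. 0"] m by (auto simp: function_ideal_def)
    moreover have "(\<lambda>x. 0 - i x) = (\<lambda>x. a x * b x - 1)"
      using *(3) by (auto simp: fun_eq_iff algebra_simps)
    ultimately show ?thesis using * by auto
  next
    case False
    have n: "c \<in> ?n" if "i \<in> m" "b \<in> ?A" "\<And>x. c x = i x + a x * b x" for c i b
      using that by (intro CollectI bexI[of _ i] bexI[of _ b] ext) auto
    have "m \<subseteq> ?n"
    proof
      fix i assume "i \<in> m"
      from n[OF this function_algebra.const[of 0]] show "i \<in> ?n" by simp
    qed
    moreover have "a \<in> ?n"
      using m by (intro n[OF _ function_algebra.const[of 1], of "\<lambda>_. 0"])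
        (auto simp: function_ideal_def)
    ultimately show ?thesis using False function_ideal_adjoin[OF assms] by blast
  qed
qed

lemma maximal_function_ideal_inverse:
  assumes "maximal_function_ideal (function_algebra G) m" "a \<in> function_algebra G" "a \<notin> m"
  shows "\<exists>b\<in>function_algebra G. (\<lambda>x. a x * b x - 1) \<in> m"
  using inverse_mod_or_proper_adjoin[of G m a] assms unfolding maximal_function_ideal_def by blast

text \<open>With \<open>c\<close> inverse to \<open>b\<close> modulo \<open>m\<close>, the element
  \<open>a\<close> is congruent to \<open>a b c\<close>, which lies in \<open>m\<close>.\<close>

lemma maximal_function_ideal_prime:
  assumes m: "maximal_function_ideal (function_algebra G) m"
    and "a \<in> function_algebra G" "b \<in> function_algebra G" "(\<lambda>x. a x * b x) \<in> m"
  shows "a \<in> m \<or> b \<in> m"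
proof (rule disjCI)
  assume "b \<notin> m"
  then obtain c where c: "c \<in> function_algebra G" "(\<lambda>x. b x * c x - 1) \<in> m"
    using maximal_function_ideal_inverse[OF m assms(3)] by blast
  have i: "function_ideal (function_algebra G) m" using m by (simp add: maximal_function_ideal_def)
  have "(\<lambda>x. c x * (a x * b x)) \<in> m" "(\<lambda>x. a x * (b x * c x - 1)) \<in> m"
    using function_ideal_mult[OF i c(1) assms(4)] function_ideal_mult[OF i assms(2) c(2)] by simp_all
  from function_ideal_diff[OF i this] show "a \<in> m" by (simp add: algebra_simps)
qed

text \<open>The field \<open>A / m\<close> has countable dimension, whereas the inverses of \<open>a - l\<close>, \<open>l \<in> \<complex>\<close>, would be
  linearly independent for transcendental \<open>a\<close>.\<close>

lemma maximal_function_ideal_residue: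
  assumes "countable G" and m: "maximal_function_ideal (function_algebra G) m"
    and a: "a \<in> function_algebra G"
  shows "\<exists>z. (\<lambda>x. a x - z) \<in> m"
proof (rule ccontr)
  assume neg: "\<not> ?thesis"
  have i: "function_ideal (function_algebra G) m" using m by (simp add: maximal_function_ideal_def)
  have A: "(\<lambda>x. a x - z) \<in> function_algebra G" for z
    using a by (intro function_algebra_diff function_algebra.const)
  have inv: "\<exists>b\<in>function_algebra G. (\<lambda>x. (a x - z) * b x - 1) \<in> m" for z
    using maximal_function_ideal_inverse[OF m A[of z]] neg by blast
  have "uncountable (UNIV :: complex set)"
    using uncountable_UNIV_real countable_image_inj_eq[of complex_of_real UNIV]
      countable_subset[OF subset_UNIV, of "range complex_of_real"] by (auto simp: inj_def)
  from uncountable_inverses_imp_algebraic[OF assms(1) i a this inv]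
  obtain P where P: "P \<noteq> 0" "(\<lambda>x. poly P (a x)) \<in> m" by blast
  then show False
  \<comment> \<open>A nonzero constant in \<open>m\<close> would put \<open>1\<close> into
    \<open>m\<close>. In positive degree a root \<open>z\<close> splits off; \<open>a - z\<close> is
    not in \<open>m\<close> by assumption, so primality moves the cofactor into \<open>m\<close> and
    lowers the degree.\<close>
  proof (induction "degree P" arbitrary: P)
    case 0
    then obtain c where c: "P = [:c:]" "c \<noteq> 0" by (metis degree_eq_zeroE pCons_0_0)
    have "(\<lambda>x. inverse c * poly P (a x)) \<in> m"
      by (rule function_ideal_mult[OF i function_algebra.const 0(3)])
    then show ?case using c m by (simp add: maximal_function_ideal_def)
  next
    case (Suc d)
    then have "\<not> constant (poly P)" by (simp add: constant_degree)
    then obtain z where "poly P z = 0" using fundamental_theorem_of_algebra by blast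
    then obtain Q where Q: "P = [:- z, 1:] * Q" by (metis poly_eq_0_iff_dvd dvdE)
    then have "Q \<noteq> 0" using Suc by auto
    then have "degree P = Suc (degree Q)" using degree_mult_eq[of "[:- z, 1:]" Q] by (simp add: Q del: mult_pCons_left)
    have "(\<lambda>x. (a x - z) * poly Q (a x)) \<in> m" using Suc(4) by (simp add: Q algebra_simps)
    from maximal_function_ideal_prime[OF m A function_algebra_poly[OF a] this]
    have "(\<lambda>x. poly Q (a x)) \<in> m" using neg by blast
    then show ?case using Suc(1)[of Q] Suc(2) \<open>degree P = Suc (degree Q)\<close> \<open>Q \<noteq> 0\<close> by simp
  qed
qed

text \<open>Assumption \<open>T\<close> says that \<open>T\<close> is cut out by polynomial
  equations inside the locus where \<open>q\<close> does not vanish. If \<open>p / q - l\<close> had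
  no inverse modulo the functions vanishing on \<open>T\<close>, a maximal ideal containing it would
  yield a point of \<open>T\<close> with value \<open>l\<close>. So omitted values give inverses,
  and uncountably many of them force \<open>p / q\<close> to satisfy a polynomial equation on
  \<open>T\<close>.\<close>

lemma finite_values_of_regular_function:
  fixes T :: "(nat \<Rightarrow> complex) set"
  defines "R n \<equiv> function_algebra {\<lambda>x :: nat \<Rightarrow> complex. x i | i. i < n}"
  assumes p: "p \<in> R n" and q: "q \<in> R n" and q0: "\<And>t. t \<in> T \<Longrightarrow> q t \<noteq> 0"
    and T: "\<And>z. \<forall>i\<ge>n. z i = 0 \<Longrightarrow> q z \<noteq> 0 \<Longrightarrow>
      (\<And>a. a \<in> R n \<Longrightarrow> (\<And>t. t \<in> T \<Longrightarrow> a t = 0) \<Longrightarrow> a z = 0) \<Longrightarrow> z \<in> T"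
    and "uncountable \<Lambda>" and \<Lambda>: "\<And>t. t \<in> T \<Longrightarrow> p t / q t \<notin> \<Lambda>"
  shows "finite ((\<lambda>t. p t / q t) ` T)"
proof -
  \<comment> \<open>Adjoining \<open>1 / q\<close> localizes at \<open>q\<close>. Since
    \<open>inverse 0 = 0\<close> this is a total function, but \<open>q * inverse q = 1\<close>
    fails at the zeros of \<open>q\<close>; the equation holds only modulo
    \<open>?K\<close>.\<close>
  let ?G = "insert (\<lambda>x. inverse (q x)) {\<lambda>x :: nat \<Rightarrow> complex. x i | i. i < n}"
  let ?A = "function_algebra ?G"
  let ?h = "\<lambda>x. p x * inverse (q x)"
  let ?K = "{a \<in> ?A. \<forall>t\<in>T. a t = 0}"
  have G: "countable ?G" by (simp add: setcompr_eq_image)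
  have R: "R n \<subseteq> ?A" unfolding R_def by (intro function_algebra_mono) auto
  have iq: "(\<lambda>x. inverse (q x)) \<in> ?A" by (simp add: function_algebra.gen)
  have h: "?h \<in> ?A" using p R iq by (intro function_algebra.mult) auto
  have K: "function_ideal ?A ?K"
    unfolding function_ideal_def by (auto intro: function_algebra.intros)
  have "\<exists>b\<in>?A. (\<lambda>x. (?h x - l) * b x - 1) \<in> ?K" if "l \<in> \<Lambda>" for l
  proof (rule ccontr)
    assume neg: "\<not> ?thesis"
    have hl: "(\<lambda>x. ?h x - l) \<in> ?A" using h by (intro function_algebra_diff function_algebra.const)
    from inverse_mod_or_proper_adjoin[OF K this] neg
    obtain k where "function_ideal ?A k" "(\<lambda>_. 1) \<notin> k" "?K \<subseteq> k" "(\<lambda>x. ?h x - l) \<in> k" by blast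
    then obtain m where m: "maximal_function_ideal ?A m" "?K \<subseteq> m" "(\<lambda>x. ?h x - l) \<in> m"
      using maximal_function_ideal_exists[of ?A k] by blast
    then have i: "function_ideal ?A m" by (simp add: maximal_function_ideal_def)
    \<comment> \<open>A proper ideal contains no nonzero constant, so congruences between constants
      modulo \<open>m\<close> are equalities.\<close>
    have c: "c = 0" if "(\<lambda>_. c) \<in> m" for c
    proof (rule ccontr)
      assume "c \<noteq> 0"
      have "(\<lambda>x. inverse c * c) \<in> m"
        by (rule function_ideal_mult[OF i function_algebra.const that])
      then show False using m \<open>c \<noteq> 0\<close> by (simp add: maximal_function_ideal_def)
    qed
    have "\<exists>z. i < n \<longrightarrow> (\<lambda>x. x i - z) \<in> m" for i
      using maximal_function_ideal_residue[OF G m(1), of "\<lambda>x. x i"] function_algebra.gen[of "\<lambda>x. x i" ?G]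
      by blast
    then obtain w where w: "\<And>i. i < n \<Longrightarrow> (\<lambda>x. x i - w i) \<in> m" by metis
    \<comment> \<open>The residues of the coordinates are the coordinates of a point; the entries
      from \<open>n\<close> on are \<open>0\<close> so that it lies in affine
      \<open>n\<close>-space.\<close>
    define z where "z = (\<lambda>i. if i < n then w i else 0)"
    \<comment> \<open>On polynomials the residue map is evaluation at \<open>z\<close>. It is not
      claimed for \<open>inverse q\<close>, so the next steps first clear denominators.\<close>
    have ev: "(\<lambda>x. a x - a z) \<in> m" if "a \<in> R n" for a
      using that unfolding R_def
    proof (induction rule: function_algebra.induct)
      case (gen g)
      then show ?case using w by (auto simp: z_def)
    next
      case (const c)
      then show ?case using function_ideal_zero[OF i] by simp
    next
      case (add a b)
      from function_ideal_add[OF i add(3,4)] show ?case by (simp add: algebra_simps)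
    next
      case (mult a b)
      have "a \<in> ?A" using mult(1) R by (auto simp: R_def)
      from function_ideal_add[OF i function_ideal_mult[OF i this mult(4)]
          function_ideal_mult[OF i function_algebra.const[of "b z"] mult(3)]]
      show ?case by (simp add: algebra_simps)
    qed
    have "(\<lambda>x. q x * inverse (q x) - 1) \<in> ?K"
      using q R iq q0 by (auto intro!: function_algebra_diff function_algebra.mult function_algebra.const)
    then have qm: "(\<lambda>x. inverse (q x) * q x - 1) \<in> m" using m(2) by (auto simp: mult.commute)
    have "q z \<noteq> 0"
    proof
      assume "q z = 0"
      then have "q \<in> m" using ev[OF q] by simp
      from function_ideal_diff[OF i function_ideal_mult[OF i iq this] qm]
      show False using c[of 1] by simp
    qed
    have "a z = 0" if "a \<in> R n" "\<And>t. t \<in> T \<Longrightarrow> a t = 0" for a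
    proof -
      have "a \<in> m" using that R m(2) by auto
      from function_ideal_diff[OF i this ev[OF that(1)]] show ?thesis using c by simp
    qed
    then have "z \<in> T" by (intro T \<open>q z \<noteq> 0\<close>) (auto simp: z_def)
    \<comment> \<open>Multiplying \<open>?h - l\<close> by \<open>q\<close> and correcting by a
      multiple of \<open>inverse q * q - 1\<close> gives the polynomial \<open>p - l q\<close>, to
      which evaluation at \<open>z\<close> applies.\<close>
    have "(\<lambda>x. q x * (?h x - l) - p x * (inverse (q x) * q x - 1)) \<in> m"
      using q p R by (intro function_ideal_diff[OF i] function_ideal_mult[OF i] m(3) qm) auto
    then have "(\<lambda>x. p x - l * q x) \<in> m" by (simp add: algebra_simps)
    moreover have "(\<lambda>x. (p x - p z) - l * (q x - q z)) \<in> m"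
      by (intro function_ideal_diff[OF i] function_ideal_mult[OF i] ev p q function_algebra.const)
    ultimately have "(\<lambda>x. (p x - l * q x) - ((p x - p z) - l * (q x - q z))) \<in> m"
      by (rule function_ideal_diff[OF i])
    then have "p z - l * q z = 0" by (intro c) (simp add: algebra_simps)
    then have "p z / q z = l" using \<open>q z \<noteq> 0\<close> by (simp add: field_simps)
    then show False using \<Lambda>[OF \<open>z \<in> T\<close>] that by simp
  qed
  from uncountable_inverses_imp_algebraic[OF G K h \<open>uncountable \<Lambda>\<close> this]
  obtain P where P: "P \<noteq> 0" "\<And>t. t \<in> T \<Longrightarrow> poly P (?h t) = 0" by blast
  then have "(\<lambda>t. p t / q t) ` T \<subseteq> {y. poly P y = 0}" by (auto simp: field_simps)
  then show ?thesis using poly_roots_finite[OF P(1)] finite_subset by blast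
qed

section \<open>Generated spaces with functions\<close>

lemma expressions_subset: "(U, f) \<in> expressions P A \<Longrightarrow> U \<subseteq> P"
  by (induction rule: expressions.induct) auto

text \<open>Restriction is not a formation rule, but adding \<open>0 * g\<close> shrinks the domain
  to that of \<open>g\<close> without changing values. The extra \<open>P\<close> is the domain of
  the constant \<open>0\<close>.\<close>

lemma expressions_restrict:
  assumes "(U, f) \<in> expressions P A" "(V, g) \<in> expressions P A"
  shows "(U \<inter> V, f) \<in> expressions P A"
proof -
  have "(U \<inter> (P \<inter> V), \<lambda>x. f x + 0 * g x) \<in> expressions P A"
    by (intro expressions.add expressions.mult expressions.const assms)
  moreover have "U \<inter> (P \<inter> V) = U \<inter> V" using expressions_subset assms by blast
  ultimately show ?thesis by simp
qed

text \<open>The domains of expressions are closed under intersection by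
  \<open>expressions_restrict\<close>, so they form a basis and not just a subbasis.\<close>

lemma openin_generated:
  "openin (zar (generated P A)) W \<longleftrightarrow>
     W \<subseteq> P \<and> (\<forall>x\<in>W. \<exists>U g. (U, g) \<in> expressions P A \<and> x \<in> U \<and> U \<subseteq> W)"
proof
  assume "openin (zar (generated P A)) W"
  then have "generate_topology_on (fst ` expressions P A) W"
    by (simp add: generated_def openin_topology_generated_by_iff)
  then show "W \<subseteq> P \<and> (\<forall>x\<in>W. \<exists>U g. (U, g) \<in> expressions P A \<and> x \<in> U \<and> U \<subseteq> W)"
  proof (induction rule: generate_topology_on.induct)
    case (Int a b)
    have "\<exists>U g. (U, g) \<in> expressions P A \<and> x \<in> U \<and> U \<subseteq> a \<inter> b" if x: "x \<in> a \<inter> b" for x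
    proof -
      obtain U g where U: "(U, g) \<in> expressions P A" "x \<in> U" "U \<subseteq> a" using Int(3)[THEN conjunct2, rule_format, OF IntD1[OF x]] by blast
      obtain V h where "(V, h) \<in> expressions P A" "x \<in> V" "V \<subseteq> b" using Int(4)[THEN conjunct2, rule_format, OF IntD2[OF x]] by blast
      with U show ?thesis by (intro exI[of _ "U \<inter> V"] exI[of _ g]) (auto intro: expressions_restrict)
    qed
    then show ?case using Int by blast
  next
    case (UN K)
    have "\<exists>U g. (U, g) \<in> expressions P A \<and> x \<in> U \<and> U \<subseteq> \<Union>K" if x: "x \<in> k" "k \<in> K" for x k
    proof -
      obtain U g where "(U, g) \<in> expressions P A" "x \<in> U" "U \<subseteq> k" using UN(2)[OF x(2), THEN conjunct2, rule_format, OF x(1)] by blast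
      then show ?thesis using that(2) by (intro exI[of _ U] exI[of _ g]) auto
    qed
    moreover have "\<Union>K \<subseteq> P" using UN(2) by (intro Sup_least) auto
    ultimately show ?case by auto
  next
    case (Basis s)
    then show ?case using expressions_subset by fastforce
  qed auto
next
  assume W: "W \<subseteq> P \<and> (\<forall>x\<in>W. \<exists>U g. (U, g) \<in> expressions P A \<and> x \<in> U \<and> U \<subseteq> W)"
  have "openin (zar (generated P A)) U" if "(U, g) \<in> expressions P A" for U g
    using that by (auto simp: generated_def intro!: topology_generated_by_Basis image_eqI)
  then show "openin (zar (generated P A)) W"
    using W by (subst openin_subopen) blast
qed

lemma openin_generated_expression:
  "(U, g) \<in> expressions P A \<Longrightarrow> openin (zar (generated P A)) U"
  using expressions_subset unfolding openin_generated by blast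

lemma pts_generated [simp]: "pts (generated P A) = P"
proof
  show "pts (generated P A) \<subseteq> P"
    using openin_topspace[of "zar (generated P A)"] unfolding openin_generated by blast
  show "P \<subseteq> pts (generated P A)"
    by (intro openin_subset openin_generated_expression[OF expressions.const[of P 0]])
qed

lemma reg_generated:
  "f \<in> reg (generated P A) W \<longleftrightarrow>
     (\<forall>x\<in>W. \<exists>U g. (U, g) \<in> expressions P A \<and> x \<in> U \<and> (\<forall>y\<in>U \<inter> W. f y = g y))"
  by (simp add: generated_def)

lemma reg_generated_expression:
  "(U, g) \<in> expressions P A \<Longrightarrow> g \<in> reg (generated P A) U"
  unfolding reg_generated by blast

text \<open>On an open \<open>W\<close> the local expression can be restricted to a domain inside
  \<open>W\<close>, so agreement no longer has to be intersected with \<open>W\<close>.\<close>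

lemma reg_generated_open:
  assumes "openin (zar (generated P A)) W"
  shows "f \<in> reg (generated P A) W \<longleftrightarrow>
     (\<forall>x\<in>W. \<exists>U g. (U, g) \<in> expressions P A \<and> x \<in> U \<and> U \<subseteq> W \<and> (\<forall>y\<in>U. f y = g y))"
    (is "_ \<longleftrightarrow> ?R")
proof
  assume f: "f \<in> reg (generated P A) W"
  show ?R
  proof
    fix x assume "x \<in> W"
    then obtain U g V h where "(U, g) \<in> expressions P A" "x \<in> U" "\<forall>y\<in>U \<inter> W. f y = g y"
      "(V, h) \<in> expressions P A" "x \<in> V" "V \<subseteq> W"
      using f assms unfolding reg_generated openin_generated by meson
    then show "\<exists>U g. (U, g) \<in> expressions P A \<and> x \<in> U \<and> U \<subseteq> W \<and> (\<forall>y\<in>U. f y = g y)"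
      by (intro exI[of _ "U \<inter> V"] exI[of _ g]) (auto intro: expressions_restrict)
  qed
next
  assume ?R
  then show "f \<in> reg (generated P A) W" unfolding reg_generated by (meson IntD1)
qed

lemma
  assumes "space_with_functions X" and "openin (zar X) U"
  shows swf_restrict: "f \<in> reg X U \<Longrightarrow> openin (zar X) V \<Longrightarrow> V \<subseteq> U \<Longrightarrow> f \<in> reg X V"
    and swf_local: "(\<And>x. x \<in> U \<Longrightarrow> \<exists>V g. openin (zar X) V \<and> x \<in> V \<and> V \<subseteq> U \<and> g \<in> reg X V \<and>
           (\<forall>y\<in>V. f y = g y)) \<Longrightarrow> f \<in> reg X U"
    and swf_const: "(\<lambda>_. c) \<in> reg X U"
    and swf_add: "f \<in> reg X U \<Longrightarrow> g \<in> reg X U \<Longrightarrow> (\<lambda>x. f x + g x) \<in> reg X U"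
    and swf_mult: "f \<in> reg X U \<Longrightarrow> g \<in> reg X U \<Longrightarrow> (\<lambda>x. f x * g x) \<in> reg X U"
    and swf_nonzero: "f \<in> reg X U \<Longrightarrow> openin (zar X) {x\<in>U. f x \<noteq> 0}"
    and swf_inverse: "f \<in> reg X U \<Longrightarrow> (\<lambda>x. inverse (f x)) \<in> reg X {x\<in>U. f x \<noteq> 0}"
proof -
  note swf = assms(1)[unfolded space_with_functions_def]
  note U = assms(2)
  show "f \<in> reg X U \<Longrightarrow> openin (zar X) V \<Longrightarrow> V \<subseteq> U \<Longrightarrow> f \<in> reg X V"
    using U by (intro swf[THEN conjunct1, rule_format, of U V f]) auto
  show "f \<in> reg X U" if "\<And>x. x \<in> U \<Longrightarrow> \<exists>V g. openin (zar X) V \<and> x \<in> V \<and> V \<subseteq> U \<and> g \<in> reg X V \<and>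
           (\<forall>y\<in>V. f y = g y)"
    using U that by (intro swf[THEN conjunct2, THEN conjunct1, rule_format, of U f]) auto
  show "(\<lambda>_. c) \<in> reg X U"
    using U by (intro swf[THEN conjunct2, THEN conjunct2, THEN conjunct1, rule_format])
  note ops = swf[THEN conjunct2, THEN conjunct2, THEN conjunct2, THEN conjunct1, rule_format, of U f g]
  show "f \<in> reg X U \<Longrightarrow> g \<in> reg X U \<Longrightarrow> (\<lambda>x. f x + g x) \<in> reg X U"
       "f \<in> reg X U \<Longrightarrow> g \<in> reg X U \<Longrightarrow> (\<lambda>x. f x * g x) \<in> reg X U"
    using U ops by auto
  note inv = swf[THEN conjunct2, THEN conjunct2, THEN conjunct2, THEN conjunct2, rule_format, of U f]
  show "f \<in> reg X U \<Longrightarrow> openin (zar X) {x\<in>U. f x \<noteq> 0}"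
       "f \<in> reg X U \<Longrightarrow> (\<lambda>x. inverse (f x)) \<in> reg X {x\<in>U. f x \<noteq> 0}"
    using U inv by auto
qed

lemma swf_cong:
  assumes "space_with_functions X" "openin (zar X) U" "f \<in> reg X U" "\<And>x. x \<in> U \<Longrightarrow> g x = f x"
  shows "g \<in> reg X U"
  by (rule swf_local[OF assms(1,2)], rule exI[of _ U], rule exI[of _ f]) (use assms in auto)

text \<open>This holds for every family \<open>A\<close>, so subspaces, products, fibre products and
  affine spaces satisfy the axioms at once.\<close>

lemma space_with_functions_generated: "space_with_functions (generated P A)"
  unfolding space_with_functions_def
proof (intro conjI allI impI; (elim conjE)?)
  fix U V f
  assume "V \<subseteq> U" "f \<in> reg (generated P A) U"
  show "f \<in> reg (generated P A) V" unfolding reg_generated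
  proof
    fix x assume "x \<in> V"
    then have "x \<in> U" using \<open>V \<subseteq> U\<close> by auto
    then obtain W g where "(W, g) \<in> expressions P A" "x \<in> W" "\<forall>y\<in>W \<inter> U. f y = g y"
      using \<open>f \<in> reg (generated P A) U\<close> unfolding reg_generated by auto
    then show "\<exists>U g. (U, g) \<in> expressions P A \<and> x \<in> U \<and> (\<forall>y\<in>U \<inter> V. f y = g y)"
      using \<open>V \<subseteq> U\<close> by (intro exI[of _ W] exI[of _ g]) auto
  qed
next
  fix U f
  assume U: "openin (zar (generated P A)) U" and
    *: "\<forall>x\<in>U. \<exists>V g. openin (zar (generated P A)) V \<and> x \<in> V \<and> V \<subseteq> U \<and> g \<in> reg (generated P A) V \<and>
           (\<forall>y\<in>V. f y = g y)"
  show "f \<in> reg (generated P A) U"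
    unfolding reg_generated_open[OF U]
  proof
    fix x assume "x \<in> U"
    then obtain V g where V: "openin (zar (generated P A)) V" "x \<in> V" "V \<subseteq> U"
      "g \<in> reg (generated P A) V" "\<forall>y\<in>V. f y = g y" using * by meson
    then obtain W h where "(W, h) \<in> expressions P A" "x \<in> W" "W \<subseteq> V" "\<forall>y\<in>W. g y = h y"
      using reg_generated_open[OF V(1), of g] by meson
    then show "\<exists>U' g. (U', g) \<in> expressions P A \<and> x \<in> U' \<and> U' \<subseteq> U \<and> (\<forall>y\<in>U'. f y = g y)"
      using V by (intro exI[of _ W] exI[of _ h]) auto
  qed
next
  fix U c assume "openin (zar (generated P A)) U"
  then show "(\<lambda>_. c) \<in> reg (generated P A) U"
    unfolding reg_generated openin_generated using expressions.const by (metis subsetD)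
next
  fix U f g
  assume U: "openin (zar (generated P A)) U" and
    fg: "f \<in> reg (generated P A) U" "g \<in> reg (generated P A) U"
  have "\<exists>V a b. (V, a) \<in> expressions P A \<and> (V, b) \<in> expressions P A \<and> x \<in> V \<and>
      (\<forall>y\<in>V \<inter> U. f y = a y \<and> g y = b y)" if "x \<in> U" for x
  proof -
    obtain V a W b where "(V, a) \<in> expressions P A" "x \<in> V" "\<forall>y\<in>V \<inter> U. f y = a y"
      "(W, b) \<in> expressions P A" "x \<in> W" "\<forall>y\<in>W \<inter> U. g y = b y"
      using fg \<open>x \<in> U\<close> unfolding reg_generated by meson
    then show ?thesis
      using expressions_restrict[of V a P A W b] expressions_restrict[of W b P A V a]
      by (intro exI[of _ "V \<inter> W"] exI[of _ a] exI[of _ b]) (auto simp: Int_commute)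
  qed
  note * = this
  show "(\<lambda>x. f x + g x) \<in> reg (generated P A) U" "(\<lambda>x. f x * g x) \<in> reg (generated P A) U"
    unfolding reg_generated
  proof -
    show "\<forall>x\<in>U. \<exists>Ua ga. (Ua, ga) \<in> expressions P A \<and> x \<in> Ua \<and> (\<forall>y\<in>Ua \<inter> U. f y + g y = ga y)"
    proof
      fix x assume "x \<in> U"
      then obtain V a b where V: "(V, a) \<in> expressions P A" "(V, b) \<in> expressions P A" "x \<in> V"
        "\<forall>y\<in>V \<inter> U. f y = a y \<and> g y = b y" using * by meson
      then show "\<exists>Ua ga. (Ua, ga) \<in> expressions P A \<and> x \<in> Ua \<and> (\<forall>y\<in>Ua \<inter> U. f y + g y = ga y)"
        using expressions.add[OF V(1,2)] by (intro exI[of _ V] exI[of _ "\<lambda>x. a x + b x"]) auto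
    qed
    show "\<forall>x\<in>U. \<exists>Ua ga. (Ua, ga) \<in> expressions P A \<and> x \<in> Ua \<and> (\<forall>y\<in>Ua \<inter> U. f y * g y = ga y)"
    proof
      fix x assume "x \<in> U"
      then obtain V a b where V: "(V, a) \<in> expressions P A" "(V, b) \<in> expressions P A" "x \<in> V"
        "\<forall>y\<in>V \<inter> U. f y = a y \<and> g y = b y" using * by meson
      then show "\<exists>Ua ga. (Ua, ga) \<in> expressions P A \<and> x \<in> Ua \<and> (\<forall>y\<in>Ua \<inter> U. f y * g y = ga y)"
        using expressions.mult[OF V(1,2)] by (intro exI[of _ V] exI[of _ "\<lambda>x. a x * b x"]) auto
    qed
  qed
next
  fix U f
  assume U: "openin (zar (generated P A)) U" and f: "f \<in> reg (generated P A) U"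
  have *: "\<exists>V g. (V, g) \<in> expressions P A \<and> x \<in> V \<and> V \<subseteq> {x \<in> U. f x \<noteq> 0} \<and>
      (\<forall>y\<in>V. inverse (f y) = g y)" if x: "x \<in> {x \<in> U. f x \<noteq> 0}" for x
  proof -
    obtain V g where "(V, g) \<in> expressions P A" "x \<in> V" "V \<subseteq> U" "\<forall>y\<in>V. f y = g y"
      using f[unfolded reg_generated_open[OF U], rule_format, of x] x by blast
    then show ?thesis
      using expressions.inv[of V g P A] that
      by (intro exI[of _ "{x\<in>V. g x \<noteq> 0}"] exI[of _ "\<lambda>x. inverse (g x)"]) auto
  qed
  show op: "openin (zar (generated P A)) {x \<in> U. f x \<noteq> 0}"
    unfolding openin_generated
  proof (intro conjI ballI)
    show "{x \<in> U. f x \<noteq> 0} \<subseteq> P" using openin_subset[OF U] by auto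
    fix x assume "x \<in> {x \<in> U. f x \<noteq> 0}"
    from *[OF this] show "\<exists>V g. (V, g) \<in> expressions P A \<and> x \<in> V \<and> V \<subseteq> {x \<in> U. f x \<noteq> 0}"
      by (elim exE conjE, intro exI conjI)
  qed
  show "(\<lambda>x. inverse (f x)) \<in> reg (generated P A) {x \<in> U. f x \<noteq> 0}"
    unfolding reg_generated_open[OF op] by (intro ballI *)
qed

section \<open>Morphisms and the universal property of generated structures\<close>

lemma morphism_pts: "morphism X Y \<phi> \<Longrightarrow> x \<in> pts X \<Longrightarrow> \<phi> x \<in> pts Y"
  by (auto simp: morphism_def continuous_map_def)

lemma morphism_open:
  "morphism X Y \<phi> \<Longrightarrow> openin (zar Y) V \<Longrightarrow> openin (zar X) {x \<in> pts X. \<phi> x \<in> V}"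
  by (auto simp: morphism_def continuous_map_def)

lemma morphism_reg:
  "morphism X Y \<phi> \<Longrightarrow> openin (zar Y) V \<Longrightarrow> f \<in> reg Y V \<Longrightarrow> f \<circ> \<phi> \<in> reg X {x \<in> pts X. \<phi> x \<in> V}"
  by (auto simp: morphism_def)

lemma morphismI:
  assumes "\<And>x. x \<in> pts X \<Longrightarrow> \<phi> x \<in> pts Y"
    and "\<And>V. openin (zar Y) V \<Longrightarrow> openin (zar X) {x \<in> pts X. \<phi> x \<in> V}"
    and "\<And>V f. openin (zar Y) V \<Longrightarrow> f \<in> reg Y V \<Longrightarrow> f \<circ> \<phi> \<in> reg X {x \<in> pts X. \<phi> x \<in> V}"
  shows "morphism X Y \<phi>"
  using assms by (auto simp: morphism_def continuous_map_def)

lemma morphism_compose: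
  assumes "morphism X Y \<phi>" "morphism Y Z \<psi>"
  shows "morphism X Z (\<lambda>x. \<psi> (\<phi> x))"
proof (rule morphismI)
  show "\<psi> (\<phi> x) \<in> pts Z" if "x \<in> pts X" for x using assms that by (blast intro: morphism_pts)
next
  fix V assume V: "openin (zar Z) V"
  have eq: "{x \<in> pts X. \<phi> x \<in> {y \<in> pts Y. \<psi> y \<in> V}} = {x \<in> pts X. \<psi> (\<phi> x) \<in> V}"
    using morphism_pts[OF assms(1)] by auto
  from morphism_open[OF assms(1) morphism_open[OF assms(2) V]]
  show "openin (zar X) {x \<in> pts X. \<psi> (\<phi> x) \<in> V}" unfolding eq .
  fix f assume "f \<in> reg Z V"
  from morphism_reg[OF assms(1) morphism_open[OF assms(2) V] morphism_reg[OF assms(2) V this]]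
  show "f \<circ> (\<lambda>x. \<psi> (\<phi> x)) \<in> reg X {x \<in> pts X. \<psi> (\<phi> x) \<in> V}" unfolding eq by (simp add: comp_def)
qed

text \<open>It suffices to test the generators. Openness and regularity are carried together through
  the induction on expressions, because the domain of an inverse is open only on account of the
  regularity of the function inverted.\<close>

lemma morphism_generated:
  assumes X: "space_with_functions X" and P: "\<And>x. x \<in> pts X \<Longrightarrow> \<phi> x \<in> P"
    and A: "\<And>U f. (U, f) \<in> A \<Longrightarrow> openin (zar X) {x \<in> pts X. \<phi> x \<in> U}"
           "\<And>U f. (U, f) \<in> A \<Longrightarrow> f \<circ> \<phi> \<in> reg X {x \<in> pts X. \<phi> x \<in> U}"
  shows "morphism X (generated P A) \<phi>"
proof -
  have E: "openin (zar X) {x \<in> pts X. \<phi> x \<in> U} \<and> (\<lambda>x. f (\<phi> x)) \<in> reg X {x \<in> pts X. \<phi> x \<in> U}"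
    if "(U, f) \<in> expressions P A" for U f
    using that
  proof (induction rule: expressions.induct)
    case (base U f)
    have "{x \<in> pts X. \<phi> x \<in> U \<inter> P} = {x \<in> pts X. \<phi> x \<in> U}" using P by auto
    then show ?case using A[OF base] by (simp add: comp_def)
  next
    case (const c)
    have "{x \<in> pts X. \<phi> x \<in> P} = pts X" using P by auto
    then show ?case using swf_const[OF X, of "pts X" c] by (simp add: comp_def)
  next
    case (add U f V g)
    let ?W = "{x \<in> pts X. \<phi> x \<in> U \<inter> V}"
    have W: "?W = {x \<in> pts X. \<phi> x \<in> U} \<inter> {x \<in> pts X. \<phi> x \<in> V}" by auto
    then have op: "openin (zar X) ?W" using add by auto
    have "(\<lambda>x. f (\<phi> x)) \<in> reg X ?W" "(\<lambda>x. g (\<phi> x)) \<in> reg X ?W"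
      using add W swf_restrict[OF X _ _ op] by auto
    from swf_add[OF X op this] show ?case using op by simp
  next
    case (mult U f V g)
    let ?W = "{x \<in> pts X. \<phi> x \<in> U \<inter> V}"
    have W: "?W = {x \<in> pts X. \<phi> x \<in> U} \<inter> {x \<in> pts X. \<phi> x \<in> V}" by auto
    then have op: "openin (zar X) ?W" using mult by auto
    have "(\<lambda>x. f (\<phi> x)) \<in> reg X ?W" "(\<lambda>x. g (\<phi> x)) \<in> reg X ?W"
      using mult W swf_restrict[OF X _ _ op] by auto
    from swf_mult[OF X op this] show ?case using op by simp
  next
    case (inv U f)
    have W: "{x \<in> pts X. \<phi> x \<in> {y \<in> U. f y \<noteq> 0}} = {x \<in> {x \<in> pts X. \<phi> x \<in> U}. f (\<phi> x) \<noteq> 0}" by auto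
    show ?case
      unfolding W using inv(2) by (intro conjI swf_nonzero[OF X] swf_inverse[OF X]) auto
  qed
  show ?thesis
  proof (rule morphismI)
    show "\<phi> x \<in> pts (generated P A)" if "x \<in> pts X" for x using P that by simp
  next
    fix V assume V: "openin (zar (generated P A)) V"
    show op: "openin (zar X) {x \<in> pts X. \<phi> x \<in> V}"
    proof (subst openin_subopen, intro ballI)
      fix x assume x: "x \<in> {x \<in> pts X. \<phi> x \<in> V}"
      then obtain U g where U: "(U, g) \<in> expressions P A" "\<phi> x \<in> U" "U \<subseteq> V"
        using V unfolding openin_generated by blast
      then show "\<exists>T. openin (zar X) T \<and> x \<in> T \<and> T \<subseteq> {x \<in> pts X. \<phi> x \<in> V}"
        using E[OF U(1)] x by (intro exI[of _ "{x \<in> pts X. \<phi> x \<in> U}"]) auto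
    qed
    fix f assume f: "f \<in> reg (generated P A) V"
    show "f \<circ> \<phi> \<in> reg X {x \<in> pts X. \<phi> x \<in> V}"
    proof (rule swf_local[OF X op])
      fix x assume x: "x \<in> {x \<in> pts X. \<phi> x \<in> V}"
      then obtain U g where U: "(U, g) \<in> expressions P A" "\<phi> x \<in> U" "U \<subseteq> V" "\<forall>y\<in>U. f y = g y"
        using f unfolding reg_generated_open[OF V] by blast
      then show "\<exists>W g. openin (zar X) W \<and> x \<in> W \<and> W \<subseteq> {x \<in> pts X. \<phi> x \<in> V} \<and> g \<in> reg X W \<and>
          (\<forall>y\<in>W. (f \<circ> \<phi>) y = g y)"
        using E[OF U(1)] x by (intro exI[of _ "{x \<in> pts X. \<phi> x \<in> U}"] exI[of _ "\<lambda>x. g (\<phi> x)"]) auto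
    qed
  qed
qed

lemma morphism_id: "morphism X X (\<lambda>x. x)"
proof (rule morphismI)
  fix V assume "openin (zar X) V"
  then have "{x \<in> pts X. x \<in> V} = V" using openin_subset by fast
  then show "openin (zar X) {x \<in> pts X. x \<in> V}" using \<open>openin (zar X) V\<close> by simp
  show "f \<circ> (\<lambda>x. x) \<in> reg X {x \<in> pts X. x \<in> V}" if "f \<in> reg X V" for f
    using \<open>_ = V\<close> that by (simp add: comp_def)
qed

section \<open>Subspaces, products and gluing\<close>

lemma generated_base:
  assumes "(U, f) \<in> A"
  shows "openin (zar (generated P A)) (U \<inter> P)" and "f \<in> reg (generated P A) (U \<inter> P)"
  using openin_generated_expression reg_generated_expression expressions.base[OF assms] by blast+

lemma space_with_functions_subspace: "space_with_functions (subspace X S)"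
  by (simp add: subspace_def space_with_functions_generated)

lemma pts_subspace [simp]: "pts (subspace X S) = S \<inter> pts X"
  by (simp add: subspace_def)

lemma pts_product [simp]: "pts (product X Y) = pts X \<times> pts Y"
  by (simp add: product_def)

lemma morphism_subspace:
  assumes "space_with_functions X"
  shows "morphism (subspace X S) X (\<lambda>x. x)"
proof (rule morphismI)
  fix V assume V: "openin (zar X) V"
  have eq: "{x \<in> pts (subspace X S). x \<in> V} = V \<inter> (S \<inter> pts X)" by auto
  show "openin (zar (subspace X S)) {x \<in> pts (subspace X S). x \<in> V}"
    using generated_base(1)[of V "\<lambda>_. 0" "sections X" "S \<inter> pts X"] V swf_const[OF assms V]
    unfolding eq by (simp add: subspace_def sections_def)
  show "f \<circ> (\<lambda>x. x) \<in> reg (subspace X S) {x \<in> pts (subspace X S). x \<in> V}" if "f \<in> reg X V" for f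
    using generated_base(2)[of V f "sections X" "S \<inter> pts X"] V that
    unfolding eq by (simp add: subspace_def sections_def comp_def)
qed auto

lemma morphism_into_subspace:
  assumes "space_with_functions Y" "morphism Y X \<phi>" "\<And>y. y \<in> pts Y \<Longrightarrow> \<phi> y \<in> S"
  shows "morphism Y (subspace X S) \<phi>"
  unfolding subspace_def
  using assms morphism_pts[OF assms(2)] morphism_open[OF assms(2)] morphism_reg[OF assms(2)]
  by (intro morphism_generated) (auto simp: sections_def)

lemma morphism_fst:
  assumes "space_with_functions X"
  shows "morphism (product X Y) X fst"
proof (rule morphismI)
  fix V assume V: "openin (zar X) V"
  have eq: "{x \<in> pts (product X Y). fst x \<in> V} = fst -` V \<inter> (pts X \<times> pts Y)" by auto
  have *: "(fst -` V, f \<circ> fst) \<in> pullback fst (sections X) \<union> pullback snd (sections Y)"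
    if "f \<in> reg X V" for f
    using V that by (force simp: pullback_def sections_def)
  show "openin (zar (product X Y)) {x \<in> pts (product X Y). fst x \<in> V}"
    using generated_base(1)[OF *[OF swf_const[OF assms V]]] unfolding eq by (simp add: product_def)
  show "f \<circ> fst \<in> reg (product X Y) {x \<in> pts (product X Y). fst x \<in> V}" if "f \<in> reg X V" for f
    using generated_base(2)[OF *[OF that]] unfolding eq by (simp add: product_def)
qed auto

lemma morphism_snd:
  assumes "space_with_functions Y"
  shows "morphism (product X Y) Y snd"
proof (rule morphismI)
  fix V assume V: "openin (zar Y) V"
  have eq: "{x \<in> pts (product X Y). snd x \<in> V} = snd -` V \<inter> (pts X \<times> pts Y)" by auto
  have *: "(snd -` V, f \<circ> snd) \<in> pullback fst (sections X) \<union> pullback snd (sections Y)"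
    if "f \<in> reg Y V" for f
    using V that by (force simp: pullback_def sections_def)
  show "openin (zar (product X Y)) {x \<in> pts (product X Y). snd x \<in> V}"
    using generated_base(1)[OF *[OF swf_const[OF assms V]]] unfolding eq by (simp add: product_def)
  show "f \<circ> snd \<in> reg (product X Y) {x \<in> pts (product X Y). snd x \<in> V}" if "f \<in> reg Y V" for f
    using generated_base(2)[OF *[OF that]] unfolding eq by (simp add: product_def)
qed auto

lemma morphism_pair:
  assumes "space_with_functions Z" "morphism Z X \<phi>" "morphism Z Y \<psi>"
  shows "morphism Z (product X Y) (\<lambda>z. (\<phi> z, \<psi> z))"
  unfolding product_def
proof (rule morphism_generated[OF assms(1)])
  show "(\<phi> z, \<psi> z) \<in> pts X \<times> pts Y" if "z \<in> pts Z" for z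
    using assms that by (auto dest: morphism_pts)
next
  fix U f assume "(U, f) \<in> pullback fst (sections X) \<union> pullback snd (sections Y)"
  then consider V h where "openin (zar X) V" "h \<in> reg X V" "U = fst -` V" "f = h \<circ> fst"
    | V h where "openin (zar Y) V" "h \<in> reg Y V" "U = snd -` V" "f = h \<circ> snd"
    by (auto simp: pullback_def sections_def)
  then have "openin (zar Z) {x \<in> pts Z. (\<phi> x, \<psi> x) \<in> U} \<and>
     f \<circ> (\<lambda>z. (\<phi> z, \<psi> z)) \<in> reg Z {x \<in> pts Z. (\<phi> x, \<psi> x) \<in> U}"
  proof cases
    case 1
    then show ?thesis using morphism_open[OF assms(2)] morphism_reg[OF assms(2)] by (auto simp: comp_def)
  next
    case 2
    then show ?thesis using morphism_open[OF assms(3)] morphism_reg[OF assms(3)] by (auto simp: comp_def)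
  qed
  then show "openin (zar Z) {x \<in> pts Z. (\<phi> x, \<psi> x) \<in> U}"
     "f \<circ> (\<lambda>z. (\<phi> z, \<psi> z)) \<in> reg Z {x \<in> pts Z. (\<phi> x, \<psi> x) \<in> U}" by auto
qed

text \<open>Over an open \<open>V\<close> the expressions in sections of \<open>X\<close> are again
  sections of \<open>X\<close>, so generating adds no open sets and no functions. For a general
  subset this fails, since restrictions need not extend.\<close>

lemma open_subspace:
  assumes X: "space_with_functions X" and V: "openin (zar X) V"
  shows "openin (zar (subspace X V)) W \<longleftrightarrow> openin (zar X) W \<and> W \<subseteq> V"
    and "openin (zar (subspace X V)) W \<Longrightarrow> f \<in> reg (subspace X V) W \<longleftrightarrow> f \<in> reg X W"
proof -
  have V': "V \<inter> pts X = V" using openin_subset[OF V] by blast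
  have E: "openin (zar X) U \<and> f \<in> reg X U" if "(U, f) \<in> expressions V (sections X)" for U f
    using that
  proof (induction rule: expressions.induct)
    case (base U f)
    then show ?case using V swf_restrict[OF X, of U f "U \<inter> V"] by (auto simp: sections_def)
  next
    case (const c)
    then show ?case using V swf_const[OF X V] by simp
  next
    case (add U f W g)
    then have op: "openin (zar X) (U \<inter> W)" by auto
    then show ?case
      using add swf_restrict[OF X _ _ op] by (auto intro!: swf_add[OF X op])
  next
    case (mult U f W g)
    then have op: "openin (zar X) (U \<inter> W)" by auto
    then show ?case
      using mult swf_restrict[OF X _ _ op] by (auto intro!: swf_mult[OF X op])
  next
    case (inv U f)
    then show ?case using swf_nonzero[OF X] swf_inverse[OF X] by blast
  qed
  have sub: "openin (zar (subspace X V)) W \<and> (f \<in> reg X W \<longrightarrow> f \<in> reg (subspace X V) W)"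
    if "openin (zar X) W" "W \<subseteq> V" for W f
  proof -
    have "{x \<in> pts (subspace X V). x \<in> W} = W" using that V' by auto
    then show ?thesis
      using morphism_open[OF morphism_subspace[OF X] that(1), of V]
        morphism_reg[OF morphism_subspace[OF X] that(1), of f V] by (auto simp: comp_def)
  qed
  show op: "openin (zar (subspace X V)) W \<longleftrightarrow> openin (zar X) W \<and> W \<subseteq> V" for W
  proof
    assume "openin (zar (subspace X V)) W"
    then have "W \<subseteq> V \<and> (\<forall>x\<in>W. \<exists>U g. (U, g) \<in> expressions V (sections X) \<and> x \<in> U \<and> U \<subseteq> W)"
      unfolding subspace_def V' openin_generated .
    then show "openin (zar X) W \<and> W \<subseteq> V" using E by (subst openin_subopen) blast
  qed (use sub in blast)
  assume W: "openin (zar (subspace X V)) W"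
  show "f \<in> reg (subspace X V) W \<longleftrightarrow> f \<in> reg X W"
  proof
    assume "f \<in> reg (subspace X V) W"
    then have *: "\<forall>x\<in>W. \<exists>U g. (U, g) \<in> expressions V (sections X) \<and> x \<in> U \<and> U \<subseteq> W \<and> (\<forall>y\<in>U. f y = g y)"
      using reg_generated_open[of V "sections X" W f] W unfolding subspace_def V' by simp
    show "f \<in> reg X W"
    proof (rule swf_local[OF X])
      show "openin (zar X) W" using W op by simp
      fix x assume "x \<in> W"
      then obtain U g where "(U, g) \<in> expressions V (sections X)" "x \<in> U" "U \<subseteq> W" "\<forall>y\<in>U. f y = g y"
        using * by auto
      then show "\<exists>U g. openin (zar X) U \<and> x \<in> U \<and> U \<subseteq> W \<and> g \<in> reg X U \<and> (\<forall>y\<in>U. f y = g y)"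
        using E by (intro exI[of _ U] exI[of _ g]) auto
    qed
  qed (use sub W op in blast)
qed

text \<open>Being a morphism is local on the source. This reduces scalar multiplication to
  trivializations, and a locally constant scalar to a constant one.\<close>

lemma morphism_local:
  assumes X: "space_with_functions X"
    and loc: "\<And>x. x \<in> pts X \<Longrightarrow> \<exists>V \<psi>. openin (zar X) V \<and> x \<in> V \<and> morphism (subspace X V) Y \<psi> \<and>
          (\<forall>y\<in>V. \<phi> y = \<psi> y)"
  shows "morphism X Y \<phi>"
proof -
  have *: "\<exists>V. openin (zar X) V \<and> x \<in> V \<and> (\<forall>y\<in>V. \<phi> y \<in> pts Y) \<and>
      (\<forall>W. openin (zar Y) W \<longrightarrow> openin (zar X) {y \<in> V. \<phi> y \<in> W}) \<and>
      (\<forall>W f. openin (zar Y) W \<longrightarrow> f \<in> reg Y W \<longrightarrow> f \<circ> \<phi> \<in> reg X {y \<in> V. \<phi> y \<in> W})"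
    if x: "x \<in> pts X" for x
  proof -
    obtain V \<psi> where V: "openin (zar X) V" "x \<in> V" "morphism (subspace X V) Y \<psi>" "\<forall>y\<in>V. \<phi> y = \<psi> y"
      using loc[OF x] by blast
    have pV: "pts (subspace X V) = V" using openin_subset[OF V(1)] by auto
    have eq: "{y \<in> pts (subspace X V). \<psi> y \<in> W} = {y \<in> V. \<phi> y \<in> W}" for W
      using V(4) unfolding pV by auto
    have op: "openin (zar X) {y \<in> V. \<phi> y \<in> W}" if "openin (zar Y) W" for W
      using morphism_open[OF V(3) that] unfolding eq open_subspace(1)[OF X V(1)] by blast
    moreover have "f \<circ> \<phi> \<in> reg X {y \<in> V. \<phi> y \<in> W}" if W: "openin (zar Y) W" "f \<in> reg Y W" for W f
    proof -
      have "f \<circ> \<psi> \<in> reg X {y \<in> V. \<phi> y \<in> W}"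
        using morphism_reg[OF V(3) W] morphism_open[OF V(3) W(1)] open_subspace(2)[OF X V(1)]
        unfolding eq by blast
      then show ?thesis
        by (rule swf_cong[OF X op[OF W(1)]]) (use V(4) in auto)
    qed
    moreover have "\<phi> y \<in> pts Y" if "y \<in> V" for y
      using morphism_pts[OF V(3), of y] that V(4) pV by auto
    ultimately show ?thesis using V by (intro exI[of _ V]) auto
  qed
  show ?thesis
  proof (rule morphismI)
    show "\<phi> x \<in> pts Y" if "x \<in> pts X" for x using *[OF that] by blast
  next
    fix W assume W: "openin (zar Y) W"
    show op: "openin (zar X) {x \<in> pts X. \<phi> x \<in> W}"
    proof (subst openin_subopen, intro ballI)
      fix x assume x: "x \<in> {x \<in> pts X. \<phi> x \<in> W}"
      then obtain V where V: "openin (zar X) V" "x \<in> V" "openin (zar X) {y \<in> V. \<phi> y \<in> W}"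
        using *[of x] W by auto
      then show "\<exists>T. openin (zar X) T \<and> x \<in> T \<and> T \<subseteq> {x \<in> pts X. \<phi> x \<in> W}"
        using x openin_subset[OF V(1)] by (intro exI[of _ "{y \<in> V. \<phi> y \<in> W}"]) auto
    qed
    fix f assume f: "f \<in> reg Y W"
    show "f \<circ> \<phi> \<in> reg X {x \<in> pts X. \<phi> x \<in> W}"
    proof (rule swf_local[OF X op])
      fix x assume x: "x \<in> {x \<in> pts X. \<phi> x \<in> W}"
      then obtain V where V: "openin (zar X) V" "x \<in> V" "openin (zar X) {y \<in> V. \<phi> y \<in> W}"
          "f \<circ> \<phi> \<in> reg X {y \<in> V. \<phi> y \<in> W}"
        using *[of x] W f by auto
      then show "\<exists>V g. openin (zar X) V \<and> x \<in> V \<and> V \<subseteq> {x \<in> pts X. \<phi> x \<in> W} \<and> g \<in> reg X V \<and>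
          (\<forall>y\<in>V. (f \<circ> \<phi>) y = g y)"
        using x openin_subset[OF V(1)]
        by (intro exI[of _ "{y \<in> V. \<phi> y \<in> W}"] exI[of _ "f \<circ> \<phi>"]) auto
    qed
  qed
qed

lemma morphism_affine_line:
  assumes X: "space_with_functions X"
  shows "morphism X affine_line f \<longleftrightarrow> f \<in> reg X (pts X)"
proof
  assume f: "morphism X affine_line f"
  have "(UNIV, \<lambda>z. z) \<in> expressions UNIV {(UNIV, \<lambda>z::complex. z)}"
    using expressions.base[of UNIV "\<lambda>z. z" "{(UNIV, \<lambda>z::complex. z)}" UNIV] by simp
  from morphism_reg[OF f openin_generated_expression[OF this, folded affine_line_def]
      reg_generated_expression[OF this, folded affine_line_def]]
  show "f \<in> reg X (pts X)" by (simp add: comp_def)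
next
  assume "f \<in> reg X (pts X)"
  then show "morphism X affine_line f"
    unfolding affine_line_def by (intro morphism_generated[OF X]) (auto simp: comp_def)
qed

lemma pts_affine_line [simp]: "pts affine_line = UNIV"
  by (simp add: affine_line_def)

lemma space_with_functions_affine_line: "space_with_functions affine_line"
  by (simp add: affine_line_def space_with_functions_generated)

section \<open>Regular functions as fractions of polynomials\<close>

text \<open>Near \<open>x\<close> the function is one fraction on a principal open subset of
  \<open>P\<close>. Requiring the nonvanishing locus of \<open>q\<close> in \<open>P\<close> to lie
  in \<open>U\<close> records at the same time that principal open sets form a basis; with
  \<open>f = 0\<close> it separates a point from a closed set.\<close>

definition fraction_near ::
    "('x \<Rightarrow> complex) set \<Rightarrow> 'x set \<Rightarrow> 'x \<Rightarrow> 'x set \<Rightarrow> ('x \<Rightarrow> complex) \<Rightarrow> bool" where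
  "fraction_near Q P x U f \<longleftrightarrow> (\<exists>p\<in>Q. \<exists>q\<in>Q. q x \<noteq> 0 \<and> (\<forall>w\<in>P. q w \<noteq> 0 \<longrightarrow> w \<in> U \<and> f w = p w / q w))"

lemma fraction_nearI:
  assumes "p \<in> Q" "q \<in> Q" "q x \<noteq> 0" "\<And>w. w \<in> P \<Longrightarrow> q w \<noteq> 0 \<Longrightarrow> w \<in> U \<and> f w = p w / q w"
  shows "fraction_near Q P x U f"
  using assms unfolding fraction_near_def by blast

lemma fraction_nearE:
  assumes "fraction_near Q P x U f"
  obtains p q where "p \<in> Q" "q \<in> Q" "q x \<noteq> 0" "\<forall>w\<in>P. q w \<noteq> 0 \<longrightarrow> w \<in> U \<and> f w = p w / q w"
  using assms unfolding fraction_near_def by (elim bexE conjE) (rule that)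

lemma expressions_fraction_near:
  assumes A: "\<And>U f x. (U, f) \<in> A \<Longrightarrow> x \<in> U \<inter> P \<Longrightarrow> fraction_near (function_algebra G) P x (U \<inter> P) f"
    and "(U, f) \<in> expressions P A" "x \<in> U"
  shows "fraction_near (function_algebra G) P x U f"
  using assms(2,3)
proof (induction arbitrary: x rule: expressions.induct)
  case (base U f)
  then show ?case using A by blast
next
  case (const c)
  then show ?case
    by (intro fraction_nearI[of "\<lambda>_. c" _ "\<lambda>_. 1"] function_algebra.const) auto
next
  case (add U f V g)
  then have x: "x \<in> U" "x \<in> V" by auto
  from add(3)[OF x(1)] obtain p q where pq: "p \<in> function_algebra G" "q \<in> function_algebra G" "q x \<noteq> 0"
    "\<forall>w\<in>P. q w \<noteq> 0 \<longrightarrow> w \<in> U \<and> f w = p w / q w"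
    by (rule fraction_nearE)
  from add(4)[OF x(2)] obtain p' q' where pq': "p' \<in> function_algebra G" "q' \<in> function_algebra G" "q' x \<noteq> 0"
    "\<forall>w\<in>P. q' w \<noteq> 0 \<longrightarrow> w \<in> V \<and> g w = p' w / q' w"
    by (rule fraction_nearE)
  \<comment> \<open>The product of the denominators is nonzero exactly where both are, which places
    the locus inside both domains.\<close>
  show ?case
    by (rule fraction_nearI[of "\<lambda>x. p x * q' x + p' x * q x" _ "\<lambda>x. q x * q' x"])
      (use pq pq' in \<open>auto intro!: function_algebra.add function_algebra.mult simp: add_frac_eq\<close>)
next
  case (mult U f V g)
  then have x: "x \<in> U" "x \<in> V" by auto
  from mult(3)[OF x(1)] obtain p q where pq: "p \<in> function_algebra G" "q \<in> function_algebra G" "q x \<noteq> 0"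
    "\<forall>w\<in>P. q w \<noteq> 0 \<longrightarrow> w \<in> U \<and> f w = p w / q w"
    by (rule fraction_nearE)
  from mult(4)[OF x(2)] obtain p' q' where pq': "p' \<in> function_algebra G" "q' \<in> function_algebra G" "q' x \<noteq> 0"
    "\<forall>w\<in>P. q' w \<noteq> 0 \<longrightarrow> w \<in> V \<and> g w = p' w / q' w"
    by (rule fraction_nearE)
  show ?case
    by (rule fraction_nearI[of "\<lambda>x. p x * p' x" _ "\<lambda>x. q x * q' x"])
      (use pq pq' in \<open>auto intro!: function_algebra.mult\<close>)
next
  case (inv U f)
  then have x: "x \<in> U" by auto
  from inv(2)[OF this] obtain p q where pq: "p \<in> function_algebra G" "q \<in> function_algebra G" "q x \<noteq> 0"
    "\<forall>w\<in>P. q w \<noteq> 0 \<longrightarrow> w \<in> U \<and> f w = p w / q w"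
    by (rule fraction_nearE)
  have "x \<in> P" using expressions_subset inv by blast
  then have "p x \<noteq> 0" using pq(3,4) inv(3) by auto
  \<comment> \<open>The inverse is written \<open>q q / (p q)\<close> rather than
    \<open>q / p\<close>: the hypothesis says something only where \<open>q\<close> is nonzero, so
    \<open>q\<close> has to remain in the denominator.\<close>
  then show ?case
    by (intro fraction_nearI[of "\<lambda>x. q x * q x" _ "\<lambda>x. p x * q x"])
      (use pq in \<open>auto intro!: function_algebra.mult\<close>)
qed

lemma generated_fraction_near:
  assumes A: "\<And>U f x. (U, f) \<in> A \<Longrightarrow> x \<in> U \<inter> P \<Longrightarrow> fraction_near (function_algebra G) P x (U \<inter> P) f"
    and W: "openin (zar (generated P A)) W" and f: "f \<in> reg (generated P A) W" and "x \<in> W"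
  shows "fraction_near (function_algebra G) P x W f"
proof -
  obtain U g where U: "(U, g) \<in> expressions P A" "x \<in> U" "U \<subseteq> W" "\<forall>y\<in>U. f y = g y"
    using f[unfolded reg_generated_open[OF W], rule_format, OF \<open>x \<in> W\<close>] by blast
  have "fraction_near (function_algebra G) P x U g"
    by (rule expressions_fraction_near[OF _ U(1,2)]) (rule A)
  then obtain p q where pq: "p \<in> function_algebra G" "q \<in> function_algebra G" "q x \<noteq> 0"
    "\<forall>w\<in>P. q w \<noteq> 0 \<longrightarrow> w \<in> U \<and> g w = p w / q w"
    by (rule fraction_nearE)
  show ?thesis by (rule fraction_nearI[OF pq(1-3)]) (use pq(4) U(3,4) in auto)
qed

abbreviation polynomial_functions :: "nat \<Rightarrow> ((nat \<Rightarrow> complex) \<Rightarrow> complex) set" where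
  "polynomial_functions n \<equiv> function_algebra {\<lambda>x. x i | i. i < n}"

lemma pts_affine_space [simp]: "pts (affine_space n) = {x. \<forall>i\<ge>n. x i = 0}"
  by (simp add: affine_space_def)

lemma affine_space_fraction_near:
  assumes "openin (zar (affine_space n)) W" "f \<in> reg (affine_space n) W" "x \<in> W"
  shows "fraction_near (polynomial_functions n) (pts (affine_space n)) x W f"
  unfolding pts_affine_space
proof (rule generated_fraction_near[OF _ assms[unfolded affine_space_def]])
  fix U :: "(nat \<Rightarrow> complex) set" and f and x :: "nat \<Rightarrow> complex"
  assume "(U, f) \<in> {(UNIV, \<lambda>x :: nat \<Rightarrow> complex. x i) | i. i < n}"
  then obtain i where "U = UNIV" "f = (\<lambda>x. x i)" "i < n" by auto
  then show "fraction_near (polynomial_functions n) {x. \<forall>i\<ge>n. x i = 0} x (U \<inter> {x. \<forall>i\<ge>n. x i = 0}) f"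
    by (intro fraction_nearI[of f _ "\<lambda>_. 1"] function_algebra.const function_algebra.gen) auto
qed

lemma affine_subspace_fraction_near:
  assumes "openin (zar (subspace (affine_space n) Z)) W" "f \<in> reg (subspace (affine_space n) Z) W" "x \<in> W"
  shows "fraction_near (polynomial_functions n) (Z \<inter> pts (affine_space n)) x W f"
proof (rule generated_fraction_near[OF _ assms[unfolded subspace_def]])
  fix U :: "(nat \<Rightarrow> complex) set" and f and x :: "nat \<Rightarrow> complex"
  assume "(U, f) \<in> sections (affine_space n)" "x \<in> U \<inter> (Z \<inter> pts (affine_space n))"
  then have "fraction_near (polynomial_functions n) (pts (affine_space n)) x U f"
    by (intro affine_space_fraction_near) (auto simp: sections_def)
  then obtain p q where "p \<in> polynomial_functions n" "q \<in> polynomial_functions n" "q x \<noteq> 0"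
    "\<forall>w\<in>pts (affine_space n). q w \<noteq> 0 \<longrightarrow> w \<in> U \<and> f w = p w / q w"
    by (rule fraction_nearE)
  then show "fraction_near (polynomial_functions n) (Z \<inter> pts (affine_space n)) x
      (U \<inter> (Z \<inter> pts (affine_space n))) f"
    by (intro fraction_nearI[of p _ q]) auto
qed

section \<open>Principal open sets and affine charts of a variety\<close>

lemma polynomial_function_nonzero_open:
  assumes "q \<in> polynomial_functions n"
  shows "openin (zar (affine_space n)) {x \<in> pts (affine_space n). q x \<noteq> 0}"
proof -
  let ?P = "{x :: nat \<Rightarrow> complex. \<forall>i\<ge>n. x i = 0}"
  have "(?P, q) \<in> expressions ?P {(UNIV, \<lambda>x. x i) | i. i < n}"
    using assms
  proof (induction rule: function_algebra.induct)
    case (gen g)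
    then show ?case using expressions.base[of UNIV g "{(UNIV, \<lambda>x. x i) | i. i < n}" ?P] by auto
  next
    case (const c)
    then show ?case by (rule expressions.const)
  next
    case (add a b)
    from expressions.add[OF add(3,4)] show ?case by simp
  next
    case (mult a b)
    from expressions.mult[OF mult(3,4)] show ?case by simp
  qed
  from openin_generated_expression[OF expressions.inv[OF this]]
  show ?thesis by (simp add: affine_space_def)
qed

text \<open>\<open>\<phi>\<close> identifies \<open>U\<close> with a closed subset of affine space; injectivity is not recorded.\<close>

definition affine_chart ::
    "'a fspace \<Rightarrow> 'a set \<Rightarrow> nat \<Rightarrow> ('a \<Rightarrow> nat \<Rightarrow> complex) \<Rightarrow> bool" where
  "affine_chart M U n \<phi> \<longleftrightarrow> openin (zar M) U \<and> \<phi> ` U \<subseteq> {z. \<forall>i\<ge>n. z i = 0} \<and>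
    (\<forall>z. (\<forall>i\<ge>n. z i = 0) \<longrightarrow> z \<notin> \<phi> ` U \<longrightarrow>
       (\<exists>a\<in>polynomial_functions n. a z \<noteq> 0 \<and> (\<forall>y\<in>U. a (\<phi> y) = 0))) \<and>
    (\<forall>q\<in>polynomial_functions n. openin (zar M) {y\<in>U. q (\<phi> y) \<noteq> 0}) \<and>
    (\<forall>W h y. openin (zar M) W \<longrightarrow> h \<in> reg M W \<longrightarrow> y \<in> W \<inter> U \<longrightarrow>
       (\<exists>p\<in>polynomial_functions n. \<exists>q\<in>polynomial_functions n. q (\<phi> y) \<noteq> 0 \<and>
          (\<forall>w\<in>U. q (\<phi> w) \<noteq> 0 \<longrightarrow> w \<in> W \<and> h w = p (\<phi> w) / q (\<phi> w))))"

text \<open>An affine piece is isomorphic to a closed subset of affine space; pulling back along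
  both directions of the isomorphism expresses everything needed later by polynomials in the
  coordinates of the chart.\<close>

lemma variety_affine_chart:
  assumes M: "variety M" and "x \<in> pts M"
  shows "\<exists>U n \<phi>. x \<in> U \<and> affine_chart M U n \<phi>"
proof -
  have swf: "space_with_functions M" using M by (simp add: variety_def)
  obtain \<U> where U: "\<Union>\<U> = pts M" "\<forall>U\<in>\<U>. openin (zar M) U \<and> affine_variety (subspace M U)"
    using M unfolding variety_def by blast
  then obtain U where U: "openin (zar M) U" "x \<in> U" "affine_variety (subspace M U)"
    using \<open>x \<in> pts M\<close> by blast
  have pU: "pts (subspace M U) = U" using openin_subset[OF U(1)] by auto
  obtain n Z \<phi> where Z: "closedin (zar (affine_space n)) Z"
      "isomorphism (subspace M U) (subspace (affine_space n) Z) \<phi>"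
    using U(3) unfolding affine_variety_def by blast
  have pZ: "pts (subspace (affine_space n) Z) = Z" using closedin_subset[OF Z(1)] by auto
  have swfA: "space_with_functions (affine_space n)"
    by (simp add: affine_space_def space_with_functions_generated)
  obtain \<psi> where \<phi>: "morphism (subspace M U) (subspace (affine_space n) Z) \<phi>"
      and \<psi>: "morphism (subspace (affine_space n) Z) (subspace M U) \<psi>"
      and inv: "\<And>y. y \<in> U \<Longrightarrow> \<psi> (\<phi> y) = y" "\<And>z. z \<in> Z \<Longrightarrow> \<phi> (\<psi> z) = z"
    using Z(2) unfolding isomorphism_def pU pZ by blast
  have \<phi>Z: "\<phi> y \<in> Z" if "y \<in> U" for y using morphism_pts[OF \<phi>, of y] that unfolding pU pZ by simp
  have \<psi>U: "\<psi> z \<in> U" if "z \<in> Z" for z using morphism_pts[OF \<psi>, of z] that unfolding pU pZ by simp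
  have im: "\<phi> ` U = Z" using \<phi>Z \<psi>U inv by force
  have ZA: "Z \<subseteq> {z. \<forall>i\<ge>n. z i = 0}" using closedin_subset[OF Z(1)] by simp
  have "\<exists>a\<in>polynomial_functions n. a z \<noteq> 0 \<and> (\<forall>y\<in>U. a (\<phi> y) = 0)"
    if z: "\<forall>i\<ge>n. z i = 0" "z \<notin> Z" for z
  proof -
    \<comment> \<open>The zero function is regular on the complement of \<open>Z\<close>. A
      denominator representing it near \<open>z\<close> vanishes on \<open>Z\<close> but not at
      \<open>z\<close>, so it is the separating polynomial.\<close>
    have op: "openin (zar (affine_space n)) (pts (affine_space n) - Z)" using Z(1) by blast
    have "fraction_near (polynomial_functions n) (pts (affine_space n)) z
        (pts (affine_space n) - Z) (\<lambda>_. 0)"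
      by (rule affine_space_fraction_near[OF op swf_const[OF swfA op]]) (use z in auto)
    then obtain p q where "p \<in> polynomial_functions n" "q \<in> polynomial_functions n" "q z \<noteq> 0"
      "\<forall>w\<in>pts (affine_space n). q w \<noteq> 0 \<longrightarrow> w \<in> pts (affine_space n) - Z \<and> 0 = p w / q w"
      by (rule fraction_nearE)
    then show ?thesis using ZA \<phi>Z by (intro bexI[of _ q]) auto
  qed
  moreover have "openin (zar M) {y\<in>U. q (\<phi> y) \<noteq> 0}" if "q \<in> polynomial_functions n" for q
  proof -
    have "{y \<in> pts (subspace M U). \<phi> y \<in> {z \<in> pts (affine_space n). q z \<noteq> 0}} = {y\<in>U. q (\<phi> y) \<noteq> 0}"
      using ZA \<phi>Z unfolding pU by auto
    then show ?thesis
      using morphism_open[OF morphism_compose[OF \<phi> morphism_subspace[OF swfA]]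
          polynomial_function_nonzero_open[OF that]] open_subspace(1)[OF swf U(1)] by simp
  qed
  moreover have "\<exists>p\<in>polynomial_functions n. \<exists>q\<in>polynomial_functions n. q (\<phi> y) \<noteq> 0 \<and>
      (\<forall>w\<in>U. q (\<phi> w) \<noteq> 0 \<longrightarrow> w \<in> W \<and> h w = p (\<phi> w) / q (\<phi> w))"
    if W: "openin (zar M) W" "h \<in> reg M W" "y \<in> W \<inter> U" for W h y
  proof -
    note \<psi>M = morphism_compose[OF \<psi> morphism_subspace[OF swf]]
    have "fraction_near (polynomial_functions n) (Z \<inter> pts (affine_space n)) (\<phi> y)
        {z \<in> pts (subspace (affine_space n) Z). \<psi> z \<in> W} (h \<circ> \<psi>)"
      by (rule affine_subspace_fraction_near[OF morphism_open[OF \<psi>M W(1)] morphism_reg[OF \<psi>M W(1,2)]])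
        (use W inv \<phi>Z pZ in auto)
    then obtain p q where pq: "p \<in> polynomial_functions n" "q \<in> polynomial_functions n" "q (\<phi> y) \<noteq> 0"
      "\<forall>w\<in>Z \<inter> pts (affine_space n). q w \<noteq> 0 \<longrightarrow> w \<in> {z \<in> pts (subspace (affine_space n) Z). \<psi> z \<in> W} \<and> (h \<circ> \<psi>) w = p w / q w"
      by (rule fraction_nearE)
    have "w \<in> W \<and> h w = p (\<phi> w) / q (\<phi> w)" if "w \<in> U" "q (\<phi> w) \<noteq> 0" for w
      using pq(4)[rule_format, of "\<phi> w"] that \<phi>Z[of w] ZA inv(1)[of w] by auto
    then show ?thesis using pq(1-3) by blast
  qed
  ultimately have "affine_chart M U n \<phi>"
    using U ZA unfolding affine_chart_def im by auto
  then show ?thesis using U(2) by blast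
qed

lemma swf_prod_diff_const:
  assumes "space_with_functions X" "openin (zar X) U" "h \<in> reg X U" "finite F"
  shows "(\<lambda>x. \<Prod>c\<in>F. h x - c) \<in> reg X U"
  using assms(4)
proof (induction F)
  case empty
  then show ?case using swf_const[OF assms(1,2)] by simp
next
  case (insert c F)
  from swf_mult[OF assms(1,2) swf_add[OF assms(1-3) swf_const[OF assms(1,2), of "- c"]] insert(3)] insert(1,2)
  show ?case by simp
qed

text \<open>In a chart \<open>h\<close> is a fraction near \<open>x\<close>, and the locally closed
  set in question becomes a subset of affine space on which this fraction omits
  \<open>\<Lambda>\<close>; hence it has finitely many values there. Avoiding the finitely many
  values other than \<open>h x\<close> is an open condition.\<close>

lemma regular_function_locally_constant:
  assumes M: "variety M" and C: "closedin (zar M) C" and W: "openin (zar M) W" and h: "h \<in> reg M W"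
    and x: "x \<in> C \<inter> W" and "uncountable \<Lambda>" and \<Lambda>: "\<And>y. y \<in> C \<inter> W \<Longrightarrow> h y \<notin> \<Lambda>"
  shows "\<exists>V. openin (zar M) V \<and> x \<in> V \<and> V \<subseteq> W \<and> (\<forall>y\<in>C \<inter> V. h y = h x)"
proof -
  have swf: "space_with_functions M" using M by (simp add: variety_def)
  have "x \<in> pts M" using x openin_subset[OF W] by auto
  then obtain U n \<phi> where "x \<in> U" and ch: "affine_chart M U n \<phi>"
    using variety_affine_chart[OF M] by blast
  then have U: "openin (zar M) U" "x \<in> U" by (simp_all add: affine_chart_def)
  have closed: "\<And>z. \<forall>i\<ge>n. z i = 0 \<Longrightarrow> z \<notin> \<phi> ` U \<Longrightarrow>
       \<exists>a\<in>polynomial_functions n. a z \<noteq> 0 \<and> (\<forall>y\<in>U. a (\<phi> y) = 0)"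
    using ch by (simp add: affine_chart_def)
  have op: "\<And>q. q \<in> polynomial_functions n \<Longrightarrow> openin (zar M) {y\<in>U. q (\<phi> y) \<noteq> 0}"
    using ch by (simp add: affine_chart_def)
  have frac: "\<And>W h y. openin (zar M) W \<Longrightarrow> h \<in> reg M W \<Longrightarrow> y \<in> W \<inter> U \<Longrightarrow>
       \<exists>p\<in>polynomial_functions n. \<exists>q\<in>polynomial_functions n. q (\<phi> y) \<noteq> 0 \<and>
          (\<forall>w\<in>U. q (\<phi> w) \<noteq> 0 \<longrightarrow> w \<in> W \<and> h w = p (\<phi> w) / q (\<phi> w))"
    using ch by (simp add: affine_chart_def)
  have "x \<in> W \<inter> U" using x U(2) by auto
  from frac[OF W h this] obtain p q where p: "p \<in> polynomial_functions n" and q: "q \<in> polynomial_functions n" "q (\<phi> x) \<noteq> 0"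
    and pq: "\<And>w. w \<in> U \<Longrightarrow> q (\<phi> w) \<noteq> 0 \<Longrightarrow> w \<in> W \<and> h w = p (\<phi> w) / q (\<phi> w)"
    by (elim bexE conjE) simp
  let ?V = "{y\<in>U. q (\<phi> y) \<noteq> 0}"
  let ?T = "\<phi> ` (C \<inter> ?V)"
  have "finite ((\<lambda>t. p t / q t) ` ?T)"
  proof (rule finite_values_of_regular_function[OF p q(1) _ _ \<open>uncountable \<Lambda>\<close>])
    show "q t \<noteq> 0" if "t \<in> ?T" for t using that by auto
    show "p t / q t \<notin> \<Lambda>" if t: "t \<in> ?T" for t
    proof -
      obtain y where "y \<in> C" "y \<in> U" "q (\<phi> y) \<noteq> 0" "t = \<phi> y" using t by auto
      then show ?thesis using pq[of y] \<Lambda>[of y] by auto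
    qed
  next
    fix z assume z: "\<forall>i\<ge>n. z i = 0" "q z \<noteq> 0"
      and van: "\<And>a. a \<in> polynomial_functions n \<Longrightarrow> (\<And>t. t \<in> ?T \<Longrightarrow> a t = 0) \<Longrightarrow> a z = 0"
    have "z \<in> \<phi> ` U"
    proof (rule ccontr)
      assume "z \<notin> \<phi> ` U"
      then obtain a where "a \<in> polynomial_functions n" "a z \<noteq> 0" "\<forall>y\<in>U. a (\<phi> y) = 0"
        using closed[OF z(1)] by blast
      then show False using van[of a] by auto
    qed
    then obtain y where y: "y \<in> U" "z = \<phi> y" by auto
    have "y \<in> C"
    proof (rule ccontr)
      assume "y \<notin> C"
      \<comment> \<open>Same separation as for charts: a denominator for the zero function on the
        complement of \<open>C\<close> vanishes on the image of \<open>C\<close> and not at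
        \<open>\<phi> y\<close>, against \<open>van\<close>.\<close>
      have opC: "openin (zar M) (pts M - C)" using C by blast
      have "y \<in> (pts M - C) \<inter> U" using \<open>y \<notin> C\<close> y openin_subset[OF U(1)] by auto
      from frac[OF opC swf_const[OF swf opC, of 0] this]
      obtain a where "a \<in> polynomial_functions n" "a (\<phi> y) \<noteq> 0"
        "\<forall>w\<in>U. a (\<phi> w) \<noteq> 0 \<longrightarrow> w \<in> pts M - C" by blast
      then show False using van[of a] y by auto
    qed
    then show "z \<in> ?T" using y z by auto
  qed
  moreover have "h ` (C \<inter> ?V) \<subseteq> (\<lambda>t. p t / q t) ` ?T" using pq by auto
  ultimately have fin: "finite (h ` (C \<inter> ?V) - {h x})" using finite_subset by blast
  \<comment> \<open>Nonvanishing of this product excludes every value on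
    \<open>C \<inter> ?V\<close> except \<open>h x\<close>.\<close>
  let ?g = "\<lambda>y. \<Prod>c\<in>h ` (C \<inter> ?V) - {h x}. h y - c"
  have V': "openin (zar M) {y\<in>W. ?g y \<noteq> 0}"
    by (rule swf_nonzero[OF swf W swf_prod_diff_const[OF swf W h fin]])
  have "h y = h x" if "y \<in> C" "y \<in> ?V" "?g y \<noteq> 0" for y
    using that fin by (auto simp: prod_zero_iff)
  moreover have "?g x \<noteq> 0" using fin by (auto simp: prod_zero_iff)
  ultimately show ?thesis
    using op[OF q(1)] V' U(2) q(2) x
    by (intro exI[of _ "?V \<inter> {y\<in>W. ?g y \<noteq> 0}"]) auto
qed

section \<open>Line bundles and their fibre products\<close>

lemma subspace_inter_pts: "subspace X (S \<inter> pts X) = subspace X S"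
  by (simp add: subspace_def Int_assoc)

lemma morphism_subspace_mono:
  assumes "space_with_functions X" "T \<subseteq> S"
  shows "morphism (subspace X T) (subspace X S) (\<lambda>x. x)"
  using assms by (intro morphism_into_subspace space_with_functions_subspace morphism_subspace) auto

lemma line_bundle_swf: "line_bundle M L \<Longrightarrow> space_with_functions (tot L)"
  by (simp add: line_bundle_def variety_def)

lemma line_bundle_proj: "line_bundle M L \<Longrightarrow> morphism (tot L) M (proj L)"
  by (simp add: line_bundle_def)

lemma fibre_base: "line_bundle M L \<Longrightarrow> v \<in> fibre L x \<Longrightarrow> x \<in> pts M"
  using morphism_pts[OF line_bundle_proj] by (auto simp: fibre_def)

lemma smul_fibre: "line_bundle M L \<Longrightarrow> v \<in> fibre L x \<Longrightarrow> smul L c v \<in> fibre L x"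
  by (auto simp: fibre_def line_bundle_def)

lemma fibre_star_subset: "fibre_star L x \<subseteq> fibre L x"
  by (auto simp: fibre_star_def)

lemma fibre_starD: "v \<in> fibre_star L x \<Longrightarrow> v \<in> fibre L x"
  by (simp add: fibre_star_def)

lemma line_bundle_trivialization:
  assumes "line_bundle M L" "x \<in> pts M"
  obtains U \<Phi> where "x \<in> U" "trivialization M L U \<Phi>"
  using assms unfolding line_bundle_def by blast

lemma trivialization_inverse:
  assumes "trivialization M L U \<Phi>"
  obtains \<Psi> where
    "morphism (subspace (tot L) {v. proj L v \<in> U}) (product (subspace M U) affine_line) \<Phi>"
    "morphism (product (subspace M U) affine_line) (subspace (tot L) {v. proj L v \<in> U}) \<Psi>"
    "\<forall>v\<in>pts (tot L). proj L v \<in> U \<longrightarrow> \<Psi> (\<Phi> v) = v"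
    "\<forall>x\<in>U. \<forall>t. \<Phi> (\<Psi> (x, t)) = (x, t)"
proof -
  have U: "openin (zar M) U" using assms by (simp add: trivialization_def)
  obtain \<Psi> where
    "morphism (subspace (tot L) {v. proj L v \<in> U}) (product (subspace M U) affine_line) \<Phi>"
    "morphism (product (subspace M U) affine_line) (subspace (tot L) {v. proj L v \<in> U}) \<Psi>"
    "\<forall>v\<in>pts (subspace (tot L) {v. proj L v \<in> U}). \<Psi> (\<Phi> v) = v"
    "\<forall>y\<in>pts (product (subspace M U) affine_line). \<Phi> (\<Psi> y) = y"
    using assms unfolding trivialization_def isomorphism_def by (elim conjE exE)
  then show ?thesis using openin_subset[OF U] by (intro that[of \<Psi>]) auto
qed

lemma trivialization_fst:
  "trivialization M L U \<Phi> \<Longrightarrow> x \<in> U \<Longrightarrow> v \<in> fibre L x \<Longrightarrow> fst (\<Phi> v) = x"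
  by (auto simp: trivialization_def fibre_def)

lemma trivialization_snd:
  "trivialization M L U \<Phi> \<Longrightarrow> x \<in> U \<Longrightarrow> v \<in> fibre L x \<Longrightarrow> snd (\<Phi> (smul L c v)) = c * snd (\<Phi> v)"
  by (auto simp: trivialization_def fibre_def)

lemma trivialization_inj:
  assumes "trivialization M L U \<Phi>" "x \<in> U" "v \<in> fibre L x" "w \<in> fibre L x" "snd (\<Phi> v) = snd (\<Phi> w)"
  shows "v = w"
proof -
  obtain \<Psi> where "\<forall>v\<in>pts (tot L). proj L v \<in> U \<longrightarrow> \<Psi> (\<Phi> v) = v"
    by (rule trivialization_inverse[OF assms(1)])
  then have "\<Psi> (\<Phi> v) = v" "\<Psi> (\<Phi> w) = w" using assms by (auto simp: fibre_def)
  moreover have "\<Phi> v = \<Phi> w"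
    using trivialization_fst[OF assms(1,2)] assms(3-5) by (auto intro: prod_eqI)
  ultimately show ?thesis by metis
qed

text \<open>The module laws are not built into \<open>line_bundle\<close>; they are read off in a
  trivialization, where scalars multiply the second coordinate.\<close>

lemma smul_smul:
  assumes L: "line_bundle M L" and v: "v \<in> fibre L x"
  shows "smul L c (smul L d v) = smul L (c * d) v"
proof -
  obtain U \<Phi> where U: "x \<in> U" "trivialization M L U \<Phi>"
    using line_bundle_trivialization[OF L fibre_base[OF L v]] .
  show ?thesis
    by (rule trivialization_inj[OF U(2,1)]) (simp_all add: smul_fibre[OF L] v trivialization_snd[OF U(2,1)])
qed

lemma smul_one:
  assumes L: "line_bundle M L" and v: "v \<in> fibre L x"
  shows "smul L 1 v = v"
proof -
  obtain U \<Phi> where U: "x \<in> U" "trivialization M L U \<Phi>"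
    using line_bundle_trivialization[OF L fibre_base[OF L v]] .
  show ?thesis
    by (rule trivialization_inj[OF U(2,1)]) (simp_all add: smul_fibre[OF L] v trivialization_snd[OF U(2,1)])
qed

lemma fibre_star_iff:
  assumes L: "line_bundle M L" and U: "x \<in> U" "trivialization M L U \<Phi>" and v: "v \<in> fibre L x"
  shows "v \<in> fibre_star L x \<longleftrightarrow> snd (\<Phi> v) \<noteq> 0"
proof -
  have "is_zero L v \<longleftrightarrow> snd (\<Phi> v) = 0"
    using trivialization_snd[OF U(2,1) v, of 0]
      trivialization_inj[OF U(2,1) smul_fibre[OF L v, of 0] v] by (auto simp: is_zero_def)
  then show ?thesis using v by (simp add: fibre_star_def)
qed

lemma smul_fibre_star:
  assumes L: "line_bundle M L" and v: "v \<in> fibre_star L x" and "c \<noteq> 0"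
  shows "smul L c v \<in> fibre_star L x"
proof -
  have v': "v \<in> fibre L x" by (rule fibre_starD[OF v])
  obtain U \<Phi> where U: "x \<in> U" "trivialization M L U \<Phi>"
    using line_bundle_trivialization[OF L fibre_base[OF L v']] .
  show ?thesis
    using v \<open>c \<noteq> 0\<close> unfolding fibre_star_iff[OF L U v'] fibre_star_iff[OF L U smul_fibre[OF L v']]
    by (simp add: trivialization_snd[OF U(2,1) v'])
qed

lemma fibre_star_ratio:
  assumes L: "line_bundle M L" and v: "v \<in> fibre_star L x" "w \<in> fibre_star L x"
  shows "\<exists>c. c \<noteq> 0 \<and> w = smul L c v"
proof -
  have v': "v \<in> fibre L x" "w \<in> fibre L x" using v by (simp_all add: fibre_starD)
  obtain U \<Phi> where U: "x \<in> U" "trivialization M L U \<Phi>"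
    using line_bundle_trivialization[OF L fibre_base[OF L v'(1)]] .
  have n: "snd (\<Phi> v) \<noteq> 0" "snd (\<Phi> w) \<noteq> 0" using v fibre_star_iff[OF L U] v' by auto
  have "w = smul L (snd (\<Phi> w) / snd (\<Phi> v)) v"
    by (rule trivialization_inj[OF U(2,1) v'(2) smul_fibre[OF L v'(1)]])
      (simp add: trivialization_snd[OF U(2,1) v'(1)] n)
  then show ?thesis using n by (intro exI[of _ "snd (\<Phi> w) / snd (\<Phi> v)"]) auto
qed

text \<open>The constant section \<open>1\<close> of a trivialization, carried back by its inverse,
  vanishes nowhere.\<close>

lemma line_bundle_local_frame:
  assumes M: "space_with_functions M" and L: "line_bundle M L" and x: "x \<in> pts M"
  shows "\<exists>U e. openin (zar M) U \<and> x \<in> U \<and> morphism (subspace M U) (tot L) e \<and>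
    (\<forall>y\<in>U. e y \<in> fibre_star L y)"
proof -
  obtain U \<Phi> where U: "x \<in> U" "trivialization M L U \<Phi>" using line_bundle_trivialization[OF L x] .
  have op: "openin (zar M) U" using U(2) by (simp add: trivialization_def)
  obtain \<Psi> where
    \<Psi>: "morphism (product (subspace M U) affine_line) (subspace (tot L) {v. proj L v \<in> U}) \<Psi>"
       "\<forall>x\<in>U. \<forall>t. \<Phi> (\<Psi> (x, t)) = (x, t)"
    by (rule trivialization_inverse[OF U(2)])
  have "morphism (subspace M U) (product (subspace M U) affine_line) (\<lambda>y. (y, 1))"
    using swf_const[OF space_with_functions_subspace openin_topspace, of 1 M U]
    by (intro morphism_pair morphism_id space_with_functions_subspace)
      (simp add: morphism_affine_line space_with_functions_subspace)
  from morphism_compose[OF morphism_compose[OF this \<Psi>(1)] morphism_subspace[OF line_bundle_swf[OF L]]]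
  have "morphism (subspace M U) (tot L) (\<lambda>y. \<Psi> (y, 1))" .
  moreover have "\<Psi> (y, 1) \<in> fibre_star L y" if y: "y \<in> U" for y
  proof -
    have p: "\<Psi> (y, 1) \<in> pts (tot L)" "proj L (\<Psi> (y, 1)) \<in> U"
      using morphism_pts[OF \<Psi>(1), of "(y, 1)"] y openin_subset[OF op] by auto
    then have "proj L (\<Psi> (y, 1)) = y"
      using trivialization_fst[OF U(2) p(2), of "\<Psi> (y, 1)"] \<Psi>(2)[rule_format, OF y] by (simp add: fibre_def)
    then show ?thesis
      using fibre_star_iff[OF L y U(2), of "\<Psi> (y, 1)"] \<Psi>(2)[rule_format, OF y] p by (simp add: fibre_def)
  qed
  ultimately show ?thesis using U(1) op by blast
qed

lemma line_bundles_local_frame: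
  assumes M: "space_with_functions M" and "finite J" and L: "\<And>j. j \<in> J \<Longrightarrow> line_bundle M (L j)"
    and x: "x \<in> pts M"
  shows "\<exists>U e. openin (zar M) U \<and> x \<in> U \<and>
    (\<forall>j\<in>J. morphism (subspace M U) (tot (L j)) (e j) \<and> (\<forall>y\<in>U. e j y \<in> fibre_star (L j) y))"
  using assms(2,3)
proof (induction J)
  case empty
  then show ?case using x by (intro exI[of _ "pts M"]) auto
next
  case (insert i J)
  obtain U e where U: "openin (zar M) U" "x \<in> U"
    and e: "\<And>j. j \<in> J \<Longrightarrow> morphism (subspace M U) (tot (L j)) (e j)"
      "\<And>j y. j \<in> J \<Longrightarrow> y \<in> U \<Longrightarrow> e j y \<in> fibre_star (L j) y"
    using insert(3)[OF insert(4)] by auto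
  obtain V e' where V: "openin (zar M) V" "x \<in> V" "morphism (subspace M V) (tot (L i)) e'"
    "\<And>y. y \<in> V \<Longrightarrow> e' y \<in> fibre_star (L i) y"
    using line_bundle_local_frame[OF M insert(4)[of i] x] by auto
  have m: "morphism (subspace M (U \<inter> V)) (subspace M U) (\<lambda>x. x)"
       "morphism (subspace M (U \<inter> V)) (subspace M V) (\<lambda>x. x)"
    by (rule morphism_subspace_mono[OF M]; blast)+
  have "openin (zar M) (U \<inter> V)" using U V by blast
  moreover have "morphism (subspace M (U \<inter> V)) (tot (L j)) (if j = i then e' else e j)"
    if "j \<in> insert i J" for j
    using that morphism_compose[OF m(1) e(1)[of j]] morphism_compose[OF m(2) V(3)] by auto
  moreover have "(if j = i then e' else e j) y \<in> fibre_star (L j) y" if "j \<in> insert i J" "y \<in> U \<inter> V" for j y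
    using that e(2) V(4) by auto
  ultimately show ?case
    using U(2) V(2) by (intro exI[of _ "U \<inter> V"] exI[of _ "\<lambda>j. if j = i then e' else e j"]) blast
qed

text \<open>Only the fibrewise rule for \<open>smul\<close> is given. For a fixed scalar, each
  trivialization turns it into \<open>(x, t) \<mapsto> (x, c t)\<close>, and these local
  descriptions are glued.\<close>

lemma morphism_smul:
  assumes M: "space_with_functions M" and L: "line_bundle M L"
  shows "morphism (tot L) (tot L) (smul L c)"
proof (rule morphism_local[OF line_bundle_swf[OF L]])
  fix v assume v: "v \<in> pts (tot L)"
  then have "proj L v \<in> pts M" using morphism_pts[OF line_bundle_proj[OF L]] by blast
  then obtain U \<Phi> where U: "proj L v \<in> U" "trivialization M L U \<Phi>"
    using line_bundle_trivialization[OF L] by blast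
  have op: "openin (zar M) U" using U(2) by (simp add: trivialization_def)
  obtain \<Psi> where
    \<Phi>: "morphism (subspace (tot L) {v. proj L v \<in> U}) (product (subspace M U) affine_line) \<Phi>" and
    \<Psi>: "morphism (product (subspace M U) affine_line) (subspace (tot L) {v. proj L v \<in> U}) \<Psi>"
    and inv: "\<forall>v\<in>pts (tot L). proj L v \<in> U \<longrightarrow> \<Psi> (\<Phi> v) = v"
      "\<forall>x\<in>U. \<forall>t. \<Phi> (\<Psi> (x, t)) = (x, t)"
    using trivialization_inverse[OF U(2)] .
  let ?V = "{v \<in> pts (tot L). proj L v \<in> U}"
  have V: "subspace (tot L) ?V = subspace (tot L) {v. proj L v \<in> U}"
    using subspace_inter_pts[of "tot L" "{v. proj L v \<in> U}"] by (simp add: Int_def conj_commute)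
  have "(\<lambda>t. c * t) \<in> reg affine_line UNIV"
    using swf_mult[OF space_with_functions_affine_line, of UNIV "\<lambda>_. c" "\<lambda>t. t"]
      swf_const[OF space_with_functions_affine_line, of UNIV c] morphism_id[of affine_line]
      openin_topspace[of "zar affine_line"]
    by (simp add: morphism_affine_line space_with_functions_affine_line)
  then have mul: "morphism affine_line affine_line (\<lambda>t. c * t)"
    by (simp add: morphism_affine_line space_with_functions_affine_line)
  note fstm = morphism_compose[OF \<Phi> morphism_fst[OF space_with_functions_subspace]]
  note sndm = morphism_compose[OF morphism_compose[OF \<Phi> morphism_snd[OF space_with_functions_affine_line]] mul]
  note m = morphism_compose[OF morphism_compose[OF morphism_pair[OF space_with_functions_subspace fstm sndm] \<Psi>]
      morphism_subspace[OF line_bundle_swf[OF L]]]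
  have "smul L c w = \<Psi> (fst (\<Phi> w), c * snd (\<Phi> w))" if w: "w \<in> ?V" for w
  proof -
    have f: "w \<in> fibre L (proj L w)" "proj L w \<in> U" using w by (auto simp: fibre_def)
    have f': "smul L c w \<in> fibre L (proj L w)" using smul_fibre[OF L f(1)] .
    have "\<Phi> (smul L c w) = (fst (\<Phi> w), c * snd (\<Phi> w))"
      using trivialization_fst[OF U(2) f(2)] trivialization_snd[OF U(2) f(2,1)] f(1) f'
      by (auto intro: prod_eqI)
    then show ?thesis using inv(1)[rule_format, of "smul L c w"] f' f(2) by (simp add: fibre_def)
  qed
  moreover have "openin (zar (tot L)) ?V" by (rule morphism_open[OF line_bundle_proj[OF L] op])
  ultimately show "\<exists>V \<psi>. openin (zar (tot L)) V \<and> v \<in> V \<and> morphism (subspace (tot L) V) (tot L) \<psi> \<and>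
      (\<forall>w\<in>V. smul L c w = \<psi> w)"
    using m v U(1) unfolding V[symmetric]
    by (intro exI[of _ ?V] exI[of _ "\<lambda>w. \<Psi> (fst (\<Phi> w), c * snd (\<Phi> w))"]) auto
qed

lemma pts_fibre_product [simp]:
  "pts (fibre_product M L J) = {(x, v). x \<in> pts M \<and> v \<in> (\<Pi>\<^sub>E j\<in>J. fibre (L j) x)}"
  by (simp add: fibre_product_def)

lemma space_with_functions_fibre_product: "space_with_functions (fibre_product M L J)"
  by (simp add: fibre_product_def space_with_functions_generated)

lemma morphism_fibre_product_base:
  assumes "space_with_functions M"
  shows "morphism (fibre_product M L J) M fst"
proof (rule morphismI)
  show "fst x \<in> pts M" if "x \<in> pts (fibre_product M L J)" for x using that by auto
  fix V assume V: "openin (zar M) V"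
  let ?P = "{(x, v). x \<in> pts M \<and> v \<in> (\<Pi>\<^sub>E j\<in>J. fibre (L j) x)}"
  have eq: "{x \<in> pts (fibre_product M L J). fst x \<in> V} = fst -` V \<inter> ?P" by auto
  have *: "(fst -` V, f \<circ> fst) \<in> pullback fst (sections M) \<union>
        (\<Union>j\<in>J. pullback (\<lambda>(x, v). v j) (sections (tot (L j))))" if "f \<in> reg M V" for f
    using V that by (force simp: pullback_def sections_def)
  show "openin (zar (fibre_product M L J)) {x \<in> pts (fibre_product M L J). fst x \<in> V}"
    using generated_base(1)[OF *[OF swf_const[OF assms V]]] unfolding eq by (simp add: fibre_product_def)
  show "f \<circ> fst \<in> reg (fibre_product M L J) {x \<in> pts (fibre_product M L J). fst x \<in> V}"
    if "f \<in> reg M V" for f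
    using generated_base(2)[OF *[OF that]] unfolding eq by (simp add: fibre_product_def)
qed

lemma morphism_fibre_product_component:
  assumes "space_with_functions (tot (L j))" "j \<in> J"
  shows "morphism (fibre_product M L J) (tot (L j)) (\<lambda>p. snd p j)"
proof (rule morphismI)
  show "snd x j \<in> pts (tot (L j))" if "x \<in> pts (fibre_product M L J)" for x
    using that assms(2) by (auto simp: fibre_def PiE_iff)
  fix V assume V: "openin (zar (tot (L j))) V"
  let ?P = "{(x, v). x \<in> pts M \<and> v \<in> (\<Pi>\<^sub>E j\<in>J. fibre (L j) x)}"
  have eq: "{x \<in> pts (fibre_product M L J). snd x j \<in> V} = (\<lambda>p. snd p j) -` V \<inter> ?P" by auto
  have *: "((\<lambda>p. snd p j) -` V, f \<circ> (\<lambda>p. snd p j)) \<in> pullback fst (sections M) \<union>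
        (\<Union>j\<in>J. pullback (\<lambda>(x, v). v j) (sections (tot (L j))))" if "f \<in> reg (tot (L j)) V" for f
  proof -
    have "((\<lambda>p. snd p j) -` V, f \<circ> (\<lambda>p. snd p j)) \<in> pullback (\<lambda>(x, v). v j) (sections (tot (L j)))"
      unfolding pullback_def case_prod_beta'
      by (rule image_eqI[of _ _ "(V, f)"]) (use V that in \<open>auto simp: sections_def\<close>)
    then show ?thesis using assms(2) by blast
  qed
  show "openin (zar (fibre_product M L J)) {x \<in> pts (fibre_product M L J). snd x j \<in> V}"
    using generated_base(1)[OF *[OF swf_const[OF assms(1) V]]] unfolding eq by (simp add: fibre_product_def)
  show "f \<circ> (\<lambda>p. snd p j) \<in> reg (fibre_product M L J) {x \<in> pts (fibre_product M L J). snd x j \<in> V}"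
    if "f \<in> reg (tot (L j)) V" for f
    using generated_base(2)[OF *[OF that]] unfolding eq by (simp add: fibre_product_def)
qed

lemma morphism_into_fibre_product:
  assumes X: "space_with_functions X" and \<phi>: "morphism X M \<phi>"
    and w: "\<And>j. j \<in> J \<Longrightarrow> morphism X (tot (L j)) (\<lambda>x. w x j)"
    and P: "\<And>x. x \<in> pts X \<Longrightarrow> w x \<in> (\<Pi>\<^sub>E j\<in>J. fibre (L j) (\<phi> x))"
  shows "morphism X (fibre_product M L J) (\<lambda>x. (\<phi> x, w x))"
  unfolding fibre_product_def
proof (rule morphism_generated[OF X])
  show "(\<phi> x, w x) \<in> {(x, v). x \<in> pts M \<and> v \<in> (\<Pi>\<^sub>E j\<in>J. fibre (L j) x)}" if "x \<in> pts X" for x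
    using that P morphism_pts[OF \<phi>] by auto
next
  fix U f assume "(U, f) \<in> pullback fst (sections M) \<union>
        (\<Union>j\<in>J. pullback (\<lambda>(x, v). v j) (sections (tot (L j))))"
  then consider V h where "openin (zar M) V" "h \<in> reg M V" "U = fst -` V" "f = h \<circ> fst"
    | j V h where "j \<in> J" "openin (zar (tot (L j))) V" "h \<in> reg (tot (L j)) V"
        "U = (\<lambda>p. snd p j) -` V" "f = h \<circ> (\<lambda>p. snd p j)"
    unfolding case_prod_beta' by (auto simp: pullback_def sections_def)
  then have "openin (zar X) {x \<in> pts X. (\<phi> x, w x) \<in> U} \<and>
     f \<circ> (\<lambda>x. (\<phi> x, w x)) \<in> reg X {x \<in> pts X. (\<phi> x, w x) \<in> U}"
  proof cases
    case 1
    then show ?thesis using morphism_open[OF \<phi>] morphism_reg[OF \<phi>] by (auto simp: comp_def)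
  next
    case 2
    then show ?thesis using morphism_open[OF w] morphism_reg[OF w] by (auto simp: comp_def)
  qed
  then show "openin (zar X) {x \<in> pts X. (\<phi> x, w x) \<in> U}"
     "f \<circ> (\<lambda>x. (\<phi> x, w x)) \<in> reg X {x \<in> pts X. (\<phi> x, w x) \<in> U}" by auto
qed

lemma pts_L_star:
  "pts (L_star M L I Di J) =
     {(x, v). x \<in> stratum M I Di J \<and> v \<in> (\<Pi>\<^sub>E j\<in>J. fibre_star (L j) x)}"
  by (auto simp: L_star_def stratum_def PiE_iff fibre_star_def)

section \<open>Rescaling one coordinate over a stratum\<close>

definition rescale :: "('i \<Rightarrow> ('a, 'l) lbundle) \<Rightarrow> 'i \<Rightarrow> ('a \<Rightarrow> complex) \<Rightarrow> 'a \<times> ('i \<Rightarrow> 'l) \<Rightarrow> 'a \<times> ('i \<Rightarrow> 'l)"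
  where "rescale L j \<rho> = (\<lambda>(x, v). (x, v(j := smul (L j) (\<rho> x) (v j))))"

lemma rescale_pts:
  assumes "line_bundle M (L j)" "j \<in> J" "p \<in> pts (L_star M L I Di J)" "\<rho> (fst p) \<noteq> 0"
  shows "rescale L j \<rho> p \<in> pts (L_star M L I Di J)"
  using assms smul_fibre_star[OF assms(1)] by (auto simp: pts_L_star rescale_def PiE_iff extensional_def)

text \<open>Scalar multiplication is known to be regular for a fixed scalar. Since
  \<open>\<rho>\<close> is locally constant on the stratum, its pullback is constant near each point
  of \<open>L_star\<close>, and gluing gives a morphism.\<close>

lemma morphism_rescale:
  assumes M: "space_with_functions M" and L: "\<And>j. j \<in> J \<Longrightarrow> line_bundle M (L j)" and j: "j \<in> J"
    and \<rho>0: "\<And>x. x \<in> stratum M I Di J \<Longrightarrow> \<rho> x \<noteq> 0"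
    and \<rho>: "\<And>x. x \<in> stratum M I Di J \<Longrightarrow>
       \<exists>V. openin (zar M) V \<and> x \<in> V \<and> (\<forall>y\<in>stratum M I Di J \<inter> V. \<rho> y = \<rho> x)"
  shows "morphism (L_star M L I Di J) (L_star M L I Di J) (rescale L j \<rho>)"
proof -
  let ?X = "L_star M L I Di J"
  have X: "space_with_functions ?X" by (simp add: L_star_def space_with_functions_subspace)
  have inc: "morphism ?X (fibre_product M L J) (\<lambda>p. p)"
    unfolding L_star_def by (intro morphism_subspace space_with_functions_fibre_product)
  note base = morphism_compose[OF inc morphism_fibre_product_base[OF M]]
  have comp: "morphism ?X (tot (L i)) (\<lambda>p. snd p i)" if "i \<in> J" for i
    by (rule morphism_compose[OF inc
          morphism_fibre_product_component[where L = L and j = i, OF line_bundle_swf[OF L[OF that]] that]])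
  have resc: "morphism ?X (tot (L j)) (\<lambda>p. smul (L j) (\<rho> (fst p)) (snd p j))"
  proof (rule morphism_local[OF X])
    fix p assume p: "p \<in> pts ?X"
    then have "fst p \<in> stratum M I Di J" by (auto simp: pts_L_star)
    from \<rho>[OF this] obtain V where V: "openin (zar M) V" "fst p \<in> V"
      "\<And>y. y \<in> stratum M I Di J \<Longrightarrow> y \<in> V \<Longrightarrow> \<rho> y = \<rho> (fst p)" by auto
    let ?V = "{q \<in> pts ?X. fst q \<in> V}"
    have "morphism (subspace ?X ?V) (tot (L j)) (\<lambda>q. smul (L j) (\<rho> (fst p)) (snd q j))"
      using morphism_compose[OF morphism_compose[OF morphism_subspace[OF X] comp[OF j]]
          morphism_smul[OF M L[OF j]]] .
    moreover have "openin (zar ?X) ?V" by (rule morphism_open[OF base V(1)])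
    moreover have "p \<in> ?V" using p V(2) by simp
    moreover have "\<forall>q\<in>?V. smul (L j) (\<rho> (fst q)) (snd q j) = smul (L j) (\<rho> (fst p)) (snd q j)"
    proof
      fix q assume "q \<in> ?V"
      then have "\<rho> (fst q) = \<rho> (fst p)" by (intro V(3)) (auto simp: pts_L_star)
      then show "smul (L j) (\<rho> (fst q)) (snd q j) = smul (L j) (\<rho> (fst p)) (snd q j)"
        by (rule arg_cong)
    qed
    ultimately show "\<exists>V \<psi>. openin (zar ?X) V \<and> p \<in> V \<and> morphism (subspace ?X V) (tot (L j)) \<psi> \<and>
        (\<forall>q\<in>V. smul (L j) (\<rho> (fst q)) (snd q j) = \<psi> q)"
      by (intro exI[of _ ?V] exI[of _ "\<lambda>q. smul (L j) (\<rho> (fst p)) (snd q j)"] conjI)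
  qed
  have resc_pts: "rescale L j \<rho> p \<in> pts ?X" if "p \<in> pts ?X" for p
    using that by (intro rescale_pts[where L = L and j = j, OF L[OF j] j] \<rho>0) (auto simp: pts_L_star)
  have "morphism ?X (fibre_product M L J)
      (\<lambda>p. (fst p, (snd p)(j := smul (L j) (\<rho> (fst p)) (snd p j))))"
  proof (rule morphism_into_fibre_product[OF X base])
    fix i assume "i \<in> J"
    then show "morphism ?X (tot (L i)) (\<lambda>p. ((snd p)(j := smul (L j) (\<rho> (fst p)) (snd p j))) i)"
      using comp resc by (cases "i = j") auto
  next
    fix p assume "p \<in> pts ?X"
    from resc_pts[OF this] have "(snd p)(j := smul (L j) (\<rho> (fst p)) (snd p j)) \<in>
        (\<Pi>\<^sub>E i\<in>J. fibre_star (L i) (fst p))"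
      by (simp add: pts_L_star rescale_def case_prod_beta)
    then show "(snd p)(j := smul (L j) (\<rho> (fst p)) (snd p j)) \<in> (\<Pi>\<^sub>E i\<in>J. fibre (L i) (fst p))"
      by (rule subsetD[OF PiE_mono[OF fibre_star_subset]])
  qed
  moreover have "rescale L j \<rho> = (\<lambda>p. (fst p, (snd p)(j := smul (L j) (\<rho> (fst p)) (snd p j))))"
    by (simp add: rescale_def case_prod_beta')
  ultimately have "morphism ?X (fibre_product M L J) (rescale L j \<rho>)" by simp
  then show ?thesis
    unfolding L_star_def
    by (rule morphism_into_subspace[OF space_with_functions_subspace, unfolded L_star_def[symmetric]])
      (use resc_pts in \<open>auto simp: L_star_def\<close>)
qed

section \<open>Comparison of the strata\<close>

locale snc =
  fixes M :: "'a fspace" and L :: "'i \<Rightarrow> ('a, 'l) lbundle" and s :: "'i \<Rightarrow> 'a \<Rightarrow> 'l"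
    and I :: "'i set" and Di :: "'i \<Rightarrow> 'a set"
  assumes variety: "variety M" and data: "snc_data M L s I Di"
begin

lemma M_swf: "space_with_functions M"
  using variety by (simp add: variety_def)

lemma finite_I: "finite I"
  using data by (simp add: snc_data_def)

lemma line_bundle_L: "i \<in> I \<Longrightarrow> line_bundle M (L i)"
  using data by (simp add: snc_data_def)

lemma section_morphism: "i \<in> I \<Longrightarrow> morphism M (tot (L i)) (s i)"
  using data by (simp add: snc_data_def regular_section_def)

lemma section_fibre: "i \<in> I \<Longrightarrow> x \<in> pts M \<Longrightarrow> s i x \<in> fibre (L i) x"
  using data morphism_pts[OF section_morphism]
  by (auto simp: snc_data_def regular_section_def fibre_def)

lemma section_fibre_star: "i \<in> I \<Longrightarrow> x \<in> pts M \<Longrightarrow> x \<notin> Di i \<Longrightarrow> s i x \<in> fibre_star (L i) x"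
  using data section_fibre[of i x] by (auto simp: snc_data_def zero_locus_def fibre_star_def)

lemma closed_Di: "i \<in> I \<Longrightarrow> closedin (zar M) (Di i)"
  using data by (simp add: snc_data_def nonsingular_hypersurface_def)

lemma nonempty_Di: "i \<in> I \<Longrightarrow> Di i \<noteq> {}"
  using data by (simp add: snc_data_def nonsingular_hypersurface_def)

abbreviation strat :: "'i set \<Rightarrow> 'a set" where
  "strat J \<equiv> stratum M I Di J"

abbreviation frames :: "'i set \<Rightarrow> 'a \<Rightarrow> ('i \<Rightarrow> 'l) set" where
  "frames J x \<equiv> \<Pi>\<^sub>E j\<in>J. fibre_star (L j) x"

lemma stratum_pts: "x \<in> strat J \<Longrightarrow> x \<in> pts M"
  by (simp add: stratum_def)

lemma stratum_eq: "J \<subseteq> I \<Longrightarrow> x \<in> strat J \<Longrightarrow> {j\<in>I. x \<in> Di j} = J"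
  by (auto simp: stratum_def)

text \<open>\<open>f_strat\<close> evaluates \<open>u\<close> at this \<open>I\<close>-tuple. The
  entries outside \<open>J\<close> are sections that do not vanish on the stratum of
  \<open>J\<close>, so \<open>u\<close> is nonzero there.\<close>

lemma completion_fibre_star:
  assumes "J \<subseteq> I" "x \<in> strat J" "v \<in> frames J x"
  shows "(\<lambda>i\<in>I. if i \<in> J then v i else s i x) \<in> (\<Pi>\<^sub>E i\<in>I. fibre_star (L i) x)"
  using assms section_fibre_star by (auto simp: stratum_def PiE_iff)

lemma frames_nonempty:
  assumes "J \<subseteq> I" "x \<in> pts M"
  shows "\<exists>v. v \<in> frames J x"
proof -
  have "\<exists>U e. openin (zar M) U \<and> x \<in> U \<and>
      (\<forall>j\<in>J. morphism (subspace M U) (tot (L j)) (e j) \<and> (\<forall>y\<in>U. e j y \<in> fibre_star (L j) y))"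
    using assms finite_subset[OF assms(1) finite_I] line_bundle_L
    by (intro line_bundles_local_frame[OF M_swf]) auto
  then obtain U e where "x \<in> U" "\<forall>j\<in>J. \<forall>y\<in>U. e j y \<in> fibre_star (L j) y" by blast
  then show ?thesis by (intro exI[of _ "\<lambda>j\<in>J. e j x"]) auto
qed

lemma f_strat_cong:
  assumes "\<And>j. j \<in> J \<Longrightarrow> v j = w j"
  shows "f_strat s I u J (x, v) = f_strat s I u J (x, w)"
proof -
  have "(\<lambda>i\<in>I. if i \<in> J then v i else s i x) = (\<lambda>i\<in>I. if i \<in> J then w i else s i x)"
    using assms by (intro restrict_ext) auto
  then show ?thesis by (simp only: f_strat_def prod.case)
qed

lemma f_strat_nonzero:
  assumes u: "nowhere_vanishing_section_neg_tensor M L I N u" and "J \<subseteq> I" "x \<in> strat J" "v \<in> frames J x"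
  shows "f_strat s I u J (x, v) \<noteq> 0"
  using u completion_fibre_star[OF assms(2-4)] stratum_pts[OF assms(3)]
  unfolding nowhere_vanishing_section_neg_tensor_def f_strat_def prod.case by blast

lemma f_strat_smul:
  assumes u: "nowhere_vanishing_section_neg_tensor M L I N u" and J: "J \<subseteq> I" and x: "x \<in> strat J"
    and v: "v \<in> frames J x"
  shows "f_strat s I u J (x, \<lambda>j\<in>J. smul (L j) (c j) (v j)) = (\<Prod>j\<in>J. c j ^ N j) * f_strat s I u J (x, v)"
proof -
  let ?w = "\<lambda>i\<in>I. if i \<in> J then v i else s i x"
  \<comment> \<open>Scalar \<open>1\<close> outside \<open>J\<close>, where the completing sections
    \<open>s i\<close> stay fixed, brings the homogeneity of \<open>u\<close> in all
    \<open>I\<close> variables to bear.\<close>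
  let ?c = "\<lambda>i. if i \<in> J then c i else 1"
  have w: "?w \<in> (\<Pi>\<^sub>E i\<in>I. fibre (L i) x)"
    by (rule subsetD[OF PiE_mono[OF fibre_star_subset] completion_fibre_star[OF J x v]])
  have "(\<lambda>i\<in>I. if i \<in> J then (\<lambda>j\<in>J. smul (L j) (c j) (v j)) i else s i x) =
      (\<lambda>i\<in>I. smul (L i) (?c i) (?w i))"
    using smul_one[OF line_bundle_L section_fibre[OF _ stratum_pts[OF x]]]
    by (intro restrict_ext) auto
  then have "f_strat s I u J (x, \<lambda>j\<in>J. smul (L j) (c j) (v j)) = u (x, \<lambda>i\<in>I. smul (L i) (?c i) (?w i))"
    by (simp only: f_strat_def prod.case)
  also have "\<dots> = (\<Prod>i\<in>I. ?c i ^ N i) * u (x, ?w)"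
    by (rule u[unfolded nowhere_vanishing_section_neg_tensor_def, THEN conjunct2, THEN conjunct1,
          rule_format, OF stratum_pts[OF x] w])
  also have "(\<Prod>i\<in>I. ?c i ^ N i) = (\<Prod>j\<in>J. c j ^ N j)"
    using J finite_I by (intro prod.mono_neutral_cong_right) auto
  finally show ?thesis unfolding f_strat_def prod.case .
qed

text \<open>The punctured fibres are single orbits of nonzero scalars, so the torus indexed by
  \<open>J\<close> acts transitively on frames at \<open>x\<close>.\<close>

lemma frames_ratio:
  assumes "J \<subseteq> I" "v \<in> frames J x" "w \<in> frames J x"
  shows "\<exists>c. (\<forall>j\<in>J. c j \<noteq> 0) \<and> w = (\<lambda>j\<in>J. smul (L j) (c j) (v j))"
proof -
  have "\<exists>c. c \<noteq> 0 \<and> w j = smul (L j) c (v j)" if "j \<in> J" for j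
    using assms that by (intro fibre_star_ratio[OF line_bundle_L]) auto
  then obtain c where c: "\<And>j. j \<in> J \<Longrightarrow> c j \<noteq> 0 \<and> w j = smul (L j) (c j) (v j)" by metis
  have "w = (\<lambda>j\<in>J. smul (L j) (c j) (v j))"
    using c assms(3) by (intro extensionalityI[of _ J]) (auto simp: PiE_iff)
  then show ?thesis using c by blast
qed

lemma frames_smul:
  assumes "J \<subseteq> I" "v \<in> frames J x" "\<And>j. j \<in> J \<Longrightarrow> c j \<noteq> 0"
  shows "(\<lambda>j\<in>J. smul (L j) (c j) (v j)) \<in> frames J x"
  using assms by (auto simp: PiE_iff intro!: smul_fibre_star[OF line_bundle_L])

text \<open>The representatives picked by \<open>SOME\<close> differ from the \<open>v j\<close> by
  positive factors. Homogeneity turns these into one positive factor of the value, which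
  \<open>sgn\<close> ignores.\<close>

lemma sign_map_eq:
  assumes u: "nowhere_vanishing_section_neg_tensor M L I N u" and J: "J \<subseteq> I" and x: "x \<in> strat J"
    and v: "v \<in> frames J x"
    and \<theta>: "\<And>j. j \<in> J \<Longrightarrow> \<theta> j = ray (L j) (v j)"
  shows "sign_map s I Di u (x, \<theta>) = sgn (f_strat s I u J (x, v))"
proof -
  have "\<exists>r>0. (SOME w. w \<in> \<theta> j) = smul (L j) (complex_of_real r) (v j)" if j: "j \<in> J" for j
  proof -
    have "smul (L j) (complex_of_real 1) (v j) \<in> \<theta> j"
      unfolding \<theta>[OF j] ray_def using zero_less_one by blast
    then have "(SOME w. w \<in> \<theta> j) \<in> ray (L j) (v j)" unfolding \<theta>[OF j] by (rule someI)
    then show ?thesis unfolding ray_def by blast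
  qed
  then obtain r where r: "\<And>j. j \<in> J \<Longrightarrow> r j > 0 \<and> (SOME w. w \<in> \<theta> j) = smul (L j) (complex_of_real (r j)) (v j)"
    by metis
  have "sign_map s I Di u (x, \<theta>) = sgn (f_strat s I u J (x, \<lambda>j\<in>J. SOME w. w \<in> \<theta> j))"
    by (simp add: sign_map_def Let_def stratum_eq[OF J x])
  also have "f_strat s I u J (x, \<lambda>j\<in>J. SOME w. w \<in> \<theta> j) =
      f_strat s I u J (x, \<lambda>j\<in>J. smul (L j) (complex_of_real (r j)) (v j))"
    using r by (intro f_strat_cong) auto
  also have "\<dots> = complex_of_real (\<Prod>j\<in>J. r j ^ N j) * f_strat s I u J (x, v)"
    by (simp add: f_strat_smul[OF u J x v])
  also have "sgn \<dots> = sgn (f_strat s I u J (x, v))"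
  proof -
    have "(\<Prod>j\<in>J. r j ^ N j) > 0" using r by (intro prod_pos) auto
    then have "sgn (complex_of_real (\<Prod>j\<in>J. r j ^ N j)) = 1" by (simp only: sgn_of_real sgn_pos of_real_1)
    then show ?thesis by (simp only: sgn_mult mult_1)
  qed
  finally show ?thesis .
qed

lemma lift_to_MD_top:
  assumes "J \<subseteq> I" "x \<in> strat J" "v \<in> frames J x"
  shows "(x, \<lambda>i\<in>I. ray (L i) (if i \<in> J then v i else s i x)) \<in> MD_top M L s I Di"
proof -
  have "ray (L i) (if i \<in> J then v i else s i x) \<in> circle_bundle (L i) x" if "i \<in> I" for i
    using completion_fibre_star[OF assms] that unfolding circle_bundle_def by (intro imageI) (auto simp: PiE_iff)
  then show ?thesis
    using assms stratum_pts[OF assms(2)] by (auto simp: MD_top_def stratum_def)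
qed

text \<open>This is the pullback of \<open>u\<close> along a local section of the full fibre
  product, made of frames for \<open>J\<close> and of the \<open>s i\<close> elsewhere. It is
  regular on an open subset of \<open>M\<close> and not merely on the stratum, as the local
  constancy result requires.\<close>

lemma regular_f_strat_along_frame:
  assumes u: "nowhere_vanishing_section_neg_tensor M L I N u" and "J \<subseteq> I"
    and U: "openin (zar M) U"
    and e: "\<And>j. j \<in> J \<Longrightarrow> morphism (subspace M U) (tot (L j)) (e j)"
      "\<And>j y. j \<in> J \<Longrightarrow> y \<in> U \<Longrightarrow> e j y \<in> fibre_star (L j) y"
  shows "(\<lambda>y. f_strat s I u J (y, \<lambda>j\<in>J. e j y)) \<in> reg M U"
proof -
  have pU: "pts (subspace M U) = U" using openin_subset[OF U] by auto
  let ?\<sigma> = "\<lambda>y. (y, \<lambda>i\<in>I. if i \<in> J then e i y else s i y)"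
  have \<sigma>: "morphism (subspace M U) (fibre_product M L I) ?\<sigma>"
  proof (rule morphism_into_fibre_product)
    show "space_with_functions (subspace M U)" by (rule space_with_functions_subspace)
    show "morphism (subspace M U) M (\<lambda>y. y)" by (rule morphism_subspace[OF M_swf])
    show "morphism (subspace M U) (tot (L i)) (\<lambda>y. (\<lambda>i\<in>I. if i \<in> J then e i y else s i y) i)"
      if "i \<in> I" for i
      using that e(1) morphism_compose[OF morphism_subspace[OF M_swf] section_morphism[OF that]]
      by (cases "i \<in> J") auto
    show "(\<lambda>i\<in>I. if i \<in> J then e i y else s i y) \<in> (\<Pi>\<^sub>E i\<in>I. fibre (L i) y)"
      if "y \<in> pts (subspace M U)" for y
    proof -
      have "y \<in> U" "y \<in> pts M" using that pU openin_subset[OF U] by auto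
      then show ?thesis using fibre_starD[OF e(2)] section_fibre by auto
    qed
  qed
  have "u \<in> reg (fibre_product M L I) (pts (fibre_product M L I))"
    using u unfolding nowhere_vanishing_section_neg_tensor_def by blast
  from morphism_reg[OF \<sigma> openin_topspace this]
  have "u \<circ> ?\<sigma> \<in> reg (subspace M U) {y \<in> pts (subspace M U). ?\<sigma> y \<in> pts (fibre_product M L I)}" .
  moreover have "{y \<in> pts (subspace M U). ?\<sigma> y \<in> pts (fibre_product M L I)} = U"
    using morphism_pts[OF \<sigma>] pU by blast
  ultimately have "u \<circ> ?\<sigma> \<in> reg M U"
    using open_subspace(2)[OF M_swf U, of U "u \<circ> ?\<sigma>"] open_subspace(1)[OF M_swf U, of U] U by simp
  then show ?thesis
    by (rule swf_cong[OF M_swf U]) (auto simp: f_strat_def intro!: arg_cong[of _ _ u] restrict_ext)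
qed

end

section \<open>Consequences of equal signs\<close>

lemma power_cis_inj:
  assumes "\<And>t. cis t ^ m = cis t ^ n"
  shows "m = n"
proof (rule ccontr)
  have *: False if "m < n" "\<And>t. cis t ^ m = cis t ^ n" for m n
  proof -
    have "cis t ^ (n - m) = 1" for t
    proof -
      have "cis t ^ m * cis t ^ (n - m) = cis t ^ n"
        using \<open>m < n\<close> by (simp add: power_add[symmetric])
      also have "\<dots> = cis t ^ m * 1" using that(2)[of t] by simp
      finally show ?thesis by (simp only: mult_cancel_left) simp
    qed
    \<comment> \<open>At the angle \<open>pi / (n - m)\<close> the power with exponent
      \<open>n - m\<close> is \<open>-1\<close>, not \<open>1\<close>.\<close>
    moreover have "real (n - m) * (pi / real (n - m)) = pi" using \<open>m < n\<close> by simp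
    ultimately have "cis pi = 1" using Complex.DeMoivre[of "pi / real (n - m)" "n - m"] by metis
    then show False by simp
  qed
  assume "m \<noteq> n"
  then show False using *[of m n] *[of n m] assms by (metis linorder_neqE_nat)
qed

lemma ratio_of_same_sgn:
  fixes a b :: complex
  assumes "sgn a = sgn b" "b \<noteq> 0"
  shows "a / b = complex_of_real (norm a / norm b)"
proof -
  have polar: "z = complex_of_real (norm z) * sgn z" for z :: complex
    by (cases "z = 0") (auto simp: sgn_div_norm scaleR_conv_of_real)
  have "a / b = (complex_of_real (norm a) * sgn b) / (complex_of_real (norm b) * sgn b)"
    using polar[of a] polar[of b] unfolding assms(1) by (rule arg_cong2)
  also have "\<dots> = complex_of_real (norm a / norm b)"
    using assms(2) by (simp add: sgn_zero_iff)
  finally show ?thesis .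
qed

text \<open>The locale is stated for an ordered pair of factorizations; it is instantiated a second
  time with the roles exchanged to obtain isomorphisms in the opposite direction.\<close>

locale snc_same_sign = snc M L s I Di
  for M :: "'a fspace" and L :: "'i \<Rightarrow> ('a, 'l) lbundle" and s :: "'i \<Rightarrow> 'a \<Rightarrow> 'l"
    and I :: "'i set" and Di :: "'i \<Rightarrow> 'a set" +
  fixes N N' :: "'i \<Rightarrow> nat" and u u' :: "'a \<times> ('i \<Rightarrow> 'l) \<Rightarrow> complex"
  assumes u: "nowhere_vanishing_section_neg_tensor M L I N u"
    and u': "nowhere_vanishing_section_neg_tensor M L I N' u'"
    and N_pos: "\<And>i. i \<in> I \<Longrightarrow> N i \<ge> 1"
    and same_sign: "\<And>x \<theta>. (x, \<theta>) \<in> MD_top M L s I Di \<Longrightarrow> x \<in> (\<Union>i\<in>I. Di i) \<Longrightarrow>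
           sign_map s I Di u (x, \<theta>) = sign_map s I Di u' (x, \<theta>)"
begin

text \<open>Every frame over the stratum determines a point of \<open>MD_top\<close> above
  \<open>x\<close>: its rays on \<open>J\<close>, and the forced rays of \<open>s i\<close>
  elsewhere. That \<open>J\<close> is nonempty places \<open>x\<close> on the divisor, where the
  signs are assumed equal.\<close>

lemma sgn_f_strat_eq:
  assumes J: "J \<subseteq> I" "J \<noteq> {}" and x: "x \<in> strat J" and v: "v \<in> frames J x"
  shows "sgn (f_strat s I u J (x, v)) = sgn (f_strat s I u' J (x, v))"
proof -
  let ?\<theta> = "\<lambda>i\<in>I. ray (L i) (if i \<in> J then v i else s i x)"
  have \<theta>: "?\<theta> j = ray (L j) (v j)" if "j \<in> J" for j using that J by auto
  have "x \<in> (\<Union>i\<in>I. Di i)" using J x by (auto simp: stratum_def)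
  then have "sign_map s I Di u (x, ?\<theta>) = sign_map s I Di u' (x, ?\<theta>)"
    by (intro same_sign lift_to_MD_top[OF J(1) x v])
  moreover have "sign_map s I Di u (x, ?\<theta>) = sgn (f_strat s I u J (x, v))"
    by (rule sign_map_eq[OF u J(1) x v \<theta>])
  moreover have "sign_map s I Di u' (x, ?\<theta>) = sgn (f_strat s I u' J (x, v))"
    by (rule sign_map_eq[OF u' J(1) x v \<theta>])
  ultimately show ?thesis by (simp only:)
qed

lemma N_eq:
  assumes j: "j \<in> I"
  shows "N j = N' j"
proof (rule power_cis_inj)
  fix t
  \<comment> \<open>A point of \<open>Di j\<close> exists because hypersurfaces are nonempty; taking
    for \<open>J\<close> all components through it puts it in the stratum of \<open>J\<close>, where
    the coordinate of \<open>j\<close> can be rotated freely.\<close>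
  obtain x where "x \<in> Di j" using nonempty_Di[OF j] by blast
  then have xM: "x \<in> pts M" using closedin_subset[OF closed_Di[OF j]] by blast
  define J where "J = {i\<in>I. x \<in> Di i}"
  have J: "J \<subseteq> I" "j \<in> J" using j \<open>x \<in> Di j\<close> by (auto simp: J_def)
  have x: "x \<in> strat J" using xM by (auto simp: J_def stratum_def)
  obtain v where v: "v \<in> frames J x" using frames_nonempty[OF J(1) xM] by blast
  let ?c = "\<lambda>i. if i = j then cis t else 1"
  let ?w = "\<lambda>i\<in>J. smul (L i) (?c i) (v i)"
  have fin: "finite J" using J(1) finite_I finite_subset by blast
  have pr: "(\<Prod>i\<in>J. ?c i ^ n i) = cis t ^ n j" for n :: "'i \<Rightarrow> nat"
    using J(2) fin by (subst prod.remove[OF fin J(2)]) (auto intro!: prod.neutral)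
  have w: "?w \<in> frames J x" by (rule frames_smul[OF J(1) v]) auto
  have cis: "sgn (cis t ^ n) = cis t ^ n" for n by (simp add: sgn_div_norm norm_power)
  have "sgn (f_strat s I u J (x, ?w)) = sgn (f_strat s I u' J (x, ?w))"
    using J by (intro sgn_f_strat_eq x w) auto
  then have "cis t ^ N j * sgn (f_strat s I u J (x, v)) = cis t ^ N' j * sgn (f_strat s I u' J (x, v))"
    unfolding f_strat_smul[OF u J(1) x v] f_strat_smul[OF u' J(1) x v] pr sgn_mult cis .
  moreover have "sgn (f_strat s I u J (x, v)) = sgn (f_strat s I u' J (x, v))"
    using J by (intro sgn_f_strat_eq x v) auto
  moreover have "sgn (f_strat s I u' J (x, v)) \<noteq> 0"
    using f_strat_nonzero[OF u' J(1) x v] by (simp add: sgn_zero_iff)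
  ultimately show "cis t ^ N j = cis t ^ N' j" by simp
qed

definition ratio :: "'i set \<Rightarrow> 'a \<Rightarrow> complex" where
  "ratio J x = (let v = SOME v. v \<in> frames J x in f_strat s I u J (x, v) / f_strat s I u' J (x, v))"

text \<open>Changing the frame multiplies numerator and denominator by the same nonzero product,
  because the multiplicities agree by \<open>N_eq\<close>; the arbitrary choice in
  \<open>ratio\<close> is therefore harmless.\<close>

lemma ratio_eq:
  assumes J: "J \<subseteq> I" and x: "x \<in> strat J" and v: "v \<in> frames J x"
  shows "ratio J x = f_strat s I u J (x, v) / f_strat s I u' J (x, v)"
proof -
  let ?w = "SOME v. v \<in> frames J x"
  have "?w \<in> frames J x" by (rule someI[of "\<lambda>v. v \<in> frames J x", OF v])
  from frames_ratio[OF J v this] obtain c where c: "\<forall>j\<in>J. c j \<noteq> 0" "?w = (\<lambda>j\<in>J. smul (L j) (c j) (v j))"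
    by blast
  have "(\<Prod>j\<in>J. c j ^ N' j) \<noteq> 0" using c(1) finite_subset[OF J finite_I] by auto
  moreover have "(\<Prod>j\<in>J. c j ^ N j) = (\<Prod>j\<in>J. c j ^ N' j)"
    using J by (intro prod.cong refl) (auto simp: N_eq)
  ultimately show ?thesis
    unfolding ratio_def Let_def c(2) f_strat_smul[OF u J x v] f_strat_smul[OF u' J x v] by simp
qed

lemma ratio_pos:
  assumes J: "J \<subseteq> I" "J \<noteq> {}" and x: "x \<in> strat J"
  shows "\<exists>r>0. ratio J x = complex_of_real r"
proof -
  obtain v where v: "v \<in> frames J x" using frames_nonempty[OF J(1) stratum_pts[OF x]] by blast
  have "ratio J x = complex_of_real (norm (f_strat s I u J (x, v)) / norm (f_strat s I u' J (x, v)))"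
    unfolding ratio_eq[OF J(1) x v]
    by (intro ratio_of_same_sgn sgn_f_strat_eq f_strat_nonzero[OF u'] J x v)
  moreover have "norm (f_strat s I u J (x, v)) / norm (f_strat s I u' J (x, v)) > 0"
    using f_strat_nonzero[OF u J(1) x v] f_strat_nonzero[OF u' J(1) x v] by simp
  ultimately show ?thesis by blast
qed

text \<open>Along a local frame the ratio is the restriction of a regular function on an open subset
  of \<open>M\<close>, and the stratum is closed in the complement of the components outside
  \<open>J\<close>. The local constancy result then applies to this locally closed set.\<close>

lemma ratio_locally_constant:
  assumes J: "J \<subseteq> I" "J \<noteq> {}" and x: "x \<in> strat J"
  shows "\<exists>U. openin (zar M) U \<and> x \<in> U \<and> (\<forall>y\<in>strat J \<inter> U. ratio J y = ratio J x)"
proof -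
  have "\<exists>U e. openin (zar M) U \<and> x \<in> U \<and>
      (\<forall>j\<in>J. morphism (subspace M U) (tot (L j)) (e j) \<and> (\<forall>y\<in>U. e j y \<in> fibre_star (L j) y))"
    using J(1) finite_subset[OF J(1) finite_I] line_bundle_L stratum_pts[OF x]
    by (intro line_bundles_local_frame[OF M_swf]) auto
  then obtain U e where U: "openin (zar M) U" "x \<in> U"
    and e: "\<And>j. j \<in> J \<Longrightarrow> morphism (subspace M U) (tot (L j)) (e j)"
      "\<And>j y. j \<in> J \<Longrightarrow> y \<in> U \<Longrightarrow> e j y \<in> fibre_star (L j) y" by auto
  define F where "F = (\<lambda>y. f_strat s I u J (y, \<lambda>j\<in>J. e j y))"
  define F' where "F' = (\<lambda>y. f_strat s I u' J (y, \<lambda>j\<in>J. e j y))"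
  have F: "F \<in> reg M U" "F' \<in> reg M U"
    unfolding F_def F'_def
    by (rule regular_f_strat_along_frame[OF u J(1) U(1) e] regular_f_strat_along_frame[OF u' J(1) U(1) e]; assumption)+
  have ev: "(\<lambda>j\<in>J. e j y) \<in> frames J y" if "y \<in> U" for y using e(2) that by auto
  define C where "C = {y \<in> pts M. \<forall>j\<in>J. y \<in> Di j}"
  have C: "closedin (zar M) C"
  proof -
    have "closedin (zar M) (\<Inter>j\<in>J. Di j)" using J closed_Di by (intro closedin_INT) auto
    moreover have "(\<Inter>j\<in>J. Di j) = C"
      using J closedin_subset[OF closed_Di] by (auto simp: C_def)
    ultimately show ?thesis by simp
  qed
  define W0 where "W0 = {y \<in> pts M. \<forall>i\<in>I - J. y \<notin> Di i}"
  have W0: "openin (zar M) W0"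
  proof -
    have "closedin (zar M) (\<Union>i\<in>I - J. Di i)" using finite_I closed_Di by (intro closedin_Union) auto
    then have "openin (zar M) (pts M - (\<Union>i\<in>I - J. Di i))" by blast
    moreover have "pts M - (\<Union>i\<in>I - J. Di i) = W0" by (auto simp: W0_def)
    ultimately show ?thesis by simp
  qed
  have SC: "strat J = C \<inter> W0" by (auto simp: stratum_def C_def W0_def)
  define W where "W = {y \<in> U. F' y \<noteq> 0} \<inter> W0"
  have U': "openin (zar M) {y \<in> U. F' y \<noteq> 0}" by (rule swf_nonzero[OF M_swf U(1) F(2)])
  have W: "openin (zar M) W" unfolding W_def using U' W0 by blast
  have h: "(\<lambda>y. F y * inverse (F' y)) \<in> reg M W"
  proof (rule swf_restrict[OF M_swf U' _ W])
    show "(\<lambda>y. F y * inverse (F' y)) \<in> reg M {y \<in> U. F' y \<noteq> 0}"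
      by (intro swf_mult[OF M_swf U'] swf_inverse[OF M_swf U(1) F(2)] swf_restrict[OF M_swf U(1) F(1) U']) auto
  qed (auto simp: W_def)
  have rat: "F y * inverse (F' y) = ratio J y" if "y \<in> strat J" "y \<in> U" for y
    using ratio_eq[OF J(1) that(1) ev[OF that(2)]] by (simp add: F_def F'_def divide_inverse)
  have xCW: "x \<in> C \<inter> W"
    using x U(2) f_strat_nonzero[OF u' J(1) x ev[OF U(2)]] by (auto simp: SC W_def F'_def)
  \<comment> \<open>Any uncountable set disjoint from the positive reals would serve as the set of
    omitted values.\<close>
  have "uncountable (complex_of_real ` {-1<..<0})"
    using uncountable_open_interval[of "-1" 0] countable_image_inj_eq[of complex_of_real "{-1<..<0}"]
    by (auto simp: inj_on_def)
  moreover have "F y * inverse (F' y) \<notin> complex_of_real ` {-1<..<0}" if "y \<in> C \<inter> W" for y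
    using that rat[of y] ratio_pos[OF J, of y] by (auto simp: SC W_def)
  ultimately obtain V' where V': "openin (zar M) V'" "x \<in> V'" "V' \<subseteq> W"
    "\<forall>y\<in>C \<inter> V'. F y * inverse (F' y) = F x * inverse (F' x)"
    using regular_function_locally_constant[OF variety C W h xCW] by metis
  have "ratio J y = ratio J x" if "y \<in> strat J \<inter> V'" for y
  proof -
    have "y \<in> U" "y \<in> C" using that V'(3) by (auto simp: W_def SC)
    then show ?thesis using rat[of y] rat[OF x U(2)] V'(4) that by auto
  qed
  then show ?thesis using V'(1,2) by blast
qed

lemma milnor_gvar_iso:
  assumes J: "J \<subseteq> I" "J \<noteq> {}"
  shows "gvar_iso (milnor_gvar M L s I Di u J k) (milnor_gvar M L s I Di u' J k)"
proof -
  let ?X = "L_star M L I Di J"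
  obtain j where j: "j \<in> J" using J(2) by blast
  then have jI: "j \<in> I" using J(1) by blast
  have LJ: "line_bundle M (L i)" if "i \<in> J" for i using that J(1) line_bundle_L by blast
  have fin: "finite J" using J(1) finite_I finite_subset by blast
  have Nj: "N j > 0" using N_pos[OF jI] by simp
  \<comment> \<open>The positive real root is a function of the ratio alone, so it inherits local
    constancy; a free choice of complex roots at the individual points would not.\<close>
  define \<rho> where "\<rho> x = complex_of_real (root (N j) (Re (ratio J x)))" for x
  have \<rho>: "\<rho> x \<noteq> 0" "\<rho> x ^ N j = ratio J x" if x: "x \<in> strat J" for x
  proof -
    obtain r where r: "r > 0" "ratio J x = complex_of_real r" using ratio_pos[OF J x] by blast
    then show "\<rho> x \<noteq> 0" using Nj by (simp add: \<rho>_def)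
    show "\<rho> x ^ N j = ratio J x" using r Nj by (simp add: \<rho>_def of_real_power[symmetric] del: of_real_power)
  qed
  have loc: "\<exists>V. openin (zar M) V \<and> x \<in> V \<and> (\<forall>y\<in>strat J \<inter> V. \<rho> y = \<rho> x)" if "x \<in> strat J" for x
    using ratio_locally_constant[OF J that] by (auto simp: \<rho>_def)
  have loc': "\<exists>V. openin (zar M) V \<and> x \<in> V \<and> (\<forall>y\<in>strat J \<inter> V. inverse (\<rho> y) = inverse (\<rho> x))"
    if "x \<in> strat J" for x
    using loc[OF that] by auto
  let ?\<phi> = "rescale L j \<rho>" and ?\<psi> = "rescale L j (\<lambda>x. inverse (\<rho> x))"
  have \<phi>: "morphism ?X ?X ?\<phi>" by (rule morphism_rescale[OF M_swf LJ j \<rho>(1) loc])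
  have \<psi>: "morphism ?X ?X ?\<psi>" by (rule morphism_rescale[OF M_swf LJ j _ loc']) (use \<rho>(1) in auto)
  have fib: "v j \<in> fibre (L j) x" if "(x, v) \<in> pts ?X" for x v
    using that j by (intro fibre_starD) (auto simp: pts_L_star)
  have inv: "?\<psi> (?\<phi> p) = p" "?\<phi> (?\<psi> p) = p" if "p \<in> pts ?X" for p
  proof -
    obtain x v where p: "p = (x, v)" by (cases p)
    have x: "\<rho> x \<noteq> 0" using that \<rho>(1) by (auto simp: p pts_L_star)
    note f = fib[OF that[unfolded p]]
    show "?\<psi> (?\<phi> p) = p" "?\<phi> (?\<psi> p) = p"
      using x by (simp_all add: p rescale_def smul_smul[OF LJ[OF j] f] smul_one[OF LJ[OF j] f])
  qed
  have iso: "isomorphism ?X ?X ?\<phi>"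
    unfolding isomorphism_def using \<phi> \<psi> inv by blast
  \<comment> \<open>The action fixes the base point, on which \<open>\<rho>\<close> depends, and
    scalars commute; equivariance thus holds for arbitrary weights \<open>k\<close>.\<close>
  have act: "?\<phi> (x, \<lambda>i\<in>J. smul (L i) (z ^ k i) (v i)) = (x, \<lambda>i\<in>J. smul (L i) (z ^ k i) ((snd (?\<phi> (x, v))) i))"
    if "(x, v) \<in> pts ?X" for x v z
    using j fib[OF that]
    by (auto simp: rescale_def fun_eq_iff smul_smul[OF LJ[OF j] fib[OF that]] mult.commute)
  have str: "f_strat s I u' J (?\<phi> (x, v)) = f_strat s I u J (x, v)" if "(x, v) \<in> pts ?X" for x v
  proof -
    have x: "x \<in> strat J" and v: "v \<in> frames J x" using that by (auto simp: pts_L_star)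
    let ?c = "\<lambda>i. if i = j then \<rho> x else 1"
    have "f_strat s I u' J (?\<phi> (x, v)) = f_strat s I u' J (x, \<lambda>i\<in>J. smul (L i) (?c i) (v i))"
      unfolding rescale_def prod.case
      using v smul_one[OF LJ fibre_starD] by (intro f_strat_cong) (auto simp: PiE_iff)
    also have "\<dots> = (\<Prod>i\<in>J. ?c i ^ N' i) * f_strat s I u' J (x, v)"
      by (rule f_strat_smul[OF u' J(1) x v])
    \<comment> \<open>The root was taken of order \<open>N j\<close>, whereas the homogeneity here
      has degree \<open>N' j\<close>; \<open>N_eq\<close> reconciles the two.\<close>
    also have "(\<Prod>i\<in>J. ?c i ^ N' i) = \<rho> x ^ N j"
      by (subst prod.remove[OF fin j]) (auto intro!: prod.neutral simp: N_eq[OF jI])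
    also have "\<dots> * f_strat s I u' J (x, v) = f_strat s I u J (x, v)"
      unfolding \<rho>(2)[OF x] ratio_eq[OF J(1) x v] using f_strat_nonzero[OF u' J(1) x v] by simp
    finally show ?thesis .
  qed
  have fst: "fst (?\<phi> p) = fst p" for p by (simp add: rescale_def case_prod_beta)
  show ?thesis
    unfolding gvar_iso_def
  proof (intro exI[of _ ?\<phi>] conjI allI ballI impI)
    show "isomorphism (var (milnor_gvar M L s I Di u J k)) (var (milnor_gvar M L s I Di u' J k)) ?\<phi>"
      using iso by (simp add: milnor_gvar_def)
    fix p assume "p \<in> pts (var (milnor_gvar M L s I Di u J k))"
    then obtain x v where p: "p = (x, v)" "(x, v) \<in> pts ?X" by (cases p) (simp add: milnor_gvar_def)
    show "?\<phi> (act (milnor_gvar M L s I Di u J k) z p) = act (milnor_gvar M L s I Di u' J k) z (?\<phi> p)" for z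
      using act[OF p(2), of z] fst[of p] by (simp add: milnor_gvar_def p(1) case_prod_beta)
    show "str (milnor_gvar M L s I Di u' J k) (?\<phi> p) = str (milnor_gvar M L s I Di u J k) p"
      using str[OF p(2)] by (simp add: milnor_gvar_def p(1) rescale_def)
  qed
qed

end

section \<open>From isomorphic objects to equal classes\<close>

lemma gvar_iso_trans:
  assumes "gvar_iso X Y" "gvar_iso Y Z"
  shows "gvar_iso X Z"
proof -
  obtain \<phi> \<phi>' where \<phi>: "morphism (var X) (var Y) \<phi>" "morphism (var Y) (var X) \<phi>'"
      "\<forall>x\<in>pts (var X). \<phi>' (\<phi> x) = x" "\<forall>y\<in>pts (var Y). \<phi> (\<phi>' y) = y"
      "\<forall>z. \<forall>x\<in>pts (var X). z \<noteq> 0 \<longrightarrow> \<phi> (act X z x) = act Y z (\<phi> x)"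
      "\<forall>x\<in>pts (var X). str Y (\<phi> x) = str X x"
    using assms(1) unfolding gvar_iso_def isomorphism_def by (elim exE conjE)
  obtain \<eta> \<eta>' where \<eta>: "morphism (var Y) (var Z) \<eta>" "morphism (var Z) (var Y) \<eta>'"
      "\<forall>x\<in>pts (var Y). \<eta>' (\<eta> x) = x" "\<forall>y\<in>pts (var Z). \<eta> (\<eta>' y) = y"
      "\<forall>z. \<forall>x\<in>pts (var Y). z \<noteq> 0 \<longrightarrow> \<eta> (act Y z x) = act Z z (\<eta> x)"
      "\<forall>x\<in>pts (var Y). str Z (\<eta> x) = str Y x"
    using assms(2) unfolding gvar_iso_def isomorphism_def by (elim exE conjE)
  show ?thesis
    unfolding gvar_iso_def isomorphism_def
    using morphism_pts[OF \<phi>(1)] morphism_pts[OF \<eta>(2)] \<phi>(3-6) \<eta>(3-6)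
    by (intro exI[of _ "\<lambda>x. \<eta> (\<phi> x)"] conjI exI[of _ "\<lambda>x. \<phi>' (\<eta>' x)"]
        morphism_compose[OF \<phi>(1) \<eta>(1)] morphism_compose[OF \<eta>(2) \<phi>(2)]) auto
qed

text \<open>Transitivity gives one inclusion from each hypothesis. Both directions are available in
  the application by exchanging the two functions.\<close>

lemma iso_class_eq:
  assumes "gvar_iso X Y" "gvar_iso Y X"
  shows "iso_class B n X = iso_class B n Y"
  using gvar_iso_trans[OF assms(1)] gvar_iso_trans[OF assms(2)] by (auto simp: iso_class_def)

text \<open>A derivation of membership in \<open>foldSetD\<close> evaluates the function only at the
  elements it inserts, all of which belong to \<open>A\<close>.\<close>

lemma foldSetD_cong:
  assumes "(A, y) \<in> foldSetD D f e" "\<And>x. x \<in> A \<Longrightarrow> f x = g x"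
  shows "(A, y) \<in> foldSetD D g e"
  using assms
proof (induction rule: foldSetD.induct)
  case emptyI
  show ?case by (rule foldSetD.emptyI[OF emptyI(1)])
next
  case (insertI x A y)
  then have "(A, y) \<in> foldSetD D g e" "f x = g x" by auto
  then show ?case using insertI(1,2) foldSetD.insertI[of x A g y D e] by simp
qed

text \<open>The library's \<open>finprod_cong\<close> would require a proof that \<open>K0\<close> is a commutative monoid.\<close>

lemma finprod_cong_raw:
  assumes "\<And>x. x \<in> A \<Longrightarrow> f x = g x"
  shows "finprod G f A = finprod G g A"
proof -
  have "(A, y) \<in> foldSetD (carrier G) (mult G \<circ> f) \<one>\<^bsub>G\<^esub> \<longleftrightarrow>
        (A, y) \<in> foldSetD (carrier G) (mult G \<circ> g) \<one>\<^bsub>G\<^esub>" for y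
    by (rule iffI; erule foldSetD_cong) (use assms in auto)
  then show ?thesis by (simp add: finprod_def foldD_def)
qed

theorem theorem2:
  fixes M :: "'a fspace"
    and L :: "'i \<Rightarrow> ('a, 'l) lbundle"
    and s :: "'i \<Rightarrow> 'a \<Rightarrow> 'l"
    and I :: "'i set"
    and D :: "'a set" and Di :: "'i \<Rightarrow> 'a set"
    and f g :: "'a \<Rightarrow> complex"
    and N N' :: "'i \<Rightarrow> nat"
    and u u' :: "'a \<times> ('i \<Rightarrow> 'l) \<Rightarrow> complex"
    and k :: "'i set \<Rightarrow> 'i \<Rightarrow> nat"
  assumes "variety M" and "nonsingular M"
    and "D = (\<Union>i\<in>I. Di i)" and "snc_data M L s I Di"
    and "f \<in> reg M (pts M)" and "{x \<in> pts M. f x = 0} = D" and "factorization M L s I f N u"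
    and "g \<in> reg M (pts M)" and "{x \<in> pts M. g x = 0} = D" and "factorization M L s I g N' u'"
    and "\<And>J j. J \<subseteq> I \<Longrightarrow> j \<in> J \<Longrightarrow> k J j \<ge> 1"
    and "\<And>x \<theta>. (x, \<theta>) \<in> MD_top M L s I Di \<Longrightarrow> x \<in> D \<Longrightarrow>
           sign_map s I Di u (x, \<theta>) = sign_map s I Di u' (x, \<theta>)"
  shows "motivic_milnor_fibre M L s I Di k N u = motivic_milnor_fibre M L s I Di k N' u'"
proof -
  interpret fg: snc_same_sign M L s I Di N N' u u'
    using assms by unfold_locales (auto simp: factorization_def)
  interpret gf: snc_same_sign M L s I Di N' N u' u
    using assms by unfold_locales (auto simp: factorization_def)
  let ?B = "subspace M (\<Union>i\<in>I. Di i)"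
  have "K0_class ?B (\<Sum>j\<in>J. k J j * N j) (milnor_gvar M L s I Di u J (k J)) =
        K0_class ?B (\<Sum>j\<in>J. k J j * N' j) (milnor_gvar M L s I Di u' J (k J))"
    if J: "J \<subseteq> I" "J \<noteq> {}" for J
  proof -
    \<comment> \<open>The level is part of a representative in the direct limit, so equality of the
      multiplicities is needed here as well as for the isomorphism.\<close>
    have "(\<Sum>j\<in>J. k J j * N j) = (\<Sum>j\<in>J. k J j * N' j)"
      using J by (intro sum.cong refl) (auto simp: fg.N_eq)
    moreover have "iso_class ?B n (milnor_gvar M L s I Di u J (k J)) =
        iso_class ?B n (milnor_gvar M L s I Di u' J (k J))" for n
      by (intro iso_class_eq fg.milnor_gvar_iso gf.milnor_gvar_iso J)
    ultimately show ?thesis by (simp add: K0_class_def class_level_def)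
  qed
  then show ?thesis
    unfolding motivic_milnor_fibre_def Let_def
    by (intro arg_cong[where f = "m_inv (K0 ?B)"] finprod_cong_raw) auto
qed

end
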